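(* Let $d\in\mathbb{N}$, $d\geq 1$, let $p>d$ and $\mathcal{E}>0$. There exists a complex-valued function $V\in L^{\infty}(\mathbb{R}^d)\cap L^p(\mathbb{R}^d)$ with $\max\{\|V\|_{\infty},\|V\|_p\}\leq \mathcal{E}$ that decays at infinity such that the Schrödinger operator $$H:=-\Delta+V \quad\text{in } L^2(\mathbb{R}^d),\qquad \mathcal{D}(H):=W^{2,2}(\mathbb{R}^d),$$ has infinitely many eigenvalues in the open lower complex half-plane $\{z\in\mathbb{C}:\operatorname{Im} z<0\}$ that accumulate at every point in $[0,\infty)$.
   Context: $L^2(\mathbb{R}^d)$ is the complex Hilbert space of square-integrable functions, and $W^{2,2}(\mathbb{R}^d)$ is the $L^2$-based Sobolev space of order 2. The potential $V$ acts as a multiplication operator. $\mathcal{D}(H)$ denotes the operator domain. "$V$ decays at infinity" means $V(x)\to 0$ as $|x|\to\infty$ (up to null sets). "Accumulate at every point in $[0,\infty)$" means that every $\lambda\in[0,\infty)$ is an accumulation point of the set of eigenvalues of $H$ lying in the open lower half-plane. *)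

theory Defs
  imports "HOL-Analysis.Analysis" "HOL-Probability.Essential_Supremum"
begin

section \<open>Lebesgue spaces\<close>

text \<open>Elements of Lebesgue spaces are represented by functions; two functions represent the same
  element iff they agree almost everywhere.\<close>

definition Lp_space :: "real \<Rightarrow> ('a::euclidean_space \<Rightarrow> complex) set" where
  "Lp_space p = {f \<in> borel_measurable lebesgue. integrable lebesgue (\<lambda>x. cmod (f x) powr p)}"

definition Lp_norm :: "real \<Rightarrow> ('a::euclidean_space \<Rightarrow> complex) \<Rightarrow> real" where
  "Lp_norm p f = (LINT x|lebesgue. cmod (f x) powr p) powr (1 / p)"

definition Linf_space :: "('a::euclidean_space \<Rightarrow> complex) set" where
  "Linf_space = {f \<in> borel_measurable lebesgue. esssup lebesgue (\<lambda>x. ereal (cmod (f x))) < \<infinity>}"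

definition Linf_norm :: "('a::euclidean_space \<Rightarrow> complex) \<Rightarrow> real" where
  "Linf_norm f = real_of_ereal (esssup lebesgue (\<lambda>x. ereal (cmod (f x))))"

definition decays_at_infinity :: "('a::euclidean_space \<Rightarrow> complex) \<Rightarrow> bool" where
  "decays_at_infinity f \<longleftrightarrow>
     (\<forall>\<epsilon>>0. \<exists>R. AE x in lebesgue. norm x \<ge> R \<longrightarrow> cmod (f x) \<le> \<epsilon>)"

definition locally_integrable :: "('a::euclidean_space \<Rightarrow> complex) \<Rightarrow> bool" where
  "locally_integrable f \<longleftrightarrow> (\<forall>K. compact K \<longrightarrow> set_integrable lebesgue K f)"


section \<open>Test functions, weak derivatives and Sobolev spaces\<close>

definition partial_deriv :: "'n::finite \<Rightarrow> (real ^ 'n \<Rightarrow> complex) \<Rightarrow> real ^ 'n \<Rightarrow> complex" where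
  "partial_deriv i f x = frechet_derivative f (at x) (axis i 1)"

text \<open>A multi-index is given by a list of coordinate directions, its order being the length of the
  list. For smooth functions the order of the entries is irrelevant.\<close>

definition partial_derivs :: "'n::finite list \<Rightarrow> (real ^ 'n \<Rightarrow> complex) \<Rightarrow> real ^ 'n \<Rightarrow> complex" where
  "partial_derivs is f = foldr partial_deriv is f"

primrec C_k :: "nat \<Rightarrow> (real ^ 'n::finite \<Rightarrow> complex) \<Rightarrow> bool" where
  "C_k 0 f \<longleftrightarrow> continuous_on UNIV f"
| "C_k (Suc k) f \<longleftrightarrow> f differentiable_on UNIV \<and> (\<forall>i. C_k k (partial_deriv i f))"

definition test_fun :: "(real ^ 'n::finite \<Rightarrow> complex) \<Rightarrow> bool" where
  "test_fun \<phi> \<longleftrightarrow> (\<forall>k. C_k k \<phi>) \<and> compact (closure {x. \<phi> x \<noteq> 0})"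

definition has_weak_deriv ::
    "'n::finite list \<Rightarrow> (real ^ 'n \<Rightarrow> complex) \<Rightarrow> (real ^ 'n \<Rightarrow> complex) \<Rightarrow> bool" where
  "has_weak_deriv is f g \<longleftrightarrow> locally_integrable f \<and> locally_integrable g \<and>
     (\<forall>\<phi>. test_fun \<phi> \<longrightarrow>
        (LINT x|lebesgue. f x * partial_derivs is \<phi> x)
          = (- 1) ^ length is * (LINT x|lebesgue. g x * \<phi> x))"

definition sobolev_space :: "nat \<Rightarrow> real \<Rightarrow> (real ^ 'n::finite \<Rightarrow> complex) set" where
  "sobolev_space k p = {f \<in> Lp_space p.
     \<forall>is. length is \<le> k \<longrightarrow> (\<exists>g \<in> Lp_space p. has_weak_deriv is f g)}"


section \<open>Schroedinger operators and eigenvalues\<close>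

text \<open>An operator in $L^2$ is given by its graph, up to equality almost everywhere. A pair
  \<open>(f, g)\<close> belongs to the graph of \<open>-\<Delta> + V\<close> iff \<open>f\<close> lies in
  $W^{2,2}$ and \<open>g\<close> represents the $L^2$ function \<open>-\<Delta> f + V f\<close>, where
  \<open>h i\<close> is the weak derivative of \<open>f\<close> taken twice in direction \<open>i\<close>.\<close>

definition schroedinger_op ::
    "(real ^ 'n::finite \<Rightarrow> complex) \<Rightarrow> ((real ^ 'n \<Rightarrow> complex) \<times> (real ^ 'n \<Rightarrow> complex)) set" where
  "schroedinger_op V = {(f, g). f \<in> sobolev_space 2 2 \<and> g \<in> Lp_space 2 \<and>
     (\<exists>h. (\<forall>i. h i \<in> Lp_space 2 \<and> has_weak_deriv [i, i] f (h i)) \<and>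
          (AE x in lebesgue. g x = - (\<Sum>i\<in>UNIV. h i x) + V x * f x))}"

definition eigenvalue ::
    "(('a::euclidean_space \<Rightarrow> complex) \<times> ('a \<Rightarrow> complex)) set \<Rightarrow> complex \<Rightarrow> bool" where
  "eigenvalue T \<mu> \<longleftrightarrow>
     (\<exists>f g. (f, g) \<in> T \<and> \<not> (AE x in lebesgue. f x = 0) \<and> (AE x in lebesgue. g x = \<mu> * f x))"


section \<open>For bounded potentials, the domain of the operator is the Sobolev space\<close>

lemma L2_eq: "Lp_space 2 = {f \<in> borel_measurable lebesgue. integrable lebesgue (\<lambda>x. (cmod (f x))\<^sup>2)}"
  by (simp add: Lp_space_def)

lemma L2_add:
  assumes "f \<in> Lp_space 2" "g \<in> Lp_space 2"
  shows "(\<lambda>x. f x + g x) \<in> Lp_space 2"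
proof -
  have [measurable]: "f \<in> borel_measurable lebesgue" "g \<in> borel_measurable lebesgue"
    and "integrable lebesgue (\<lambda>x. (cmod (f x))\<^sup>2)" "integrable lebesgue (\<lambda>x. (cmod (g x))\<^sup>2)"
    using assms by (auto simp: L2_eq)
  then have i: "integrable lebesgue (\<lambda>x. 2 * (cmod (f x))\<^sup>2 + 2 * (cmod (g x))\<^sup>2)"
    by simp
  have le: "(cmod (f x + g x))\<^sup>2 \<le> 2 * (cmod (f x))\<^sup>2 + 2 * (cmod (g x))\<^sup>2" for x
  proof -
    have "(cmod (f x + g x))\<^sup>2 \<le> (cmod (f x) + cmod (g x))\<^sup>2"
      by (intro power_mono norm_triangle_ineq) auto
    also have "\<dots> \<le> 2 * (cmod (f x))\<^sup>2 + 2 * (cmod (g x))\<^sup>2"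
      using zero_le_power2[of "cmod (f x) - cmod (g x)"] by (simp add: power2_eq_square algebra_simps)
    finally show ?thesis .
  qed
  have "integrable lebesgue (\<lambda>x. (cmod (f x + g x))\<^sup>2)"
    by (rule Bochner_Integration.integrable_bound[OF i]) (use le in \<open>auto intro!: AE_I2\<close>)
  then show ?thesis by (simp add: L2_eq)
qed

lemma L2_bounded_mult:
  assumes "V \<in> Linf_space" "f \<in> Lp_space 2"
  shows "(\<lambda>x. V x * f x) \<in> Lp_space 2"
proof -
  have [measurable]: "V \<in> borel_measurable lebesgue" "f \<in> borel_measurable lebesgue"
    and fin: "esssup lebesgue (\<lambda>x. ereal (cmod (V x))) < \<infinity>"
    and i: "integrable lebesgue (\<lambda>x. (cmod (f x))\<^sup>2)"
    using assms by (auto simp: L2_eq Linf_space_def)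
  obtain C :: real where C: "esssup lebesgue (\<lambda>x. ereal (cmod (V x))) \<le> ereal C"
    using fin less_PInf_Ex_of_nat[of "esssup lebesgue (\<lambda>x. ereal (cmod (V x)))"] less_imp_le by fastforce
  have AE: "AE x in lebesgue. cmod (V x) \<le> C"
    using esssup_AE[of "\<lambda>x. ereal (cmod (V x))" lebesgue] by eventually_elim (use C order_trans in fastforce)
  have iC: "integrable lebesgue (\<lambda>x. C\<^sup>2 * (cmod (f x))\<^sup>2)"
    using i by simp
  have "integrable lebesgue (\<lambda>x. (cmod (V x * f x))\<^sup>2)"
  proof (rule Bochner_Integration.integrable_bound[OF iC])
    show "AE x in lebesgue. norm ((cmod (V x * f x))\<^sup>2) \<le> norm (C\<^sup>2 * (cmod (f x))\<^sup>2)"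
      using AE
    proof eventually_elim
      case (elim x)
      have "(cmod (V x))\<^sup>2 \<le> C\<^sup>2" using elim by (intro power_mono) auto
      then show ?case by (simp add: norm_mult power_mult_distrib mult_right_mono)
    qed
  qed measurable
  then show ?thesis by (simp add: L2_eq)
qed

lemma L2_uminus: "f \<in> Lp_space 2 \<Longrightarrow> (\<lambda>x. - f x) \<in> Lp_space 2"
  by (simp add: L2_eq)

lemma L2_sum: "finite I \<Longrightarrow> (\<And>i. i \<in> I \<Longrightarrow> h i \<in> Lp_space 2) \<Longrightarrow> (\<lambda>x. \<Sum>i\<in>I. h i x) \<in> Lp_space 2"
proof (induction I rule: finite_induct)
  case empty
  then show ?case by (simp add: L2_eq)
next
  case (insert a I)
  then show ?case using L2_add[of "h a" "\<lambda>x. \<Sum>i\<in>I. h i x"] by simp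
qed

lemma Domain_schroedinger_op:
  fixes V :: "real ^ 'n::finite \<Rightarrow> complex"
  assumes "V \<in> Linf_space"
  shows "Domain (schroedinger_op V) = sobolev_space 2 2"
proof
  show "Domain (schroedinger_op V) \<subseteq> sobolev_space 2 2"
    by (auto simp: schroedinger_op_def)
next
  show "sobolev_space 2 2 \<subseteq> Domain (schroedinger_op V)"
  proof
    fix f :: "real ^ 'n \<Rightarrow> complex"
    assume f: "f \<in> sobolev_space 2 2"
    then have "\<forall>i. \<exists>g \<in> Lp_space 2. has_weak_deriv [i, i] f g"
      by (simp add: sobolev_space_def)
    then obtain h where h: "\<And>i. h i \<in> Lp_space 2" "\<And>i. has_weak_deriv [i, i] f (h i)"
      by metis
    have "f \<in> Lp_space 2" using f by (simp add: sobolev_space_def)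
    then have "(\<lambda>x. - (\<Sum>i\<in>UNIV. h i x) + V x * f x) \<in> Lp_space 2"
      by (intro L2_add L2_uminus L2_sum L2_bounded_mult assms h) auto
    then have "(f, \<lambda>x. - (\<Sum>i\<in>UNIV. h i x) + V x * f x) \<in> schroedinger_op V"
      unfolding schroedinger_op_def using f h by auto
    then show "f \<in> Domain (schroedinger_op V)" by blast
  qed
qed

end

theory Submission
  imports Defs "HOL-Complex_Analysis.Complex_Analysis" "HOL-Real_Asymp.Real_Asymp"
begin

text \<open>
  The potential is radial. With $\alpha = (d-1)/2$, the substitution
  $f(x) = |x|^{-\alpha} w(|x|)$ turns $-\Delta f + V f = z f$ into the one-dimensional equation
  $w'' = -(z - q) w$, where $V = q - \alpha(\alpha-1)/|x|^2$. Hence \<open>V\<close> is taken to be zero in a ball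
  of large radius $R_0$ and equal to $q_j - \alpha(\alpha-1)/|x|^2$ for $R_j < |x| \le R_{j+1}$, with
  complex constants $q_j$. The term $|x|^{-2}$ is harmless: it is small for large $R_0$, and it belongs
  to $L^p$ outside a ball because $2p > d$. In the ball the radial solution is a power series
  (\<open>radial_free_solution\<close>), in every layer it is trigonometric, so its data $(w, w')$ at $R_j$ are
  entire functions of \<open>z\<close>. For $\mathrm{Im}\, z < 0$ let $k = -\sqrt z$ be the square root with
  $\mathrm{Im}\, k > 0$. If \<open>q\<close> vanishes outside $R_j$, then \<open>z\<close> is an eigenvalue as soon as $w' = i k w$
  at $R_j$.

  \<^emph>\<open>One layer creates one eigenvalue.\<close> Given an energy $E = k_0^2 > 0$, aim at $z = k^2$ with
  $k = -k_0 + i\delta$, and let the wave number in the layer be $k' = -k_0 - i\tau$ with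
  $\delta \le \tau \le 2\delta$, so that $q = k^2 - k'^2 = O(\delta)$. The matching condition reads
  $e^{2ik'L} = \Phi$ with $|\Phi|$ of order $1/\delta$. Its modulus fixes the thickness
  $L = \ln|\Phi|/(2\tau)$, and its phase is adjusted by the intermediate value theorem in $\tau$. The cost
  $|q|^p (R + L)^d$ is of order $\delta^{p-d}$ up to logarithms, and it is here that $p > d$ is decisive
  (\<open>slab_creates_resonance\<close>). The ratio of the two waves at the inner boundary must be neither zero
  nor infinite at \<open>E\<close>; this holds for a dense set of energies (\<open>nondegenerate_energy\<close>).

  \<^emph>\<open>The eigenvalue survives all later layers.\<close> Later layers lie further out, and only the supremum of
  $|q_j|$ over them matters, not their number or thickness: if $|q| + \rho^2 \le 2\kappa\rho$ and
  $\mathrm{Im}\, k \ge \kappa$, then $|w' - ikw|^2 - \rho^2 |w|^2$ never decreases in the radius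
  (\<open>cone_functional_mono\<close>). So a solution that satisfies $w' = ikw$ far out has a logarithmic
  derivative within $\rho$ of $ik$ at all radii back to the layer that created the eigenvalue, and the maximum modulus principle traps a zero
  of the new matching function in a fixed small disc (\<open>perturbed_resonance_exists\<close>). As the number of
  layers tends to infinity these zeros have a limit point in the disc, at which $|w' - ikw| \le \rho |w|$
  holds at all large radii; this forces exponential decay (\<open>persistent_resonance\<close>, \<open>layer_decay\<close>), so the limit point is an
  eigenvalue of the full operator.

  Layers are added one after another, with energies that are dense in $[0,\infty)$ and with discs
  and costs that shrink to zero (\<open>resonance_sequence\<close>).
\<close>

section \<open>Weak derivatives from derivatives along lines\<close>

lemma borel_measurable_imp_lebesgue: "f \<in> borel_measurable borel \<Longrightarrow> f \<in> borel_measurable lebesgue"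
  by (rule measurable_completion) (simp only: measurable_lborel2)

lemma integrable_indicator_cball:
  fixes c :: real
  shows "integrable lebesgue (\<lambda>x::real ^ 'n::finite. indicator (cball 0 r) x * c)"
  by (intro integrable_mult_left) (simp add: lmeasurable_iff_integrable[symmetric])

lemma continuous_bounded_on_cball:
  fixes f :: "'a::euclidean_space \<Rightarrow> complex"
  assumes "continuous_on UNIV f"
  obtains M where "M \<ge> 0" "\<And>x. x \<in> cball a r \<Longrightarrow> cmod (f x) \<le> M"
proof -
  have "bounded (f ` cball a r)"
    by (intro compact_imp_bounded compact_continuous_image continuous_on_subset[OF assms]) auto
  then obtain M where "\<And>x. x \<in> cball a r \<Longrightarrow> cmod (f x) \<le> M" unfolding bounded_iff by blast
  then have "max 0 M \<ge> 0" "\<And>x. x \<in> cball a r \<Longrightarrow> cmod (f x) \<le> max 0 M" by (auto simp: le_max_iff_disj)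
  then show ?thesis using that by blast
qed

lemma cmod_mult_le: "cmod a \<le> A \<Longrightarrow> cmod b \<le> B \<Longrightarrow> cmod (a * b) \<le> A * B"
  unfolding norm_mult by (rule mult_mono') auto

lemma eq_0_outside_support: "x \<notin> closure {x. \<phi> x \<noteq> 0} \<Longrightarrow> \<phi> x = 0"
  using closure_subset[of "{x. \<phi> x \<noteq> 0}"] by blast

lemma partial_deriv_eq_0_outside_support:
  assumes "x \<notin> closure {x. \<phi> x \<noteq> 0}"
  shows "partial_deriv i \<phi> x = 0"
proof -
  have "(\<phi> has_derivative (\<lambda>_. 0)) (at x)"
  proof (rule has_derivative_transform_within_open)
    show "((\<lambda>_. 0) has_derivative (\<lambda>_. 0)) (at x)" by simp
    show "open (- closure {x. \<phi> x \<noteq> 0})" by blast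
    show "x \<in> - closure {x. \<phi> x \<noteq> 0}" using assms by blast
    show "0 = \<phi> y" if "y \<in> - closure {x. \<phi> x \<noteq> 0}" for y
      using that eq_0_outside_support[of y \<phi>] by simp
  qed
  then have "frechet_derivative \<phi> (at x) = (\<lambda>_. 0)"
    by (metis frechet_derivative_at)
  then show ?thesis by (simp add: partial_deriv_def)
qed

lemma test_fun_partial_deriv:
  assumes "test_fun \<phi>" shows "test_fun (partial_deriv i \<phi>)"
proof -
  have C: "C_k k \<phi>" for k using assms by (simp add: test_fun_def)
  have "C_k k (partial_deriv i \<phi>)" for k
    using C[of "Suc k"] by simp
  moreover have "{x. partial_deriv i \<phi> x \<noteq> 0} \<subseteq> closure {x. \<phi> x \<noteq> 0}"
  proof
    fix x assume x: "x \<in> {x. partial_deriv i \<phi> x \<noteq> 0}"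
    then show "x \<in> closure {x. \<phi> x \<noteq> 0}"
      using partial_deriv_eq_0_outside_support by blast
  qed
  then have "closure {x. partial_deriv i \<phi> x \<noteq> 0} \<subseteq> closure {x. \<phi> x \<noteq> 0}"
    by (simp add: closure_minimal)
  then have "compact (closure {x. partial_deriv i \<phi> x \<noteq> 0})"
    using assms unfolding test_fun_def
    by (metis closed_closure compact_Int_closed inf.absorb_iff2)
  ultimately show ?thesis by (simp add: test_fun_def)
qed

lemma test_fun_continuous:
  assumes "test_fun \<phi>" shows "continuous_on UNIV \<phi>"
  using assms C_k.simps(1) unfolding test_fun_def by blast

lemma test_fun_line_deriv:
  assumes "test_fun \<phi>"
  shows "((\<lambda>t. \<phi> (x + t *\<^sub>R axis i 1)) has_vector_derivative partial_deriv i \<phi> (x + t *\<^sub>R axis i 1)) (at t)"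
proof -
  have "C_k (Suc 0) \<phi>" using assms unfolding test_fun_def by blast
  then have "\<phi> differentiable (at (x + t *\<^sub>R axis i 1))"
    by (simp add: differentiable_on_def)
  then have D: "(\<phi> has_derivative frechet_derivative \<phi> (at (x + t *\<^sub>R axis i 1))) (at (x + t *\<^sub>R axis i 1))"
    using frechet_derivative_works by blast
  have "((\<lambda>t. \<phi> (x + t *\<^sub>R axis i 1)) has_derivative (\<lambda>h. frechet_derivative \<phi> (at (x + t *\<^sub>R axis i 1)) (h *\<^sub>R axis i 1))) (at t)"
    by (rule has_derivative_compose[where f="\<lambda>t. x + t *\<^sub>R axis i 1" and g=\<phi>, OF _ D]) (auto intro!: derivative_eq_intros)
  moreover have "frechet_derivative \<phi> (at (x + t *\<^sub>R axis i 1)) (h *\<^sub>R axis i 1) = h *\<^sub>R partial_deriv i \<phi> (x + t *\<^sub>R axis i 1)" for h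
    unfolding partial_deriv_def using has_derivative_linear[OF D] by (simp add: linear_scale)
  ultimately show ?thesis by (simp add: has_vector_derivative_def)
qed

text \<open>Translation invariance makes the integral of every difference quotient of \<open>G\<close> vanish. The
  quotients are dominated, because \<open>G\<close> is Lipschitz along the lines in direction \<open>e\<close>, and they converge
  outside \<open>N\<close>. The exceptional set meets every line in a locally finite set, which is what the
  fundamental theorem of calculus tolerates for a continuous function.\<close>

lemma integral_line_derivative_eq_0:
  fixes G D :: "real ^ 'n::finite \<Rightarrow> complex"
  assumes contG: "continuous_on UNIV G"
    and measD: "D \<in> borel_measurable lebesgue"
    and K: "bounded K" and GK: "\<And>x. x \<notin> K \<Longrightarrow> G x = 0"
    and bd: "\<And>x. cmod (D x) \<le> M"
    and N: "negligible N" and line: "\<And>x a b. finite {t\<in>{a..b}. x + t *\<^sub>R e \<in> N}"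
    and der: "\<And>x t. x + t *\<^sub>R e \<notin> N \<Longrightarrow>
        ((\<lambda>t. G (x + t *\<^sub>R e)) has_vector_derivative D (x + t *\<^sub>R e)) (at t)"
  shows "(LINT x|lebesgue. D x) = 0"
proof -
  obtain B where B: "\<And>x. x \<in> K \<Longrightarrow> norm x \<le> B" using K bounded_iff by blast
  \<comment> \<open>the difference quotients below use steps of length at most \<open>norm e\<close>\<close>
  define B' where "B' = B + norm e"
  define Q where "Q n x = real (Suc n) *\<^sub>R (G (x + (1 / real (Suc n)) *\<^sub>R e) - G x)" for n x
  have M0: "M \<ge> 0" using bd norm_ge_zero order_trans by blast
  have mG: "G \<in> borel_measurable borel" using contG by (rule borel_measurable_continuous_onI)
  have intG: "integrable lborel G"
  proof -
    have "integrable lborel (\<lambda>x. indicator (cball 0 B) x *\<^sub>R G x)"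
      by (rule borel_integrable_compact) (auto intro: continuous_on_subset[OF contG])
    also have "(\<lambda>x. indicator (cball 0 B) x *\<^sub>R G x) = G"
      using B GK by (force simp: indicator_def)
    finally show ?thesis .
  qed
  have shift: "distr lborel borel (\<lambda>x. x + v) = (lborel :: (real ^ 'n) measure)" for v
  proof -
    have "(\<lambda>x. x + v) = (+) v" by (simp add: fun_eq_iff add.commute)
    then show ?thesis using lborel_distr_plus[of v] by metis
  qed
  have intGs: "integrable lborel (\<lambda>x. G (x + v))" for v
    using integrable_distr_eq[of "\<lambda>x. x + v" lborel borel G] intG mG
    by (simp add: shift)
  have "(LINT x|lborel. G (x + v)) = (LINT x|lborel. G x)" for v
    using integral_distr[of "\<lambda>x. x + v" lborel borel G] mG
    by (simp add: shift)
  then have Q0: "(LINT x|lborel. Q n x) = 0" for n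
    unfolding Q_def using intG intGs by simp
  have Qm: "Q n \<in> borel_measurable borel" for n unfolding Q_def using mG by measurable
  have Q0': "(LINT x|lebesgue. Q n x) = 0" for n
    using Q0[of n] Qm[of n] by (simp add: integral_completion)
  have lip: "norm (G (x + t *\<^sub>R e) - G x) \<le> M * t" if "t \<ge> 0" for x t
  proof -
    have "((\<lambda>t. D (x + t *\<^sub>R e)) has_integral G (x + t *\<^sub>R e) - G (x + 0 *\<^sub>R e)) {0..t}"
      by (rule fundamental_theorem_of_calculus_strong[OF line[of 0 t x] that])
         (auto intro!: der continuous_on_compose2[OF contG] continuous_intros)
    from has_integral_bound[OF M0 this[unfolded box_real(2)[symmetric]]] show ?thesis
      using bd that by simp
  qed
  have bound: "norm (Q n x) \<le> indicator (cball 0 B') x *\<^sub>R M" for n x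
  proof (cases "x \<in> cball 0 B'")
    case True
    have "norm (Q n x) = real (Suc n) * norm (G (x + (1 / real (Suc n)) *\<^sub>R e) - G x)"
      unfolding Q_def by (metis norm_scaleR abs_of_nat)
    also have "\<dots> \<le> real (Suc n) * (M * (1 / real (Suc n)))"
      by (intro mult_left_mono lip) auto
    finally show ?thesis using True by simp
  next
    case False
    then have x: "norm x > B'" by simp
    have "norm ((1 / real (Suc n)) *\<^sub>R e) = (1 / real (Suc n)) * norm e" by simp
    also have "\<dots> \<le> 1 * norm e" by (intro mult_right_mono) auto
    finally have "norm (x + (1 / real (Suc n)) *\<^sub>R e) > B"
      using x norm_triangle_ineq4[of "x + (1 / real (Suc n)) *\<^sub>R e" "(1 / real (Suc n)) *\<^sub>R e"]
      by (simp add: B'_def)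
    moreover have "norm x > B" using x by (simp add: B'_def) (smt (verit) norm_ge_zero)
    ultimately have "x \<notin> K" "x + (1 / real (Suc n)) *\<^sub>R e \<notin> K" using B by force+
    then show ?thesis by (simp add: Q_def GK M0)
  qed
  have lim: "(\<lambda>n. Q n x) \<longlonglongrightarrow> D x" if "x \<notin> N" for x
  proof -
    have d: "((\<lambda>t. G (x + t *\<^sub>R e)) has_vector_derivative D x) (at 0)"
      using der[of x 0] that by simp
    have "((\<lambda>h. norm (G (x + h *\<^sub>R e) - G x - h *\<^sub>R D x) / norm h) \<longlongrightarrow> 0) (at 0)"
      using d unfolding has_vector_derivative_def has_derivative_at by simp
    then have "((\<lambda>h. (G (x + h *\<^sub>R e) - G x) /\<^sub>R h - D x) \<longlongrightarrow> 0) (at 0)"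
    proof (rule tendsto_norm_zero_cancel[OF Lim_transform_eventually])
      have "norm (G (x + h *\<^sub>R e) - G x - h *\<^sub>R D x) / norm h = norm ((G (x + h *\<^sub>R e) - G x) /\<^sub>R h - D x)"
        if "h \<noteq> 0" for h :: real
      proof -
        have "(G (x + h *\<^sub>R e) - G x) /\<^sub>R h - D x = (G (x + h *\<^sub>R e) - G x - h *\<^sub>R D x) /\<^sub>R h"
          using that by (simp add: scaleR_diff_right)
        then show ?thesis by (simp add: divide_inverse mult.commute)
      qed
      then show "\<forall>\<^sub>F h in at 0. norm (G (x + h *\<^sub>R e) - G x - h *\<^sub>R D x) / norm h = norm ((G (x + h *\<^sub>R e) - G x) /\<^sub>R h - D x)"
        by (simp add: eventually_at_filter)
    qed
    then have "((\<lambda>h. (G (x + h *\<^sub>R e) - G x) /\<^sub>R h) \<longlongrightarrow> D x) (at 0)"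
      by (rule LIM_zero_cancel)
    moreover have "filterlim (\<lambda>n. 1 / real (Suc n)) (at 0) sequentially"
      using LIMSEQ_Suc[OF lim_1_over_n[where ?'a=real]] by (auto simp: filterlim_at simp del: of_nat_Suc)
    ultimately have "((\<lambda>n. (G (x + (1 / real (Suc n)) *\<^sub>R e) - G x) /\<^sub>R (1 / real (Suc n))) \<longlongrightarrow> D x) sequentially"
      by (rule filterlim_compose)
    then show ?thesis by (simp add: Q_def[abs_def])
  qed
  have "(\<lambda>n. LINT x|lebesgue. Q n x) \<longlonglongrightarrow> (LINT x|lebesgue. D x)"
  proof (rule integral_dominated_convergence)
    show "integrable lebesgue (\<lambda>x::real ^ 'n. indicator (cball 0 B') x *\<^sub>R M)"
      using integrable_indicator_cball[of B' M] by simp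
    show "AE x in lebesgue. (\<lambda>n. Q n x) \<longlonglongrightarrow> D x"
      using N unfolding negligible_iff_null_sets
      by (rule AE_I') (use lim in auto)
    show "\<And>n. AE x in lebesgue. norm (Q n x) \<le> indicator (cball 0 B') x *\<^sub>R M"
      using bound by auto
    show "\<And>n. Q n \<in> borel_measurable lebesgue" using Qm by (simp add: measurable_completion)
  qed (rule measD)
  then show ?thesis using Q0' LIMSEQ_unique by (simp add: LIMSEQ_const_iff)
qed

lemma locally_integrable_locally_bounded:
  fixes f :: "real ^ 'n::finite \<Rightarrow> complex"
  assumes [measurable]: "f \<in> borel_measurable lebesgue"
    and bd: "\<And>r. \<exists>M. \<forall>x\<in>cball 0 r. cmod (f x) \<le> M"
  shows "locally_integrable f"
  unfolding locally_integrable_def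
proof (intro allI impI)
  fix K :: "(real ^ 'n) set" assume K: "compact K"
  obtain r where r: "\<And>x. x \<in> K \<Longrightarrow> norm x \<le> r"
    using compact_imp_bounded[OF K] unfolding bounded_iff by blast
  obtain M where M: "\<And>x. norm x \<le> r \<Longrightarrow> cmod (f x) \<le> M" using bd[of r] by (metis mem_cball_0)
  have Kl: "K \<in> sets lebesgue" and "K \<in> lmeasurable" using lmeasurable_compact[OF K] by (auto simp: fmeasurableD)
  show "set_integrable lebesgue K f"
    unfolding set_integrable_def
  proof (rule Bochner_Integration.integrable_bound)
    show "integrable lebesgue (\<lambda>x. indicator K x * M :: real)"
      using \<open>K \<in> lmeasurable\<close> by (intro integrable_mult_left) (simp add: lmeasurable_iff_integrable[symmetric])
    show "(\<lambda>x. indicator K x *\<^sub>R f x) \<in> borel_measurable lebesgue" using Kl by measurable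
    show "AE x in lebesgue. norm (indicator K x *\<^sub>R f x) \<le> norm (indicator K x * M)"
    proof (rule AE_I2)
      fix x
      show "norm (indicator K x *\<^sub>R f x) \<le> norm (indicator K x * M)"
        using M[of x] r[of x] by (cases "x \<in> K") auto
    qed
  qed
qed

text \<open>Integration by parts: the previous lemma is applied to \<open>f * \<phi>\<close>. The exceptional set
  allows second derivatives that jump across spheres, as they do for a discontinuous potential.\<close>

lemma has_weak_deriv_singleton:
  fixes f g :: "real ^ 'n::finite \<Rightarrow> complex"
  assumes contf: "continuous_on UNIV f"
    and measg: "g \<in> borel_measurable lebesgue"
    and bd: "\<And>r. \<exists>M. \<forall>x\<in>cball 0 r. cmod (g x) \<le> M"
    and N: "negligible N" and line: "\<And>x a b. finite {t\<in>{a..b}. x + t *\<^sub>R axis i 1 \<in> N}"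
    and der: "\<And>x t. x + t *\<^sub>R axis i 1 \<notin> N \<Longrightarrow>
        ((\<lambda>t. f (x + t *\<^sub>R axis i 1)) has_vector_derivative g (x + t *\<^sub>R axis i 1)) (at t)"
  shows "has_weak_deriv [i] f g"
proof -
  have mf: "f \<in> borel_measurable lebesgue"
    using continuous_imp_measurable_on_sets_lebesgue[OF contf] by simp
  have bdf: "\<exists>M. \<forall>x\<in>cball 0 r. cmod (f x) \<le> M" for r
    by (rule continuous_bounded_on_cball[OF contf, of 0 r]) blast
  have li: "locally_integrable f" "locally_integrable g"
    using locally_integrable_locally_bounded[OF mf bdf] locally_integrable_locally_bounded[OF measg bd] by blast+
  have "(LINT x|lebesgue. f x * partial_deriv i \<phi> x) = - (LINT x|lebesgue. g x * \<phi> x)"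
    if \<phi>: "test_fun \<phi>" for \<phi>
  proof -
    define K where "K = closure {x. \<phi> x \<noteq> 0}"
    let ?p = "partial_deriv i \<phi>"
    have tp: "test_fun ?p" by (rule test_fun_partial_deriv[OF \<phi>])
    have K: "compact K" using \<phi> by (simp add: test_fun_def K_def)
    obtain r where r: "\<And>x. x \<in> K \<Longrightarrow> norm x \<le> r" using compact_imp_bounded[OF K] unfolding bounded_iff by blast
    have z: "\<phi> x = 0" "?p x = 0" if "x \<notin> K" for x
      using that eq_0_outside_support[of x \<phi>] partial_deriv_eq_0_outside_support[of x \<phi> i]
      unfolding K_def by blast+
    have c: "continuous_on UNIV \<phi>" "continuous_on UNIV ?p"
      using test_fun_continuous[OF \<phi>] test_fun_continuous[OF tp] by blast+
    have m: "\<phi> \<in> borel_measurable lebesgue" "?p \<in> borel_measurable lebesgue"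
      using continuous_imp_measurable_on_sets_lebesgue[OF c(1)] continuous_imp_measurable_on_sets_lebesgue[OF c(2)] by simp_all
    obtain M1 where M1: "M1 \<ge> 0" "\<And>x. x \<in> cball 0 r \<Longrightarrow> cmod (f x) \<le> M1"
      by (rule continuous_bounded_on_cball[OF contf, of 0 r]) blast
    obtain M2 where M2: "M2 \<ge> 0" "\<And>x. x \<in> cball 0 r \<Longrightarrow> cmod (\<phi> x) \<le> M2"
      by (rule continuous_bounded_on_cball[OF c(1), of 0 r]) blast
    obtain M3 where M3: "M3 \<ge> 0" "\<And>x. x \<in> cball 0 r \<Longrightarrow> cmod (?p x) \<le> M3"
      by (rule continuous_bounded_on_cball[OF c(2), of 0 r]) blast
    obtain M0 where M0: "\<And>x. x \<in> cball 0 r \<Longrightarrow> cmod (g x) \<le> M0" using bd[of r] by blast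
    define M4 where "M4 = max 0 M0"
    have M4: "M4 \<ge> 0" "\<And>x. x \<in> cball 0 r \<Longrightarrow> cmod (g x) \<le> M4"
      using M0 by (auto simp: M4_def le_max_iff_disj)
    note M = M1 M2 M3 M4
    have i1: "integrable lebesgue (\<lambda>x. f x * ?p x)" and i2: "integrable lebesgue (\<lambda>x. g x * \<phi> x)"
    proof -
      have ib: "integrable lebesgue h" if "h \<in> borel_measurable lebesgue" "\<And>x. x \<notin> K \<Longrightarrow> h x = 0"
        "\<And>x. x \<in> cball 0 r \<Longrightarrow> cmod (h x) \<le> M" for h :: "real ^ 'n \<Rightarrow> complex" and M
      proof (rule Bochner_Integration.integrable_bound)
        show "integrable lebesgue (\<lambda>x::real ^ 'n. indicator (cball 0 r) x * M)"
          by (rule integrable_indicator_cball)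
        show "AE x in lebesgue. norm (h x) \<le> norm (indicator (cball 0 r) x * M)"
        proof (rule AE_I2)
          fix x
          show "norm (h x) \<le> norm (indicator (cball 0 r) x * M)"
          proof (cases "x \<in> K")
            case True then have "x \<in> cball 0 r" using r by simp
            then show ?thesis using that(3)[of x] by simp
          next
            case False then show ?thesis using that(2)[of x] by simp
          qed
        qed
      qed (rule that)
      show "integrable lebesgue (\<lambda>x. f x * ?p x)"
        by (rule ib[OF borel_measurable_times[OF mf m(2)] _ cmod_mult_le[OF M1(2) M3(2)]]) (simp_all add: z)
      show "integrable lebesgue (\<lambda>x. g x * \<phi> x)"
        by (rule ib[OF borel_measurable_times[OF measg m(1)] _ cmod_mult_le[OF M4(2) M2(2)]]) (simp_all add: z)
    qed
    have "(LINT x|lebesgue. f x * ?p x + g x * \<phi> x) = 0"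
    proof (rule integral_line_derivative_eq_0[where G="\<lambda>x. f x * \<phi> x" and K="K" and N=N and e="axis i 1" and M="M1 * M3 + M4 * M2"])
      show "continuous_on UNIV (\<lambda>x. f x * \<phi> x)" by (intro continuous_intros contf c)
      show "(\<lambda>x. f x * ?p x + g x * \<phi> x) \<in> borel_measurable lebesgue" using mf m measg by measurable
      show "bounded K" using K by (rule compact_imp_bounded)
      show "cmod (f x * ?p x + g x * \<phi> x) \<le> M1 * M3 + M4 * M2" for x
      proof (cases "x \<in> K")
        case True
        then have "x \<in> cball 0 r" using r by simp
        then show ?thesis
          by (intro order_trans[OF norm_triangle_ineq] add_mono cmod_mult_le M1 M2 M3 M4)
      next
        case False
        then show ?thesis using M1(1) M2(1) M3(1) M4(1) by (simp add: z)
      qed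
      show "negligible N" by (rule N)
      show "f x * \<phi> x = 0" if "x \<notin> K" for x using that by (simp add: z)
      show "finite {t\<in>{a..b}. x + t *\<^sub>R axis i 1 \<in> N}" for x a b by (rule line)
      show "((\<lambda>t. f (x + t *\<^sub>R axis i 1) * \<phi> (x + t *\<^sub>R axis i 1)) has_vector_derivative
          f (x + t *\<^sub>R axis i 1) * ?p (x + t *\<^sub>R axis i 1) + g (x + t *\<^sub>R axis i 1) * \<phi> (x + t *\<^sub>R axis i 1)) (at t)"
        if "x + t *\<^sub>R axis i 1 \<notin> N" for x t
        by (rule has_vector_derivative_mult[OF der[OF that] test_fun_line_deriv[OF \<phi>]])
    qed
    then show ?thesis using i1 i2 by (simp add: eq_neg_iff_add_eq_0)
  qed
  then show ?thesis using li by (simp add: has_weak_deriv_def partial_derivs_def)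
qed

lemma has_weak_deriv_trans:
  assumes "has_weak_deriv [j] f g" "has_weak_deriv [i] g h"
  shows "has_weak_deriv [j, i] f h"
proof -
  have "(LINT x|lebesgue. f x * partial_deriv j (partial_deriv i \<phi>) x) = (LINT x|lebesgue. h x * \<phi> x)"
    if "test_fun \<phi>" for \<phi>
    using assms that test_fun_partial_deriv[OF that, of i]
    by (simp add: has_weak_deriv_def partial_derivs_def)
  then show ?thesis using assms by (simp add: has_weak_deriv_def partial_derivs_def)
qed

section \<open>Functions dominated by radial step functions\<close>

text \<open>An integral bound without polar coordinates: \<open>f\<close> is dominated by a countable sum of
  multiples of indicator functions of balls, whose volumes are known. It serves for exponentially decaying
  functions, for $|x|^{-2p}$, and for potentials that are constant on shells.\<close>

lemma radial_majorant:
  fixes f :: "'a::euclidean_space \<Rightarrow> real" and h r :: "nat \<Rightarrow> real"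
  assumes meas: "f \<in> borel_measurable lebesgue" and f0: "\<And>x. 0 \<le> f x"
    and h: "\<And>n. 0 \<le> h n" and r: "\<And>n. 0 \<le> r n"
    and maj: "\<And>x. f x \<noteq> 0 \<Longrightarrow> \<exists>n. norm x \<le> r n \<and> f x \<le> h n"
    and S: "(\<lambda>n. h n * r n ^ DIM('a)) sums S"
  shows "integrable lebesgue f" "(LINT x|lebesgue. f x) \<le> unit_ball_vol (DIM('a)) * S"
proof -
  have pw: "ennreal (f x) \<le> (\<Sum>n. ennreal (h n) * indicator (cball 0 (r n)) x)" for x
  proof (cases "f x = 0")
    case False
    then obtain n where n: "norm x \<le> r n" "f x \<le> h n" using maj by blast
    define F where "F k = ennreal (h k) * indicator (cball 0 (r k)) x" for k
    have "ennreal (f x) \<le> F n" using n by (simp add: F_def ennreal_leI)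
    also have "F n = sum F {n}" by simp
    also have "\<dots> \<le> suminf F" by (rule sum_le_suminf) auto
    finally show ?thesis unfolding F_def .
  qed simp
  have "(\<integral>\<^sup>+x. ennreal (f x) \<partial>lebesgue) \<le> (\<integral>\<^sup>+x. (\<Sum>n. ennreal (h n) * indicator (cball 0 (r n)) (x :: 'a)) \<partial>lebesgue)"
    by (intro nn_integral_mono pw)
  also have "\<dots> = (\<Sum>n. \<integral>\<^sup>+x. ennreal (h n) * indicator (cball 0 (r n)) (x :: 'a) \<partial>lebesgue)"
    by (rule nn_integral_suminf) (auto intro!: borel_measurable_times_ennreal borel_measurable_indicator)
  also have "\<dots> = (\<Sum>n. ennreal (unit_ball_vol (DIM('a)) * (h n * r n ^ DIM('a))))"
  proof (rule suminf_cong)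
    fix n
    have "(\<integral>\<^sup>+x. ennreal (h n) * indicator (cball 0 (r n)) (x :: 'a) \<partial>lebesgue) = ennreal (h n) * emeasure lebesgue (cball (0 :: 'a) (r n))"
      by (rule nn_integral_cmult_indicator) simp
    also have "\<dots> = ennreal (h n) * ennreal (unit_ball_vol (DIM('a)) * r n ^ DIM('a))"
      using emeasure_cball[OF r[of n], of "0 :: 'a"] by simp
    also have "\<dots> = ennreal (unit_ball_vol (DIM('a)) * (h n * r n ^ DIM('a)))"
      using h[of n] r[of n] by (simp add: ennreal_mult[symmetric] mult_ac)
    finally show "(\<integral>\<^sup>+x. ennreal (h n) * indicator (cball 0 (r n)) (x :: 'a) \<partial>lebesgue) = \<dots>" .
  qed
  also have "\<dots> = ennreal (unit_ball_vol (DIM('a)) * S)"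
    using sums_mult[OF S, of "unit_ball_vol (DIM('a))"] h r
    by (intro suminf_ennreal_eq) auto
  finally have le: "(\<integral>\<^sup>+x. ennreal (f x) \<partial>lebesgue) \<le> ennreal (unit_ball_vol (DIM('a)) * S)" .
  have S0: "S \<ge> 0" using sums_le[OF _ sums_zero S] h r by simp
  show i: "integrable lebesgue f"
    using meas f0 order.strict_trans1[OF le ennreal_less_top] by (intro integrableI_nonneg) auto
  have "ennreal (LINT x|lebesgue. f x) \<le> ennreal (unit_ball_vol (DIM('a)) * S)"
    using nn_integral_eq_integral[OF i] f0 le by simp
  then show "(LINT x|lebesgue. f x) \<le> unit_ball_vol (DIM('a)) * S"
    using S0 by (simp add: ennreal_le_iff)
qed

lemma summable_exp_decay_power:
  fixes c :: real and d :: nat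
  assumes "c > 0"
  shows "summable (\<lambda>n. exp (- c * real n) * real (Suc n) ^ d)"
proof (rule summable_comparison_test_bigo)
  show "summable (\<lambda>n. norm (real n powr (- 2)))" by (simp add: summable_real_powr_iff)
  have "(\<lambda>n. exp (- c * real n) * (real n + 1) powr real d) \<in> O(\<lambda>n. real n powr (- 2))"
    using assms by real_asymp
  then show "(\<lambda>n. exp (- c * real n) * real (Suc n) ^ d) \<in> O(\<lambda>n. real n powr (- 2))"
    by (simp add: powr_realpow add.commute)
qed

lemma summable_inverse_square_power:
  fixes p :: real and d :: nat
  assumes "p > real d" "d \<ge> 1"
  shows "summable (\<lambda>n. real n powr (- 2 * p) * real (Suc n) ^ d)"
proof (rule summable_comparison_test_bigo)
  show "summable (\<lambda>n. norm (real n powr (- p)))" using assms by (simp add: summable_real_powr_iff)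
  define s where "s = p - real d"
  have s: "s > 0" "p = real d + s" using assms by (auto simp: s_def)
  have "(\<lambda>n. real n powr (- 2 * (real d + s)) * (real n + 1) powr real d) \<in> O(\<lambda>n. real n powr (- (real d + s)))"
    using s(1) by real_asymp
  then show "(\<lambda>n. real n powr (- 2 * p) * real (Suc n) ^ d) \<in> O(\<lambda>n. real n powr (- p))"
    by (simp add: powr_realpow add.commute s(2))
qed

lemma L2_exponential_decay:
  fixes f :: "'a::euclidean_space \<Rightarrow> complex"
  assumes meas: "f \<in> borel_measurable lebesgue" and \<kappa>: "\<kappa> > 0"
    and bd: "\<And>x. cmod (f x) \<le> C * exp (- \<kappa> * norm x)"
  shows "f \<in> Lp_space 2"
proof -
  have s: "summable (\<lambda>n. C\<^sup>2 * exp (- (2 * \<kappa>) * real n) * real (Suc n) ^ DIM('a))"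
    using summable_mult[OF summable_exp_decay_power[of "2 * \<kappa>" "DIM('a)"], of "C\<^sup>2"] \<kappa>
    by (simp add: mult.assoc)
  have "integrable lebesgue (\<lambda>x. (cmod (f x))\<^sup>2)"
  proof (rule radial_majorant(1)[OF _ _ _ _ _ summable_sums[OF s]])
    show "(\<lambda>x. (cmod (f x))\<^sup>2) \<in> borel_measurable lebesgue" using meas by measurable
    show "\<exists>n. norm x \<le> real (Suc n) \<and> (cmod (f x))\<^sup>2 \<le> C\<^sup>2 * exp (- (2 * \<kappa>) * real n)" for x
    proof (intro exI conjI)
      let ?n = "nat \<lfloor>norm x\<rfloor>"
      have n: "real ?n \<le> norm x" "norm x \<le> real (Suc ?n)" by (simp_all, linarith)
      show "norm x \<le> real (Suc ?n)" by (rule n)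
      have "(cmod (f x))\<^sup>2 \<le> (C * exp (- \<kappa> * norm x))\<^sup>2" by (intro power_mono bd) simp
      also have "\<dots> = C\<^sup>2 * exp (- (2 * \<kappa>) * norm x)"
        by (simp add: power_mult_distrib exp_double[symmetric] mult.assoc)
      also have "\<dots> \<le> C\<^sup>2 * exp (- (2 * \<kappa>) * real ?n)"
        using n(1) \<kappa> by (intro mult_left_mono) auto
      finally show "(cmod (f x))\<^sup>2 \<le> C\<^sup>2 * exp (- (2 * \<kappa>) * real ?n)" .
    qed
  qed auto
  then show ?thesis using meas by (simp add: L2_eq)
qed

section \<open>Radial eigenfunctions\<close>

lemma line_norm_square:
  fixes x :: "real ^ 'n::finite"
  shows "(norm (x + t *\<^sub>R axis i 1))\<^sup>2 = (norm x)\<^sup>2 + 2 * t * x $ i + t\<^sup>2"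
  unfolding power2_norm_eq_inner
  by (simp add: inner_add_left inner_add_right inner_axis inner_axis' power2_eq_square algebra_simps)

lemma has_vector_derivative_line_norm_square:
  fixes x :: "real ^ 'n::finite"
  shows "((\<lambda>t. (norm (x + t *\<^sub>R axis i 1))\<^sup>2) has_real_derivative 2 * (x + t *\<^sub>R axis i 1) $ i) (at t)"
  unfolding line_norm_square by (auto intro!: derivative_eq_intros simp: axis_def)

text \<open>Along a coordinate line the squared norm is a quadratic polynomial of the parameter, so each
  sphere is met at most twice.\<close>

lemma finite_line_meets_spheres:
  fixes x :: "real ^ 'n::finite"
  assumes "\<And>r. finite (B \<inter> {..r})"
  shows "finite {t\<in>{a..b}. x + t *\<^sub>R axis i 1 \<in> {x. (norm x)\<^sup>2 \<in> B}}"
proof -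
  let ?s = "\<lambda>t. (norm (x + t *\<^sub>R axis i 1))\<^sup>2"
  define r where "r = (norm x + max \<bar>a\<bar> \<bar>b\<bar>)\<^sup>2"
  have sub: "{t\<in>{a..b}. x + t *\<^sub>R axis i 1 \<in> {x. (norm x)\<^sup>2 \<in> B}} \<subseteq> (\<Union>y\<in>B \<inter> {..r}. {t. ?s t = y})"
  proof
    fix t assume t: "t \<in> {t\<in>{a..b}. x + t *\<^sub>R axis i 1 \<in> {x. (norm x)\<^sup>2 \<in> B}}"
    have "norm (x + t *\<^sub>R axis i 1) \<le> norm x + \<bar>t\<bar>"
      by (rule order_trans[OF norm_triangle_ineq]) simp
    also have "\<dots> \<le> norm x + max \<bar>a\<bar> \<bar>b\<bar>" using t by auto
    finally have "?s t \<le> r" unfolding r_def by (intro power_mono) auto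
    then show "t \<in> (\<Union>y\<in>B \<inter> {..r}. {t. ?s t = y})" using t by auto
  qed
  have "finite {t. ?s t = y}" for y
  proof (rule finite_subset)
    let ?c = "y - (norm x)\<^sup>2 + (x $ i)\<^sup>2"
    show "{t. ?s t = y} \<subseteq> {sqrt ?c - x $ i, - sqrt ?c - x $ i}"
    proof
      fix t assume "t \<in> {t. ?s t = y}"
      then have "(norm x)\<^sup>2 + 2 * t * x $ i + t\<^sup>2 = y"
        by (simp add: line_norm_square)
      then have "(t + x $ i)\<^sup>2 = ?c" by (simp add: power2_eq_square algebra_simps)
      then have "\<bar>t + x $ i\<bar> = sqrt ?c" by (metis real_sqrt_abs)
      then show "t \<in> {sqrt ?c - x $ i, - sqrt ?c - x $ i}" by (auto simp: abs_if split: if_splits)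
    qed
  qed simp
  then show ?thesis using assms by (intro finite_subset[OF sub] finite_UN_I) auto
qed

lemma negligible_spheres:
  fixes B :: "real set"
  assumes "\<And>r. finite (B \<inter> {..r})"
  shows "negligible {x :: real ^ 'n::finite. (norm x)\<^sup>2 \<in> B}"
proof -
  have "B = (\<Union>n. B \<inter> {..real n})" by (auto intro: real_arch_simple)
  then have "countable B" using assms by (metis countable_UN countable_finite uncountable_def countableI_type)
  then have "countable ((\<lambda>b. sphere (0 :: real ^ 'n) (sqrt b)) ` B)" by (rule countable_image)
  then have "negligible (\<Union>((\<lambda>b. sphere (0 :: real ^ 'n) (sqrt b)) ` B))"
    by (rule negligible_countable_Union) (auto intro: negligible_sphere)
  moreover have "{x :: real ^ 'n. (norm x)\<^sup>2 \<in> B} \<subseteq> (\<Union>((\<lambda>b. sphere (0 :: real ^ 'n) (sqrt b)) ` B))"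
    by (auto intro!: bexI[of _ "(norm _)\<^sup>2"])
  ultimately show ?thesis by (rule negligible_subset)
qed

text \<open>A decay estimate for large arguments extends to all arguments at the cost of a larger constant.\<close>

lemma bounded_times_exp_sqrt:
  fixes f :: "real \<Rightarrow> complex"
  assumes c: "continuous_on UNIV f" and \<kappa>: "\<kappa> > 0"
    and tail: "\<And>s. s \<ge> S \<Longrightarrow> cmod (f s) \<le> C * exp (- \<kappa> * sqrt s)"
  obtains C' where "C' \<ge> 0" "\<And>s. s \<ge> 0 \<Longrightarrow> cmod (f s) \<le> C' * exp (- \<kappa> * sqrt s)"
proof -
  obtain M where M: "M \<ge> 0" "\<And>s. s \<in> cball 0 \<bar>S\<bar> \<Longrightarrow> cmod (f s) \<le> M"
    by (rule continuous_bounded_on_cball[OF c, of 0 "\<bar>S\<bar>"]) blast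
  define C' where "C' = max \<bar>C\<bar> (M * exp (\<kappa> * sqrt \<bar>S\<bar>))"
  show ?thesis
  proof (rule that)
    show "C' \<ge> 0" by (simp add: C'_def le_max_iff_disj)
    fix s :: real assume s: "s \<ge> 0"
    show "cmod (f s) \<le> C' * exp (- \<kappa> * sqrt s)"
    proof (cases "s \<ge> S")
      case True
      have "C * exp (- \<kappa> * sqrt s) \<le> C' * exp (- \<kappa> * sqrt s)"
        by (intro mult_right_mono) (auto simp: C'_def)
      then show ?thesis using tail[OF True] by linarith
    next
      case False
      then have "s \<in> cball 0 \<bar>S\<bar>" using s by simp
      then have "cmod (f s) \<le> M * 1" using M(2) by simp
      also have "\<dots> \<le> M * (exp (\<kappa> * sqrt \<bar>S\<bar>) * exp (- \<kappa> * sqrt s))"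
        using M(1) s False \<kappa> by (intro mult_left_mono) (auto simp: exp_add[symmetric] mult_left_mono)
      also have "\<dots> \<le> C' * exp (- \<kappa> * sqrt s)"
        unfolding mult.assoc[symmetric] by (intro mult_right_mono) (auto simp: C'_def)
      finally show ?thesis .
    qed
  qed
qed

lemma continuous_AE_eq_0:
  fixes f :: "(real ^ 'n::finite) \<Rightarrow> complex"
  assumes "continuous_on UNIV f" "AE x in lborel. f x = 0"
  shows "f x = 0"
proof (rule ccontr)
  assume x: "f x \<noteq> 0"
  have o: "open {x. f x \<noteq> 0}" using assms(1) by (intro open_Collect_neq) auto
  have "{x. f x \<noteq> 0} \<in> null_sets lborel" using assms(2) o AE_iff_null[of lborel "\<lambda>x. f x = 0"] by simp
  then have "negligible {x. f x \<noteq> 0}" by (simp add: negligible_iff_null_sets null_sets_completionI)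
  then show False using o x open_not_negligible by blast
qed

text \<open>With $f(x) = g(|x|^2)$ one has $\Delta f = 4 s g''(s) + 2 d g'(s)$ at $s = |x|^2$. The variable \<open>s\<close> is
  used instead of $|x|$ because then nothing is singular at the origin. The bounds on \<open>g\<close> and \<open>g1\<close> give, through
  the differential equation, the bound on \<open>s * g2 s\<close> that places the second derivatives in $L^2$;
  the separate bound on \<open>g2\<close> covers small \<open>s\<close>, where division by \<open>s\<close> would lose it.\<close>

lemma eigenvalue_radial:
  fixes g g1 g2 v :: "real \<Rightarrow> complex" and z :: complex and B :: "real set"
  assumes dg: "\<And>s. (g has_vector_derivative g1 s) (at s)"
    and cont: "continuous_on UNIV g1"
    and dg1: "\<And>s. s \<notin> B \<Longrightarrow> (g1 has_vector_derivative g2 s) (at s)"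
    and B: "\<And>r. finite (B \<inter> {..r})"
    and meas: "g2 \<in> borel_measurable borel"
    and ode: "\<And>s. s \<ge> 0 \<Longrightarrow> of_real (4 * s) * g2 s + of_nat (2 * CARD('n::finite)) * g1 s + (z - v s) * g s = 0"
    and v: "\<And>s. cmod (v s) \<le> M"
    and g2: "\<And>s. 0 \<le> s \<Longrightarrow> s \<le> 1 \<Longrightarrow> cmod (g2 s) \<le> K"
    and \<kappa>: "\<kappa> > 0" and S: "S \<ge> 1"
    and tail: "\<And>s. s \<ge> S \<Longrightarrow> cmod (g s) \<le> C * exp (- \<kappa> * sqrt s)"
      "\<And>s. s \<ge> S \<Longrightarrow> sqrt s * cmod (g1 s) \<le> C * exp (- \<kappa> * sqrt s)"
    and g0: "g 0 \<noteq> 0"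
  shows "eigenvalue (schroedinger_op (\<lambda>x :: real ^ 'n. v ((norm x)\<^sup>2))) z"
proof -
  define e where "e s = exp (- \<kappa> * sqrt s)" for s
  have e0: "e s > 0" for s by (simp add: e_def)
  have cg: "continuous_on UNIV g"
    using dg by (meson continuous_at_imp_continuous_on has_vector_derivative_continuous)
  obtain A0 where A0: "A0 \<ge> 0" "\<And>s. s \<ge> 0 \<Longrightarrow> cmod (g s) \<le> A0 * e s"
    unfolding e_def by (rule bounded_times_exp_sqrt[OF cg \<kappa> tail(1)]) blast+
  have cs: "continuous_on UNIV (\<lambda>s. of_real (sqrt s) * g1 s)"
    by (intro continuous_intros cont)
  have t2: "cmod (of_real (sqrt s) * g1 s) \<le> C * exp (- \<kappa> * sqrt s)" if "s \<ge> S" for s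
    using tail(2)[OF that] S that by (simp add: norm_mult)
  obtain A1 where A1: "A1 \<ge> 0" "\<And>s. s \<ge> 0 \<Longrightarrow> sqrt s * cmod (g1 s) \<le> A1 * e s"
  proof (rule bounded_times_exp_sqrt[OF cs \<kappa> t2])
    fix C' assume C': "C' \<ge> 0" "\<And>s. s \<ge> 0 \<Longrightarrow> cmod (of_real (sqrt s) * g1 s) \<le> C' * exp (- \<kappa> * sqrt s)"
    have "sqrt s * cmod (g1 s) \<le> C' * e s" if "s \<ge> 0" for s
      using C'(2)[OF that] that by (simp add: norm_mult e_def)
    then show thesis using that C'(1) by blast
  qed
  have t3: "cmod (g1 s) \<le> C * exp (- \<kappa> * sqrt s)" if "s \<ge> S" for s
  proof -
    have "1 * cmod (g1 s) \<le> sqrt s * cmod (g1 s)" using that S by (intro mult_right_mono) auto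
    then show ?thesis using tail(2)[OF that] by linarith
  qed
  obtain A2 where A2: "A2 \<ge> 0" "\<And>s. s \<ge> 0 \<Longrightarrow> cmod (g1 s) \<le> A2 * e s"
    unfolding e_def by (rule bounded_times_exp_sqrt[OF cont \<kappa> t3]) blast+
  define A3 where "A3 = (2 * real CARD('n) * A2 + (cmod z + M) * A0) / 4"
  have M0: "M \<ge> 0" using v norm_ge_zero order_trans by blast
  have A3: "s * cmod (g2 s) \<le> A3 * e s" if s: "s \<ge> 0" for s
  proof -
    have "of_real (4 * s) * g2 s = - (of_nat (2 * CARD('n)) * g1 s + (z - v s) * g s)"
      using ode[OF s] by (simp only: eq_neg_iff_add_eq_0 add.assoc)
    then have "4 * s * cmod (g2 s) = cmod (of_nat (2 * CARD('n)) * g1 s + (z - v s) * g s)"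
      using s by (metis norm_minus_cancel norm_mult norm_of_real abs_of_nonneg mult_nonneg_nonneg zero_le_numeral)
    also have "\<dots> \<le> cmod (of_nat (2 * CARD('n))) * cmod (g1 s) + cmod (z - v s) * cmod (g s)"
      unfolding norm_mult[symmetric] by (rule norm_triangle_ineq)
    also have "\<dots> \<le> 2 * real CARD('n) * (A2 * e s) + (cmod z + M) * (A0 * e s)"
    proof (intro add_mono mult_mono A2 A0 s)
      show "cmod (z - v s) \<le> cmod z + M" using norm_triangle_ineq4[of z "v s"] v[of s] by linarith
    qed (use M0 in \<open>auto simp: norm_mult\<close>)
    finally show ?thesis by (simp add: A3_def algebra_simps)
  qed
  define A4 where "A4 = max (\<bar>K\<bar> * exp \<kappa>) \<bar>A3\<bar>"
  have A4: "cmod (g2 s) \<le> A4 * e s" if s: "s \<ge> 0" for s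
  proof (cases "s \<le> 1")
    case True
    have "cmod (g2 s) \<le> \<bar>K\<bar> * 1" using g2[OF s True] by simp
    also have "\<dots> \<le> \<bar>K\<bar> * (exp \<kappa> * e s)"
      using True s \<kappa> by (intro mult_left_mono) (auto simp: e_def exp_add[symmetric] mult_le_cancel_left1)
    also have "\<dots> \<le> A4 * e s"
      unfolding mult.assoc[symmetric] using e0[of s] by (intro mult_right_mono) (auto simp: A4_def)
    finally show ?thesis .
  next
    case False
    then have "1 * cmod (g2 s) \<le> s * cmod (g2 s)" by (intro mult_right_mono) auto
    also have "\<dots> \<le> A3 * e s" by (rule A3[OF s])
    also have "\<dots> \<le> A4 * e s" using e0[of s] by (intro mult_right_mono) (auto simp: A4_def)
    finally show ?thesis by simp
  qed
  have eN: "e ((norm x)\<^sup>2) = exp (- \<kappa> * norm x)" for x :: "real ^ 'n" by (simp add: e_def)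
  define f where "f x = g ((norm x)\<^sup>2)" for x :: "real ^ 'n"
  define D where "D i x = of_real (2 * x $ i) * g1 ((norm x)\<^sup>2)" for i and x :: "real ^ 'n"
  define H where "H j i x = of_real (2 * (if i = j then 1 else 0)) * g1 ((norm x)\<^sup>2)
      + of_real (4 * x $ j * x $ i) * g2 ((norm x)\<^sup>2)" for j i and x :: "real ^ 'n"
  have cf: "continuous_on UNIV f" unfolding f_def
    by (intro continuous_on_compose2[OF cg] continuous_intros) auto
  have cD: "continuous_on UNIV (D i)" for i unfolding D_def
    by (intro continuous_intros continuous_on_compose2[OF cont]) auto
  have mf: "f \<in> borel_measurable lebesgue" and mD: "D i \<in> borel_measurable lebesgue" for i
    using continuous_imp_measurable_on_sets_lebesgue[OF cf] continuous_imp_measurable_on_sets_lebesgue[OF cD] by simp_all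
  have mH: "H j i \<in> borel_measurable lebesgue" for j i
  proof -
    have "(\<lambda>x :: real ^ 'n. (norm x)\<^sup>2) \<in> borel \<rightarrow>\<^sub>M borel" by measurable
    moreover have "g1 \<in> borel_measurable borel" by (rule borel_measurable_continuous_onI[OF cont])
    ultimately have m: "(\<lambda>x :: real ^ 'n. g1 ((norm x)\<^sup>2)) \<in> borel_measurable borel"
       "(\<lambda>x :: real ^ 'n. g2 ((norm x)\<^sup>2)) \<in> borel_measurable borel"
      using meas by (auto intro: measurable_compose)
    have "(\<lambda>x :: real ^ 'n. complex_of_real (4 * x $ j * x $ i)) \<in> borel_measurable borel"
      by (intro borel_measurable_continuous_onI continuous_intros)
    then have "H j i \<in> borel_measurable borel" unfolding H_def[abs_def] using m by measurable
    then show ?thesis by (rule borel_measurable_imp_lebesgue)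
  qed
  have bf: "cmod (f x) \<le> A0 * exp (- \<kappa> * norm x)" for x
    using A0(2)[of "(norm x)\<^sup>2"] by (simp add: f_def eN)
  have bD: "cmod (D i x) \<le> (2 * A1) * exp (- \<kappa> * norm x)" for i x
  proof -
    have "cmod (D i x) = 2 * (\<bar>x $ i\<bar> * cmod (g1 ((norm x)\<^sup>2)))" by (simp add: D_def norm_mult)
    also have "\<dots> \<le> 2 * (norm x * cmod (g1 ((norm x)\<^sup>2)))"
      by (intro mult_left_mono mult_right_mono component_le_norm_cart) auto
    finally show ?thesis using A1(2)[of "(norm x)\<^sup>2"] by (simp add: eN)
  qed
  have bH: "cmod (H j i x) \<le> (2 * A2 + 4 * A3) * exp (- \<kappa> * norm x)" for j i x
  proof -
    have "cmod (H j i x) \<le> 2 * cmod (g1 ((norm x)\<^sup>2)) + 4 * ((\<bar>x $ j\<bar> * \<bar>x $ i\<bar>) * cmod (g2 ((norm x)\<^sup>2)))"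
      unfolding H_def by (rule order_trans[OF norm_triangle_ineq]) (auto simp: norm_mult abs_mult)
    also have "\<dots> \<le> 2 * cmod (g1 ((norm x)\<^sup>2)) + 4 * ((norm x * norm x) * cmod (g2 ((norm x)\<^sup>2)))"
      by (intro add_left_mono mult_left_mono mult_right_mono mult_mono component_le_norm_cart) auto
    also have "\<dots> \<le> 2 * (A2 * e ((norm x)\<^sup>2)) + 4 * (A3 * e ((norm x)\<^sup>2))"
      using A2(2)[of "(norm x)\<^sup>2"] A3[of "(norm x)\<^sup>2"] by (simp add: power2_eq_square)
    finally show ?thesis by (simp add: eN algebra_simps)
  qed
  have L2: "f \<in> Lp_space 2" "D i \<in> Lp_space 2" "H j i \<in> Lp_space 2" for i j
    using L2_exponential_decay[OF mf \<kappa> bf] L2_exponential_decay[OF mD \<kappa> bD] L2_exponential_decay[OF mH \<kappa> bH] by blast+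
  have locb: "\<exists>M. \<forall>x\<in>cball 0 r. cmod (F x) \<le> M" if "\<And>x. cmod (F x) \<le> A * exp (- \<kappa> * norm x)" for F :: "real ^ 'n \<Rightarrow> complex" and A r
  proof (intro exI ballI)
    fix x :: "real ^ 'n"
    have "A * exp (- \<kappa> * norm x) \<le> \<bar>A\<bar> * 1" using \<kappa> by (intro mult_mono) auto
    then show "cmod (F x) \<le> \<bar>A\<bar>" using that[of x] by simp
  qed
  let ?s = "\<lambda>i x t. (norm (x + t *\<^sub>R axis i 1 :: real ^ 'n))\<^sup>2"
  have ds: "(?s i x has_vector_derivative 2 * (x + t *\<^sub>R axis i 1) $ i) (at t)" for i x t
    using has_vector_derivative_line_norm_square[of x i t] by (simp add: has_real_derivative_iff_has_vector_derivative)
  have w1: "has_weak_deriv [i] f (D i)" for i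
  proof (rule has_weak_deriv_singleton[where N="{}", OF cf mD locb[OF bD]])
    show "((\<lambda>t. f (x + t *\<^sub>R axis i 1)) has_vector_derivative D i (x + t *\<^sub>R axis i 1)) (at t)" for x t
      using vector_diff_chain_at[OF ds[where i=i and x=x and t=t] dg[of "?s i x t"]]
      by (simp add: f_def D_def o_def scaleR_conv_of_real)
  qed auto
  have w2: "has_weak_deriv [i] (D j) (H j i)" for j i
  proof (rule has_weak_deriv_singleton[where N="{x. (norm x)\<^sup>2 \<in> B}", OF cD mH locb[OF bH]])
    show "negligible {x :: real ^ 'n. (norm x)\<^sup>2 \<in> B}" by (rule negligible_spheres[OF B])
    show "finite {t \<in> {a..b}. x + t *\<^sub>R axis i 1 \<in> {x. (norm x)\<^sup>2 \<in> B}}" for x :: "real ^ 'n" and a b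
      by (rule finite_line_meets_spheres[OF B])
    show "((\<lambda>t. D j (x + t *\<^sub>R axis i 1)) has_vector_derivative H j i (x + t *\<^sub>R axis i 1)) (at t)"
      if nB: "x + t *\<^sub>R axis i 1 \<notin> {x. (norm x)\<^sup>2 \<in> B}" for x t
    proof -
      have 1: "((\<lambda>t. g1 (?s i x t)) has_vector_derivative of_real (2 * (x + t *\<^sub>R axis i 1) $ i) * g2 (?s i x t)) (at t)"
        using vector_diff_chain_at[OF ds[where i=i and x=x and t=t] dg1[of "?s i x t"]] nB
        by (simp add: o_def scaleR_conv_of_real)
      have "((\<lambda>t. 2 * (x + t *\<^sub>R axis i 1) $ j) has_real_derivative 2 * (if i = j then 1 else 0)) (at t)"
        by (auto intro!: derivative_eq_intros simp: axis_def)
      then have 2: "((\<lambda>t. complex_of_real (2 * (x + t *\<^sub>R axis i 1) $ j)) has_vector_derivative of_real (2 * (if i = j then 1 else 0))) (at t)"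
        by (rule has_vector_derivative_of_real)
      show ?thesis
        using has_vector_derivative_mult[OF 2 1]
        by (simp add: D_def H_def algebra_simps)
    qed
  qed
  have w0: "has_weak_deriv [] f f"
    using w1 by (simp add: has_weak_deriv_def partial_derivs_def)
  have sob: "f \<in> sobolev_space 2 2"
    unfolding sobolev_space_def
  proof (intro CollectI conjI allI impI L2)
    fix l :: "'n list" assume "length l \<le> 2"
    then consider "l = []" | i where "l = [i]" | j i where "l = [j, i]"
      by (auto simp: numeral_2_eq_2 le_Suc_eq length_Suc_conv)
    then show "\<exists>g\<in>Lp_space 2. has_weak_deriv l f g"
      using w0 w1 has_weak_deriv_trans[OF w1 w2] L2 by cases blast+
  qed
  let ?V = "\<lambda>x :: real ^ 'n. v ((norm x)\<^sup>2)"
  have eq: "z * f x = - (\<Sum>i\<in>UNIV. H i i x) + ?V x * f x" for x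
  proof -
    have "(\<Sum>i\<in>UNIV. x $ i * x $ i) = (norm x)\<^sup>2"
      unfolding power2_norm_eq_inner inner_vec_def by simp
    then have "(\<Sum>i\<in>UNIV. 4 * x $ i * x $ i) = 4 * (norm x)\<^sup>2"
      by (simp only: mult.assoc sum_distrib_left[symmetric])
    then have "(\<Sum>i\<in>UNIV. complex_of_real (4 * x $ i * x $ i)) = of_real (4 * (norm x)\<^sup>2)"
      by (simp only: of_real_sum[symmetric])
    then have "(\<Sum>i\<in>UNIV. H i i x) = of_nat (2 * CARD('n)) * g1 ((norm x)\<^sup>2) + of_real (4 * (norm x)\<^sup>2) * g2 ((norm x)\<^sup>2)"
      unfolding H_def sum.distrib sum_distrib_right[symmetric] by simp
    then show ?thesis using ode[of "(norm x)\<^sup>2"] by (simp add: f_def algebra_simps add_eq_0_iff)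
  qed
  have zf: "(\<lambda>x. z * f x) \<in> Lp_space 2"
  proof (rule L2_exponential_decay[OF _ \<kappa>])
    show "cmod (z * f x) \<le> (cmod z * A0) * exp (- \<kappa> * norm x)" for x
      using mult_left_mono[OF bf[of x], of "cmod z"] by (simp add: norm_mult mult.assoc)
  qed (use mf in measurable)
  have op: "(f, \<lambda>x. z * f x) \<in> schroedinger_op ?V"
    unfolding schroedinger_op_def
  proof (intro CollectI case_prodI conjI sob zf exI[of _ "\<lambda>i. H i i"] allI L2)
    show "has_weak_deriv [i, i] f (H i i)" for i by (rule has_weak_deriv_trans[OF w1 w2])
    show "AE x in lebesgue. z * f x = - (\<Sum>i\<in>UNIV. H i i x) + ?V x * f x" by (intro AE_I2 eq)
  qed
  have "\<not> (AE x in lebesgue. f x = 0)"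
  proof
    assume "AE x in lebesgue. f x = 0"
    then have "AE x in lborel. f x = 0" by (simp add: AE_completion_iff)
    then have "f 0 = 0" using continuous_AE_eq_0 cf by blast
    then show False using g0 by (simp add: f_def)
  qed
  then show ?thesis unfolding eigenvalue_def using op by blast
qed

section \<open>Waves in a layer of constant potential\<close>

lemma csqrt_power2_cases: "csqrt (k\<^sup>2) = k \<or> csqrt (k\<^sup>2) = - k"
  using power2_csqrt[of "k\<^sup>2"] by (simp only: power2_eq_iff)

text \<open>The branch cut disappears for even functions. Off the cut the principal square root is
  holomorphic; on the cut the branch \<open>\<i> * csqrt (- z)\<close> may be used instead, since both roots give the same
  value; at the origin the singularity is removable.\<close>

lemma even_entire_csqrt:
  assumes hol: "h holomorphic_on UNIV" and even: "\<And>y. h (- y) = h y"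
  shows "(\<lambda>z. h (csqrt z)) holomorphic_on UNIV"
proof (rule no_isolated_singularity)
  have sq: "h (csqrt (k\<^sup>2)) = h k" for k
    using csqrt_power2_cases[of k] even[of k] by metis
  have nonpos: "(\<lambda>z. h (csqrt z)) field_differentiable at z" if "z \<notin> \<real>\<^sub>\<le>\<^sub>0" for z
  proof -
    have "(h \<circ> csqrt) field_differentiable at z"
      using that hol by (intro field_differentiable_compose field_differentiable_at_csqrt)
        (auto simp: holomorphic_on_def)
    then show ?thesis by (simp add: o_def)
  qed
  have "(\<lambda>z. h (csqrt z)) field_differentiable at z" if "z \<noteq> 0" for z
  proof (cases "z \<in> \<real>\<^sub>\<le>\<^sub>0")
    case True
    then have "- z \<notin> \<real>\<^sub>\<le>\<^sub>0" using that by (auto simp: complex_nonpos_Reals_iff complex_eq_iff)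
    then have "(csqrt \<circ> uminus) field_differentiable at z"
      by (intro field_differentiable_compose field_differentiable_at_csqrt) (auto intro!: derivative_intros)
    then have "(\<lambda>z. csqrt (- z)) field_differentiable at z" by (simp add: o_def)
    then have "(\<lambda>z. \<i> * csqrt (- z)) field_differentiable at z"
      by (intro derivative_intros)
    then have "(h \<circ> (\<lambda>z. \<i> * csqrt (- z))) field_differentiable at z"
      using hol by (intro field_differentiable_compose) (auto simp: holomorphic_on_def)
    moreover have "h \<circ> (\<lambda>z. \<i> * csqrt (- z)) = (\<lambda>z. h (csqrt z))"
    proof
      fix z
      show "(h \<circ> (\<lambda>z. \<i> * csqrt (- z))) z = h (csqrt z)"
        using sq[of "\<i> * csqrt (- z)"] by (simp add: power_mult_distrib)
    qed
    ultimately show ?thesis by simp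
  qed (use nonpos in blast)
  then show "(\<lambda>z. h (csqrt z)) holomorphic_on UNIV - {0}"
    by (simp add: holomorphic_on_def field_differentiable_at_within)
  then have c: "isCont (\<lambda>z. h (csqrt z)) z" if "z \<noteq> 0" for z
    using that holomorphic_on_imp_continuous_on[of "\<lambda>z. h (csqrt z)" "UNIV - {0}"]
    by (simp add: continuous_on_eq_continuous_at open_delete)
  have "isCont csqrt 0"
  proof -
    have "((\<lambda>z. sqrt (cmod z)) \<longlongrightarrow> sqrt (cmod 0)) (at 0)" by (intro tendsto_intros)
    then have "(csqrt \<longlongrightarrow> 0) (at 0)"
      by (intro tendsto_norm_zero_cancel[of csqrt]) (simp add: norm_csqrt)
    then show ?thesis by (simp add: isCont_def)
  qed
  moreover have "isCont h (csqrt 0)"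
    using hol holomorphic_on_imp_continuous_on[of h UNIV] by (simp add: continuous_on_eq_continuous_at)
  ultimately have "isCont (\<lambda>z. h (csqrt z)) 0" by (rule isCont_o2)
  then show "continuous_on UNIV (\<lambda>z. h (csqrt z))"
    using c by (metis continuous_at_imp_continuous_on)
qed auto

text \<open>Both functions are even in the square root, so they are entire in \<open>\<zeta>\<close>: the data at the far end of a layer
  depend holomorphically on the spectral parameter across the positive half-axis.\<close>

definition slab_cos :: "complex \<Rightarrow> real \<Rightarrow> complex" where
  "slab_cos \<zeta> x = cos (csqrt \<zeta> * x)"

definition slab_sin :: "complex \<Rightarrow> real \<Rightarrow> complex" where
  "slab_sin \<zeta> x = (if \<zeta> = 0 then of_real x else sin (csqrt \<zeta> * x) / csqrt \<zeta>)"

lemma slab_cos_square: "slab_cos (k\<^sup>2) x = cos (k * x)"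
  unfolding slab_cos_def using csqrt_power2_cases[of k] by (metis cos_minus mult_minus_left)

lemma slab_sin_square: "k \<noteq> 0 \<Longrightarrow> slab_sin (k\<^sup>2) x = sin (k * x) / k"
  unfolding slab_sin_def using csqrt_power2_cases[of k] by auto

lemma slab_at_0 [simp]: "slab_cos \<zeta> 0 = 1" "slab_sin \<zeta> 0 = 0"
  by (simp_all add: slab_cos_def slab_sin_def)

lemma slab_cos_deriv: "(slab_cos \<zeta> has_vector_derivative - \<zeta> * slab_sin \<zeta> x) (at x)"
proof (cases "\<zeta> = 0")
  case True
  then have "slab_cos \<zeta> = (\<lambda>_. 1)" by (simp add: slab_cos_def fun_eq_iff)
  then show ?thesis using True by simp
next
  case False
  define k where "k = csqrt \<zeta>"
  have k: "k \<noteq> 0" "k\<^sup>2 = \<zeta>" using False by (auto simp: k_def)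
  have "((\<lambda>y. cos (k * y)) has_field_derivative - k * sin (k * of_real x)) (at (of_real x))"
    by (auto intro!: derivative_eq_intros)
  then have "((\<lambda>x. cos (k * of_real x)) has_vector_derivative - k * sin (k * of_real x)) (at x)"
    by (rule has_vector_derivative_real_field)
  moreover have "- k * sin (k * of_real x) = - \<zeta> * slab_sin \<zeta> x"
    unfolding k(2)[symmetric] slab_sin_square[OF k(1)] using k(1) by (simp add: power2_eq_square)
  moreover have "slab_cos \<zeta> = (\<lambda>x. cos (k * of_real x))"
    by (simp add: slab_cos_def k_def fun_eq_iff)
  ultimately show ?thesis by simp
qed

lemma slab_sin_deriv: "(slab_sin \<zeta> has_vector_derivative slab_cos \<zeta> x) (at x)"
proof (cases "\<zeta> = 0")
  case True
  have "((\<lambda>x. of_real x) has_vector_derivative (1::complex)) (at x)"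
    by (rule has_vector_derivative_real_field[of "\<lambda>x. x"]) auto
  moreover have "slab_sin \<zeta> = of_real" using True by (simp add: slab_sin_def fun_eq_iff)
  ultimately show ?thesis using True by (simp add: slab_cos_def)
next
  case False
  define k where "k = csqrt \<zeta>"
  have k: "k \<noteq> 0" "k\<^sup>2 = \<zeta>" using False by (auto simp: k_def)
  have "((\<lambda>y. sin (k * y) / k) has_field_derivative cos (k * of_real x)) (at (of_real x))"
    using k(1) by (auto intro!: derivative_eq_intros)
  then have "((\<lambda>x. sin (k * of_real x) / k) has_vector_derivative cos (k * of_real x)) (at x)"
    by (rule has_vector_derivative_real_field)
  moreover have "slab_sin \<zeta> = (\<lambda>x. sin (k * of_real x) / k)"
    using False by (simp add: slab_sin_def k_def fun_eq_iff)
  ultimately show ?thesis by (simp add: slab_cos_def k_def)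
qed

lemma slab_cos_sin_squared: "(slab_cos \<zeta> x)\<^sup>2 + \<zeta> * (slab_sin \<zeta> x)\<^sup>2 = 1"
proof (cases "\<zeta> = 0")
  case False
  define k where "k = csqrt \<zeta>"
  have k: "k \<noteq> 0" "k\<^sup>2 = \<zeta>" using False by (auto simp: k_def)
  show ?thesis
    unfolding k(2)[symmetric] slab_sin_square[OF k(1)] slab_cos_square
    using k(1) by (simp add: power_divide)
qed (simp add: slab_cos_def)

lemma slab_cos_holomorphic: "(\<lambda>\<zeta>. slab_cos \<zeta> x) holomorphic_on UNIV"
  unfolding slab_cos_def
  by (rule even_entire_csqrt[of "\<lambda>y. cos (y * of_real x)"]) (auto intro!: holomorphic_intros)

lemma slab_sin_holomorphic: "(\<lambda>\<zeta>. slab_sin \<zeta> x) holomorphic_on UNIV"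
proof -
  define h where "h y = (if y = 0 then of_real x else sin (y * of_real x) / y)" for y :: complex
  have "h holomorphic_on UNIV"
  proof (rule no_isolated_singularity')
    have "h holomorphic_on (UNIV - {0}) \<longleftrightarrow> (\<lambda>y. sin (y * of_real x) / y) holomorphic_on (UNIV - {0})"
      by (rule holomorphic_cong) (auto simp: h_def)
    then show "h holomorphic_on (UNIV - {0})" by (auto intro!: holomorphic_intros)
    have "((\<lambda>y. sin (y * of_real x)) has_field_derivative of_real x) (at (0::complex))"
      by (auto intro!: derivative_eq_intros)
    then have "((\<lambda>y. sin (y * of_real x) / y) \<longlongrightarrow> of_real x) (at (0::complex))"
      by (simp add: has_field_derivative_iff)
    moreover have "\<forall>\<^sub>F y in at (0::complex). sin (y * of_real x) / y = h y"
      by (auto simp: h_def eventually_at_filter)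
    ultimately have "(h \<longlongrightarrow> of_real x) (at 0)" by (rule Lim_transform_eventually)
    then show "(h \<longlongrightarrow> h z) (at z within UNIV)" if "z \<in> {0}" for z using that by (simp add: h_def)
  qed auto
  then have "(\<lambda>z. h (csqrt z)) holomorphic_on UNIV"
    by (rule even_entire_csqrt) (simp add: h_def)
  moreover have "(\<lambda>z. h (csqrt z)) = (\<lambda>\<zeta>. slab_sin \<zeta> x)"
    by (simp add: fun_eq_iff h_def slab_sin_def)
  ultimately show ?thesis by simp
qed

text \<open>The solution of $w'' = -\zeta w$ with $w(0) = b$ and $w'(0) = a$; \<open>slab_der\<close> is its derivative.\<close>

definition slab_val :: "complex \<Rightarrow> complex \<Rightarrow> complex \<Rightarrow> real \<Rightarrow> complex" where
  "slab_val \<zeta> b a x = b * slab_cos \<zeta> x + a * slab_sin \<zeta> x"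

definition slab_der :: "complex \<Rightarrow> complex \<Rightarrow> complex \<Rightarrow> real \<Rightarrow> complex" where
  "slab_der \<zeta> b a x = a * slab_cos \<zeta> x - \<zeta> * b * slab_sin \<zeta> x"

lemma slab_val_deriv: "(slab_val \<zeta> b a has_vector_derivative slab_der \<zeta> b a x) (at x)"
proof -
  have "((\<lambda>x. b * slab_cos \<zeta> x + a * slab_sin \<zeta> x) has_vector_derivative
      b * (- \<zeta> * slab_sin \<zeta> x) + a * slab_cos \<zeta> x) (at x)"
    by (intro has_vector_derivative_add has_vector_derivative_mult_right slab_cos_deriv slab_sin_deriv)
  then show ?thesis by (simp add: slab_val_def[abs_def] slab_der_def algebra_simps)
qed

lemma slab_der_deriv: "(slab_der \<zeta> b a has_vector_derivative - \<zeta> * slab_val \<zeta> b a x) (at x)"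
proof -
  have "((\<lambda>x. a * slab_cos \<zeta> x - \<zeta> * b * slab_sin \<zeta> x) has_vector_derivative
      a * (- \<zeta> * slab_sin \<zeta> x) - \<zeta> * b * slab_cos \<zeta> x) (at x)"
    by (intro has_vector_derivative_diff has_vector_derivative_mult_right slab_cos_deriv slab_sin_deriv)
  then show ?thesis by (simp add: slab_val_def slab_der_def[abs_def] algebra_simps)
qed

lemma slab_at_left [simp]: "slab_val \<zeta> b a 0 = b" "slab_der \<zeta> b a 0 = a"
  by (simp_all add: slab_val_def slab_der_def)

lemma inner_rotate: "u \<bullet> (\<i> * k * u) = - Im k * (cmod u)\<^sup>2"
  by (simp add: inner_complex_def cmod_power2) (simp add: algebra_simps power2_eq_square)

text \<open>The mechanism of persistence. With $X = w' - ikw$ one has $X' = q w - i k X$, and the derivative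
  of $|X|^2 - \rho^2|w|^2$ is at least
  $2\kappa(|X|^2 + \rho^2|w|^2) - 2(|q| + \rho^2)|X||w| \ge 2\kappa(|X| - \rho|w|)^2 \ge 0$. For a solution that is
  purely decaying far out this says that the disc of radius $\rho$ about $ik$ is invariant for the
  logarithmic derivative as the radius decreases.\<close>

lemma cone_functional_mono:
  fixes w w' :: "real \<Rightarrow> complex" and k q :: complex
  assumes w: "\<And>r. (w has_vector_derivative w' r) (at r)"
    and w': "\<And>r. (w' has_vector_derivative - (k\<^sup>2 - q) * w r) (at r)"
    and k: "\<kappa> \<le> Im k" and \<rho>: "0 < \<rho>" "cmod q + \<rho>\<^sup>2 \<le> 2 * \<kappa> * \<rho>" and "x \<le> y"
  shows "(cmod (w' x - \<i> * k * w x))\<^sup>2 - \<rho>\<^sup>2 * (cmod (w x))\<^sup>2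
       \<le> (cmod (w' y - \<i> * k * w y))\<^sup>2 - \<rho>\<^sup>2 * (cmod (w y))\<^sup>2"
proof -
  define X where "X r = w' r - \<i> * k * w r" for r
  have X: "(X has_vector_derivative q * w r - \<i> * k * X r) (at r)" for r
  proof -
    have "(X has_vector_derivative (- (k\<^sup>2 - q) * w r - \<i> * k * w' r)) (at r)"
      unfolding X_def[abs_def] by (intro has_vector_derivative_diff has_vector_derivative_mult_right w w')
    also have "- (k\<^sup>2 - q) * w r - \<i> * k * w' r = q * w r - \<i> * k * X r"
      by (simp add: X_def algebra_simps power2_eq_square)
    finally show ?thesis .
  qed
  have sq: "((\<lambda>r. u r \<bullet> u r) has_vector_derivative 2 * (u r \<bullet> u')) (at r)"
    if "(u has_vector_derivative u') (at r)" for u u' and r :: real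
    using bounded_bilinear.has_vector_derivative[OF bounded_bilinear_inner that that]
    by (simp add: inner_commute)
  define \<phi> where "\<phi> r = X r \<bullet> X r - \<rho>\<^sup>2 * (w r \<bullet> w r)" for r
  have "\<phi> x \<le> \<phi> y"
  proof (rule DERIV_nonneg_imp_nondecreasing[OF \<open>x \<le> y\<close>])
    fix r
    let ?D = "2 * (X r \<bullet> (q * w r - \<i> * k * X r)) - \<rho>\<^sup>2 * (2 * (w r \<bullet> w' r))"
    have "(\<phi> has_vector_derivative ?D) (at r)"
      unfolding \<phi>_def[abs_def]
      by (intro has_vector_derivative_diff has_vector_derivative_mult_right sq X w)
    then have D: "(\<phi> has_real_derivative ?D) (at r)"
      by (simp add: has_real_derivative_iff_has_vector_derivative)
    note rot = inner_rotate[of _ k]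
    have "?D = 2 * (X r \<bullet> (q * w r)) + 2 * Im k * (cmod (X r))\<^sup>2
        - 2 * \<rho>\<^sup>2 * (w r \<bullet> X r) + 2 * \<rho>\<^sup>2 * Im k * (cmod (w r))\<^sup>2"
    proof -
      have "w' r = X r + \<i> * k * w r" by (simp add: X_def)
      then have "w r \<bullet> w' r = w r \<bullet> X r - Im k * (cmod (w r))\<^sup>2"
        by (simp add: inner_add_right rot)
      moreover have "X r \<bullet> (q * w r - \<i> * k * X r) = X r \<bullet> (q * w r) + Im k * (cmod (X r))\<^sup>2"
        by (simp add: inner_diff_right rot)
      ultimately show ?thesis by (simp only:) (simp add: right_diff_distrib distrib_left)
    qed
    moreover have "- (cmod (X r) * (cmod q * cmod (w r))) \<le> X r \<bullet> (q * w r)"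
      using Cauchy_Schwarz_ineq2[of "X r" "q * w r"] by (simp add: norm_mult abs_le_iff)
    moreover have "\<rho>\<^sup>2 * (w r \<bullet> X r) \<le> \<rho>\<^sup>2 * (cmod (w r) * cmod (X r))"
      using Cauchy_Schwarz_ineq2[of "w r" "X r"] by (intro mult_left_mono) (auto simp: abs_le_iff)
    moreover have "\<kappa> * (cmod (X r))\<^sup>2 \<le> Im k * (cmod (X r))\<^sup>2"
      "\<kappa> * (\<rho>\<^sup>2 * (cmod (w r))\<^sup>2) \<le> Im k * (\<rho>\<^sup>2 * (cmod (w r))\<^sup>2)"
      using k by (intro mult_right_mono; simp)+
    moreover have "0 \<le> \<kappa> * (cmod (X r))\<^sup>2 + \<kappa> * (\<rho>\<^sup>2 * (cmod (w r))\<^sup>2)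
        - cmod (X r) * (cmod q * cmod (w r)) - \<rho>\<^sup>2 * (cmod (w r) * cmod (X r))"
    proof -
      have "0 \<le> cmod q + \<rho>\<^sup>2" by simp
      then have "0 \<le> \<kappa>" using \<rho> by (smt (verit) mult_neg_pos zero_less_power2)
      then have "0 \<le> \<kappa> * (cmod (X r) - \<rho> * cmod (w r))\<^sup>2" by simp
      moreover have "(cmod q + \<rho>\<^sup>2) * (cmod (X r) * cmod (w r)) \<le> 2 * \<kappa> * \<rho> * (cmod (X r) * cmod (w r))"
        using \<rho>(2) by (intro mult_right_mono) auto
      ultimately show ?thesis by (simp add: power2_eq_square algebra_simps)
    qed
    ultimately have "0 \<le> ?D" by (simp add: algebra_simps)
    with D show "\<exists>y. (\<phi> has_real_derivative y) (at r) \<and> 0 \<le> y" by blast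
  qed
  then show ?thesis by (simp add: \<phi>_def X_def power2_norm_eq_inner)
qed

text \<open>In the cone $|w' - ikw| \le \rho|w|$ the logarithmic derivative of $|w|^2$ is at most
  $2(\rho - \mathrm{Im}\, k) \le -\kappa$.\<close>

lemma cone_decay:
  fixes w w' :: "real \<Rightarrow> complex" and k :: complex
  assumes w: "\<And>r. (w has_vector_derivative w' r) (at r)"
    and k: "\<kappa> \<le> Im k" and \<rho>: "2 * \<rho> \<le> \<kappa>"
    and cone: "\<And>r. x \<le> r \<Longrightarrow> r \<le> y \<Longrightarrow> cmod (w' r - \<i> * k * w r) \<le> \<rho> * cmod (w r)" and "x \<le> y"
  shows "(cmod (w y))\<^sup>2 * exp (\<kappa> * y) \<le> (cmod (w x))\<^sup>2 * exp (\<kappa> * x)"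
proof -
  define \<psi> where "\<psi> r = (w r \<bullet> w r) * exp (\<kappa> * r)" for r
  have "\<psi> y \<le> \<psi> x"
  proof (rule DERIV_nonpos_imp_nonincreasing[OF \<open>x \<le> y\<close>])
    fix r assume r: "x \<le> r" "r \<le> y"
    let ?D = "(2 * (w r \<bullet> w' r) + \<kappa> * (w r \<bullet> w r)) * exp (\<kappa> * r)"
    have "((\<lambda>r. w r \<bullet> w r) has_real_derivative 2 * (w r \<bullet> w' r)) (at r)"
      using bounded_bilinear.has_vector_derivative[OF bounded_bilinear_inner w[of r] w[of r]]
      by (simp add: inner_commute has_real_derivative_iff_has_vector_derivative)
    then have D: "(\<psi> has_real_derivative ?D) (at r)"
      unfolding \<psi>_def[abs_def] by (auto intro!: derivative_eq_intros simp: algebra_simps)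
    have "w' r = (w' r - \<i> * k * w r) + \<i> * k * w r" by simp
    then have "w r \<bullet> w' r = w r \<bullet> (w' r - \<i> * k * w r) + w r \<bullet> (\<i> * k * w r)"
      by (metis inner_add_right)
    also have "w r \<bullet> (\<i> * k * w r) = - Im k * (cmod (w r))\<^sup>2"
      by (rule inner_rotate)
    also have "w r \<bullet> (w' r - \<i> * k * w r) \<le> cmod (w r) * (\<rho> * cmod (w r))"
      using Cauchy_Schwarz_ineq2[of "w r" "w' r - \<i> * k * w r"] mult_left_mono[OF cone[OF r], of "cmod (w r)"]
      by auto
    finally have "w r \<bullet> w' r \<le> (\<rho> - Im k) * (cmod (w r))\<^sup>2"
      by (simp add: algebra_simps power2_eq_square)
    also have "\<dots> \<le> (- \<kappa> / 2) * (cmod (w r))\<^sup>2"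
      using k \<rho> by (intro mult_right_mono) auto
    finally have "2 * (w r \<bullet> w' r) + \<kappa> * (w r \<bullet> w r) \<le> 0" by (simp add: power2_norm_eq_inner[symmetric])
    then have "?D \<le> 0" by (simp add: mult_nonpos_nonneg)
    with D show "\<exists>y. (\<psi> has_real_derivative y) (at r) \<and> y \<le> 0" by blast
  qed
  then show ?thesis by (simp add: \<psi>_def power2_norm_eq_inner)
qed

section \<open>Radial waves in a ball without potential\<close>

text \<open>The regular radial solution of $-\Delta f = z f$ is $F(z|x|^2)$ with
  $F(y) = \sum_n (-y/4)^n / (n!\,(d/2)_n)$, a Bessel function of $\sqrt y$ up to a power of \<open>y\<close>.\<close>

lemma radial_free_solution:
  fixes d :: real
  assumes d: "d \<ge> 1"
  obtains F F' F'' :: "complex \<Rightarrow> complex" where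
    "\<And>z. (F has_field_derivative F' z) (at z)"
    "\<And>z. (F' has_field_derivative F'' z) (at z)"
    "continuous_on UNIV F''"
    "\<And>z. 4 * z * F'' z + 2 * of_real d * F' z + F z = 0"
    "F 0 = 1"
proof -
  define c :: "nat \<Rightarrow> complex" where "c n = (- 1 / 4) ^ n / (fact n * pochhammer (of_real (d / 2)) n)" for n
  define f where "f = Abs_fps c"
  have nz: "of_real (d / 2) + of_nat n \<noteq> (0::complex)" for n
  proof -
    have "of_real (d / 2) + of_nat n = complex_of_real (d / 2 + real n)" by simp
    also have "\<dots> \<noteq> 0" using d by (simp only: of_real_eq_0_iff)
    finally show ?thesis .
  qed
  have s: "c (Suc n) = c n * (- 1 / 4) / ((of_nat n + 1) * (of_real (d / 2) + of_nat n))" for n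
    by (simp add: c_def pochhammer_Suc field_simps)
  have rec: "(of_nat n + 1) * (4 * of_nat n + 2 * of_real d) * c (Suc n) = - c n" for n
  proof -
    have e: "4 * of_nat n + 2 * of_real d = (4::complex) * (of_real (d / 2) + of_nat n)" by simp
    have "of_nat n + 1 \<noteq> (0::complex)" by (metis of_nat_Suc of_nat_eq_0_iff add.commute nat.distinct(2))
    moreover have "u * (4 * v) * (x * (- 1 / 4) / (u * v)) = - x" if "u \<noteq> 0" "v \<noteq> 0" for u v x :: complex
      using that by simp
    ultimately show ?thesis unfolding s e using nz[of n] by blast
  qed
  \<comment> \<open>every factor of the Pochhammer symbol is at least 1/2, so the series is dominated by the exponential series\<close>
  have small: "norm (c n) \<le> 1 / fact n" for n
  proof (induction n)
    case (Suc n)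
    have "norm (of_real (d / 2) + of_nat n :: complex) = d / 2 + real n"
    proof -
      have "of_real (d / 2) + of_nat n = complex_of_real (d / 2 + real n)" by simp
      then show ?thesis using d by (simp only: norm_of_real)
    qed
    moreover have "norm (of_nat n + 1 :: complex) = real n + 1"
      by (metis norm_of_nat of_nat_Suc add.commute)
    ultimately have "norm (c (Suc n)) = norm (c n) * (1 / 4 / ((real n + 1) * (d / 2 + real n)))"
      unfolding s norm_mult norm_divide by simp
    also have "\<dots> \<le> 1 / fact n * (1 / (real n + 1))"
    proof (rule mult_mono[OF Suc.IH])
      have "1 / 4 \<le> d / 2 + real n" using d by simp
      then have "1 / 4 / (d / 2 + real n) \<le> 1" by (simp add: divide_le_eq)
      then have "1 / 4 / (d / 2 + real n) / (real n + 1) \<le> 1 / (real n + 1)" by (intro divide_right_mono) auto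
      then show "1 / 4 / ((real n + 1) * (d / 2 + real n)) \<le> 1 / (real n + 1)"
        by (metis divide_divide_eq_left mult.commute)
    qed (use d in auto)
    also have "\<dots> = 1 / fact (Suc n)" by (simp add: field_simps)
    finally show ?case .
  qed (simp add: c_def)
  have sm: "summable (\<lambda>n. c n * z ^ n)" for z
  proof (rule summable_comparison_test')
    show "summable (\<lambda>n. norm z ^ n /\<^sub>R fact n)" by (rule summable_exp_generic)
    show "norm (c n * z ^ n) \<le> norm z ^ n /\<^sub>R fact n" if "n \<ge> 0" for n
      using mult_right_mono[OF small[of n], of "norm z ^ n"] by (simp add: norm_mult norm_power field_simps)
  qed
  have "fps_conv_radius f = \<infinity>"
    unfolding fps_conv_radius_def f_def by (rule conv_radius_inftyI'') (simp add: sm)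
  then have R: "norm z < fps_conv_radius f" "norm z < fps_conv_radius (fps_deriv f)" "norm z < fps_conv_radius (fps_deriv (fps_deriv f))" for z :: complex
    using fps_conv_radius_deriv[of f] fps_conv_radius_deriv[of "fps_deriv f"] by auto
  have ode: "fps_const 4 * fps_X * fps_deriv (fps_deriv f) + fps_const (2 * of_real d) * fps_deriv f + f = 0"
  proof (rule fps_ext)
    fix n
    show "(fps_const 4 * fps_X * fps_deriv (fps_deriv f) + fps_const (2 * of_real d) * fps_deriv f + f) $ n = 0 $ n"
      using rec[of n] by (cases n) (simp_all add: f_def fps_X_mult_nth mult.assoc algebra_simps)
  qed
  show ?thesis
  proof
    show 1: "(eval_fps f has_field_derivative eval_fps (fps_deriv f) z) (at z)" for z
      using R by (intro has_field_derivative_eval_fps) 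
    show 2: "(eval_fps (fps_deriv f) has_field_derivative eval_fps (fps_deriv (fps_deriv f)) z) (at z)" for z
      using R by (intro has_field_derivative_eval_fps)
    show "continuous_on UNIV (eval_fps (fps_deriv (fps_deriv f)))"
      using R(3) by (intro continuous_on_subset[OF continuous_on_eval_fps]) (auto simp: eball_def)
    show "4 * z * eval_fps (fps_deriv (fps_deriv f)) z + 2 * of_real d * eval_fps (fps_deriv f) z + eval_fps f z = 0" for z
    proof -
      have "eval_fps (fps_const 4 * fps_X * fps_deriv (fps_deriv f) + fps_const (2 * of_real d) * fps_deriv f + f) z = 0"
        unfolding ode by simp
      moreover have "eval_fps (fps_const 4 * fps_X * fps_deriv (fps_deriv f) + fps_const (2 * of_real d) * fps_deriv f + f) z
         = 4 * z * eval_fps (fps_deriv (fps_deriv f)) z + 2 * of_real d * eval_fps (fps_deriv f) z + eval_fps f z"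
      proof -
        have i: "fps_conv_radius g = \<infinity>" if "g \<in> {f, fps_deriv f, fps_deriv (fps_deriv f)}" for g
          using that \<open>fps_conv_radius f = \<infinity>\<close> fps_conv_radius_deriv[of f] fps_conv_radius_deriv[of "fps_deriv f"] by auto
        have m: "fps_conv_radius (fps_const 4 * fps_X * fps_deriv (fps_deriv f)) = \<infinity>"
          "fps_conv_radius (fps_const (2 * of_real d) * fps_deriv f) = \<infinity>"
          "fps_conv_radius (fps_const 4 * fps_X :: complex fps) = \<infinity>"
          using fps_conv_radius_mult[of "fps_const 4 * fps_X" "fps_deriv (fps_deriv f)"]
            fps_conv_radius_mult[of "fps_const 4" "fps_X :: complex fps"] 
            fps_conv_radius_mult[of "fps_const (2 * of_real d)" "fps_deriv f"] i by auto
        have "fps_conv_radius (fps_const 4 * fps_X * fps_deriv (fps_deriv f) + fps_const (2 * of_real d) * fps_deriv f) = \<infinity>"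
          using fps_conv_radius_add[of "fps_const 4 * fps_X * fps_deriv (fps_deriv f)" "fps_const (2 * of_real d) * fps_deriv f"] m by auto
        then show ?thesis using m i
          by (simp add: eval_fps_add eval_fps_mult)
      qed
      ultimately show ?thesis by simp
    qed
    show "eval_fps f 0 = 1" by (simp add: eval_fps_at_0 f_def c_def)
  qed
qed

section \<open>Matching functions and their zeros\<close>

text \<open>If $a^2 = -z b^2$ held identically, the order of vanishing at 0 would be even on the left and
  odd on the right unless both functions vanish; so \<open>a 0 = b 0 = 0\<close>. The factorisation
  $a^2 + z b^2 = (a + i\sqrt z\,b)(a - i\sqrt z\,b)$ makes this the nondegeneracy of both matching conditions.\<close>

lemma entire_square_plus_not_identically_0:
  assumes a: "a holomorphic_on UNIV" and b: "b holomorphic_on UNIV"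
    and nz: "a 0 \<noteq> 0 \<or> b 0 \<noteq> (0::complex)"
    and S: "open S" "S \<noteq> {}"
  shows "\<exists>z\<in>S. (a z)\<^sup>2 + z * (b z)\<^sup>2 \<noteq> 0"
proof (rule ccontr)
  assume n: "\<not> (\<exists>z\<in>S. (a z)\<^sup>2 + z * (b z)\<^sup>2 \<noteq> 0)"
  have hol: "(\<lambda>z. (a z)\<^sup>2 + z * (b z)\<^sup>2) holomorphic_on UNIV"
    using a b by (auto intro!: holomorphic_intros)
  have 0: "(a z)\<^sup>2 + z * (b z)\<^sup>2 = 0" for z
    by (rule analytic_continuation_open[OF S(1) open_UNIV S(2) connected_UNIV _ hol, where g="\<lambda>_. 0"])
       (use n in auto)
  have a0: "a 0 = 0" using 0[of 0] by simp
  have "(a has_field_derivative deriv a 0) (at 0)"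
    using a by (simp add: DERIV_deriv_iff_field_differentiable holomorphic_on_def)
  then have "((\<lambda>z. a z / z) \<longlongrightarrow> deriv a 0) (at 0)"
    using a0 by (simp add: has_field_derivative_iff)
  moreover have ca: "isCont a 0" and cb: "isCont b 0"
    using a b holomorphic_on_imp_continuous_on[of _ UNIV] by (auto simp: continuous_on_eq_continuous_at)
  then have "(a \<longlongrightarrow> 0) (at 0)" using a0 by (simp add: isCont_def)
  ultimately have "((\<lambda>z. a z * (a z / z)) \<longlongrightarrow> 0 * deriv a 0) (at 0)"
    by (intro tendsto_mult)
  moreover have "\<forall>\<^sub>F z in at 0. a z * (a z / z) = - (b z)\<^sup>2"
  proof -
    have "a z * (a z / z) = - (b z)\<^sup>2" if "z \<noteq> 0" for z
      using 0[of z] that by (simp add: field_simps power2_eq_square add_eq_0_iff)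
    then show ?thesis by (auto simp: eventually_at_filter)
  qed
  ultimately have "((\<lambda>z. - (b z)\<^sup>2) \<longlongrightarrow> 0) (at 0)"
    using Lim_transform_eventually by fastforce
  moreover have "((\<lambda>z. - (b z)\<^sup>2) \<longlongrightarrow> - (b 0)\<^sup>2) (at 0)"
    using cb unfolding isCont_def by (intro tendsto_intros)
  ultimately have "b 0 = 0" using LIM_unique by fastforce
  then show False using nz a0 by simp
qed

text \<open>The condition excludes that at energy \<open>E'\<close> the inner solution consists of an incoming or an
  outgoing wave only, so that the quotient of the two amplitudes, which enters the matching condition of a layer,
  is neither zero nor infinite.\<close>

lemma nondegenerate_energy:
  assumes a: "a holomorphic_on UNIV" and b: "b holomorphic_on UNIV"
    and nz: "a 0 \<noteq> 0 \<or> b 0 \<noteq> (0::complex)" and E: "E > 0" "\<epsilon> > 0"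
  obtains E' :: real where "E' > 0" "\<bar>E' - E\<bar> < \<epsilon>" "(a (of_real E'))\<^sup>2 + of_real E' * (b (of_real E'))\<^sup>2 \<noteq> 0"
proof -
  let ?P = "\<lambda>z. (a z)\<^sup>2 + z * (b z)\<^sup>2"
  let ?U = "of_real ` {max (E/2) (E - \<epsilon>/2)<..<E + \<epsilon>/2} :: complex set"
  have "\<exists>E'\<in>{max (E/2) (E - \<epsilon>/2)<..<E + \<epsilon>/2}. ?P (of_real E') \<noteq> 0"
  proof (rule ccontr)
    assume n: "\<not> ?thesis"
    have "?P w = 0" for w
    proof (rule analytic_continuation[of ?P UNIV ?U "of_real E"])
      show "?P holomorphic_on UNIV" using a b by (auto intro!: holomorphic_intros)
      show "complex_of_real E islimpt ?U"
      proof -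
        have "E islimpt {max (E/2) (E - \<epsilon>/2)<..<E + \<epsilon>/2}"
          using E by (intro open_imp_islimpt) auto
        then have L: "\<exists>x'\<in>{max (E/2) (E - \<epsilon>/2)<..<E + \<epsilon>/2}. x' \<noteq> E \<and> dist x' E < e" if "e > 0" for e
          using that by (simp only: islimpt_approachable)
        show ?thesis unfolding islimpt_approachable
        proof (intro allI impI)
          fix e :: real assume "e > 0"
          from L[OF this] obtain x' where "x' \<in> {max (E/2) (E - \<epsilon>/2)<..<E + \<epsilon>/2}" "x' \<noteq> E" "dist x' E < e" by blast
          then show "\<exists>x'\<in>?U. x' \<noteq> complex_of_real E \<and> dist x' (complex_of_real E) < e"
            by (intro bexI[of _ "of_real x'"]) (auto simp: dist_of_real)
        qed
      qed
      show "?P z = 0" if "z \<in> ?U" for z using n that by auto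
    qed auto
    then show False using entire_square_plus_not_identically_0[OF a b nz open_UNIV] by auto
  qed
  then obtain E' where E': "E' \<in> {max (E/2) (E - \<epsilon>/2)<..<E + \<epsilon>/2}" "?P (of_real E') \<noteq> 0" by blast
  have "E' > 0" "\<bar>E' - E\<bar> < \<epsilon>" using E'(1) E unfolding greaterThanLessThan_iff abs_less_iff max_less_iff_conj by linarith+
  then show ?thesis using that E'(2) by blast
qed

lemma Im_csqrt_neg: "Im z < 0 \<Longrightarrow> Im (csqrt z) < 0"
  by (metis csqrt_principal Im_complex_of_real add.commute linorder_not_less mult_nonneg_nonneg power2_csqrt Im_power2 mult_eq_0_iff zero_le_numeral order_le_less)

text \<open>The data that protect a zero \<open>\<mu>\<close> of the matching function against later layers: a disc in the lower half-plane,
  a lower bound \<open>\<kappa>\<close> for the decay rate there, and a \<open>\<rho>\<close> so small that an error \<open>\<rho>\<close> in the logarithmic derivative of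
  the outer solution cannot remove the zero. The two terms on the left of the last inequality are the possible
  errors at the centre and on the boundary.\<close>

definition protected_zero ::
    "(complex \<Rightarrow> complex) \<Rightarrow> (complex \<Rightarrow> complex) \<Rightarrow> complex \<Rightarrow> real \<Rightarrow> real \<Rightarrow> real \<Rightarrow> bool" where
  "protected_zero b a \<mu> rad \<kappa> \<rho> \<longleftrightarrow>
     a \<mu> + \<i> * csqrt \<mu> * b \<mu> = 0 \<and> rad > 0 \<and> \<kappa> > 0 \<and> \<rho> > 0 \<and> 2 * \<rho> \<le> \<kappa> \<and>
     (\<forall>z\<in>cball \<mu> rad. Im z < 0 \<and> \<kappa> \<le> Im (- csqrt z)) \<and>
     (\<forall>z\<in>sphere \<mu> rad. \<rho> * cmod (b \<mu>) + \<rho> * cmod (b z) < cmod (a z + \<i> * csqrt z * b z))"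

text \<open>The matching function is holomorphic in the lower half-plane and does not vanish identically there,
  so its zeros are isolated; the constants come from compactness of the disc.\<close>

lemma isolated_resonance:
  assumes a: "a holomorphic_on UNIV" and b: "b holomorphic_on UNIV"
    and nz: "a 0 \<noteq> 0 \<or> b 0 \<noteq> (0::complex)"
    and \<mu>: "Im \<mu> < 0" "a \<mu> + \<i> * csqrt \<mu> * b \<mu> = 0" and \<epsilon>: "\<epsilon> > 0"
  obtains rad \<kappa> \<rho> :: real where "rad < \<epsilon>" "protected_zero b a \<mu> rad \<kappa> \<rho>"
proof -
  let ?F = "\<lambda>z. a z + \<i> * csqrt z * b z"
  let ?H = "{z. Im z < 0}"
  have H: "open ?H" "connected ?H"
    by (auto simp: open_halfspace_Im_lt intro!: convex_connected convex_halfspace_Im_lt)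
  have nr: "z \<notin> \<real>\<^sub>\<le>\<^sub>0" if "Im z < 0" for z using that by (auto simp: complex_nonpos_Reals_iff)
  have hol: "?F holomorphic_on ?H"
    by (intro holomorphic_intros holomorphic_on_subset[OF a] holomorphic_on_subset[OF b]) (auto simp: nr)
  have "\<exists>\<beta>\<in>?H. ?F \<beta> \<noteq> 0"
  proof -
    have "\<exists>z\<in>?H. (a z)\<^sup>2 + z * (b z)\<^sup>2 \<noteq> 0"
      by (rule entire_square_plus_not_identically_0[OF a b nz H(1)]) (use \<mu> in auto)
    moreover have "?F z = 0 \<Longrightarrow> (a z)\<^sup>2 + z * (b z)\<^sup>2 = 0" for z
    proof -
      assume "?F z = 0"
      then have "a z = - (\<i> * csqrt z * b z)" by (simp add: add_eq_0_iff2)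
      then show ?thesis by (simp add: power_mult_distrib)
    qed
    ultimately show ?thesis by blast
  qed
  then obtain \<beta> where \<beta>: "\<beta> \<in> ?H" "?F \<beta> \<noteq> 0" by blast
  obtain r where r: "0 < r" "ball \<mu> r \<subseteq> ?H" "\<And>z. z \<in> ball \<mu> r - {\<mu>} \<Longrightarrow> ?F z \<noteq> 0"
    using isolated_zeros[OF hol H, of \<mu> \<beta>] \<mu> \<beta> by blast
  define rad where "rad = min r \<epsilon> / 2"
  have rad: "rad > 0" "rad < \<epsilon>" "rad < r" using r(1) \<epsilon> by (auto simp: rad_def min_def)
  have sub: "Im z < 0" if "z \<in> cball \<mu> rad" for z
  proof -
    have "z \<in> ball \<mu> r" using that rad(3) by simp
    then show ?thesis using r(2) by blast
  qed
  have cc: "continuous_on (cball \<mu> rad) csqrt"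
    by (intro holomorphic_on_imp_continuous_on holomorphic_intros) (use sub nr in auto)
  have cb: "continuous_on (cball \<mu> rad) b" and ca: "continuous_on (cball \<mu> rad) a"
    using a b holomorphic_on_imp_continuous_on continuous_on_subset by blast+
  have "\<exists>z0\<in>cball \<mu> rad. \<forall>z\<in>cball \<mu> rad. Im (- csqrt z0) \<le> Im (- csqrt z)"
    by (intro continuous_attains_inf continuous_on_Im continuous_on_minus cc compact_cball) (use rad in simp)
  then obtain z0 where z0: "z0 \<in> cball \<mu> rad" "\<And>z. z \<in> cball \<mu> rad \<Longrightarrow> Im (- csqrt z0) \<le> Im (- csqrt z)"
    by blast
  define \<kappa> where "\<kappa> = Im (- csqrt z0)"
  have "Im (csqrt z0) < 0" by (rule Im_csqrt_neg[OF sub[OF z0(1)]])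
  then have \<kappa>: "\<kappa> > 0" by (simp add: \<kappa>_def)
  have sne: "sphere \<mu> rad \<noteq> {}" using rad by simp
  have "continuous_on (sphere \<mu> rad) (\<lambda>z. cmod (?F z))"
    by (intro continuous_intros continuous_on_subset[OF ca] continuous_on_subset[OF cb] continuous_on_subset[OF cc]) auto
  from continuous_attains_inf[OF compact_sphere sne this] obtain z1 where
    z1: "z1 \<in> sphere \<mu> rad" "\<And>z. z \<in> sphere \<mu> rad \<Longrightarrow> cmod (?F z1) \<le> cmod (?F z)" by blast
  define c where "c = cmod (?F z1)"
  have c: "c > 0"
  proof -
    have "z1 \<in> ball \<mu> r - {\<mu>}" using z1(1) rad by auto
    then show ?thesis using r(3) by (simp add: c_def)
  qed
  have "bounded (b ` cball \<mu> rad)" by (intro compact_imp_bounded compact_continuous_image cb) auto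
  then obtain B where B: "B > 0" "\<And>z. z \<in> cball \<mu> rad \<Longrightarrow> cmod (b z) \<le> B"
    unfolding bounded_pos by blast
  define \<rho> where "\<rho> = min (\<kappa> / 2) (c / (4 * B))"
  have \<rho>: "\<rho> > 0" "2 * \<rho> \<le> \<kappa>" "\<rho> * B \<le> c / 4" using \<kappa> c B(1) by (auto simp: \<rho>_def min_def field_simps)
  have gap: "\<rho> * cmod (b \<mu>) + \<rho> * cmod (b z) < cmod (?F z)" if z: "z \<in> sphere \<mu> rad" for z
  proof -
    have "\<rho> * cmod (b \<mu>) \<le> \<rho> * B" "\<rho> * cmod (b z) \<le> \<rho> * B"
      using z rad \<rho>(1) by (auto intro!: mult_left_mono B(2))
    then have "\<rho> * cmod (b \<mu>) + \<rho> * cmod (b z) \<le> c / 2" using \<rho>(3) by linarith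
    also have "\<dots> < cmod (?F z)" using z1(2)[OF z] c unfolding c_def by linarith
    finally show ?thesis .
  qed
  have "protected_zero b a \<mu> rad \<kappa> \<rho>"
    unfolding protected_zero_def using \<mu>(2) rad(1) \<kappa> \<rho>(1,2) sub z0(2) gap by (simp add: \<kappa>_def)
  then show ?thesis using that rad(2) by blast
qed

section \<open>One layer creates an eigenvalue\<close>

text \<open>In terms of the waves $e^{\pm ik'x}$ the solution has amplitudes proportional to \<open>\<i> * k' * b + a\<close> and
  \<open>\<i> * k' * b - a\<close>, and $w' = ikw$ at the right end becomes an equation for $e^{2ik'L}$.\<close>

lemma slab_matching_condition:
  fixes a b k k' :: complex and L :: real
  assumes k': "k' \<noteq> 0"
    and e: "exp (2 * \<i> * k' * L) * ((k' - k) * (\<i> * k' * b + a)) = (k' + k) * (\<i> * k' * b - a)"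
  shows "slab_der (k'\<^sup>2) b a L = \<i> * k * slab_val (k'\<^sup>2) b a L"
proof -
  define x y where "x = exp (\<i> * (k' * L))" and "y = exp (- (\<i> * (k' * L)))"
  have xy: "x * y = 1" by (simp add: x_def y_def exp_minus)
  have "exp (2 * \<i> * k' * L) = x * x"
    by (simp add: x_def exp_double[symmetric] power2_eq_square[symmetric] mult.assoc)
  then have "x * x * ((k' - k) * (\<i> * k' * b + a)) = (k' + k) * (\<i> * k' * b - a)" using e by simp
  then have "y * (x * x * ((k' - k) * (\<i> * k' * b + a))) = y * ((k' + k) * (\<i> * k' * b - a))" by simp
  then have xe: "x * ((k' - k) * (\<i> * k' * b + a)) = y * ((k' + k) * (\<i> * k' * b - a))"
    using xy by (metis (no_types, opaque_lifting) mult.assoc mult.commute mult.left_neutral)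
  have c: "slab_cos (k'\<^sup>2) L = (x + y) / 2"
    by (simp add: slab_cos_square cos_exp_eq x_def y_def)
  have s: "slab_sin (k'\<^sup>2) L = (x - y) / (2 * \<i>) / k'"
    using k' by (simp add: slab_sin_square sin_exp_eq x_def y_def)
  have "2 * k' * (slab_der (k'\<^sup>2) b a L - \<i> * k * slab_val (k'\<^sup>2) b a L)
    = x * ((k' - k) * (\<i> * k' * b + a)) - y * ((k' + k) * (\<i> * k' * b - a))"
    unfolding slab_der_def slab_val_def c s using k' by (simp add: field_simps power2_eq_square)
  also have "\<dots> = 0" using xe by simp
  finally show ?thesis using k' by simp
qed

text \<open>All smallness conditions on \<open>\<delta>\<close>. The third gives thickness at least 1, the fourth makes the phase run
  through more than a full turn as \<open>\<tau>\<close> goes from \<open>\<delta>\<close> to \<open>2 * \<delta>\<close>, and the last is the bound on the cost.\<close>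

lemma small_slab_asymptotics:
  fixes c k R \<eta> p :: real and d :: nat
  assumes "c > 0" "k > 0" "\<eta> > 0" "d \<ge> 1" "p > real d"
  shows "\<forall>\<^sub>F \<delta> in at_right 0.
     3 * \<delta> * (2 * k + \<delta>) \<le> \<eta> \<and> \<delta>\<^sup>2 + 2 * k * \<delta> < \<eta> \<and>
     1 \<le> ln (c / (6 * \<delta>)) / (4 * \<delta>) \<and>
     3 * pi \<le> 2 * k * (ln (c / (4 * \<delta>)) / (2 * \<delta>) - ln (c / (2 * \<delta>)) / (4 * \<delta>)) \<and>
     (3 * \<delta> * (2 * k + \<delta>)) powr p * (R + ln (3 * c / (4 * \<delta>)) / (2 * \<delta>)) ^ d \<le> \<eta>"
proof -
  have "((\<lambda>\<delta>. 3 * \<delta> * (2 * k + \<delta>)) \<longlongrightarrow> 0) (at_right 0)" by real_asymp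
  then have 1: "\<forall>\<^sub>F \<delta> in at_right 0. 3 * \<delta> * (2 * k + \<delta>) < \<eta>" by (rule order_tendstoD) fact
  have "((\<lambda>\<delta>. \<delta>\<^sup>2 + 2 * k * \<delta>) \<longlongrightarrow> 0) (at_right 0)" by real_asymp
  then have 2: "\<forall>\<^sub>F \<delta> in at_right 0. \<delta>\<^sup>2 + 2 * k * \<delta> < \<eta>" by (rule order_tendstoD) fact
  have "filterlim (\<lambda>\<delta>. ln (c / (6 * \<delta>)) / (4 * \<delta>)) at_top (at_right 0)"
    using \<open>c > 0\<close> by real_asymp
  then have 3: "\<forall>\<^sub>F \<delta> in at_right 0. 1 \<le> ln (c / (6 * \<delta>)) / (4 * \<delta>)"
    unfolding filterlim_at_top by blast
  have "filterlim (\<lambda>\<delta>. 2 * k * (ln (c / (4 * \<delta>)) / (2 * \<delta>) - ln (c / (2 * \<delta>)) / (4 * \<delta>))) at_top (at_right 0)"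
    using \<open>c > 0\<close> \<open>k > 0\<close> by real_asymp
  then have 4: "\<forall>\<^sub>F \<delta> in at_right 0. 3 * pi \<le> 2 * k * (ln (c / (4 * \<delta>)) / (2 * \<delta>) - ln (c / (2 * \<delta>)) / (4 * \<delta>))"
    unfolding filterlim_at_top by blast
  define s where "s = p / real d - 1"
  have s: "s > 0" "p = (1 + s) * real d" using assms by (auto simp: s_def field_simps)
  have "((\<lambda>\<delta>. (3 * \<delta> * (2 * k + \<delta>)) powr (1 + s) * (R + ln (3 * c / (4 * \<delta>)) / (2 * \<delta>))) \<longlongrightarrow> 0) (at_right 0)"
    using \<open>c > 0\<close> \<open>k > 0\<close> s(1) by real_asymp
  then have "((\<lambda>\<delta>. ((3 * \<delta> * (2 * k + \<delta>)) powr (1 + s) * (R + ln (3 * c / (4 * \<delta>)) / (2 * \<delta>))) ^ d) \<longlongrightarrow> 0 ^ d) (at_right 0)"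
    by (rule tendsto_power)
  then have "((\<lambda>\<delta>. ((3 * \<delta> * (2 * k + \<delta>)) powr (1 + s) * (R + ln (3 * c / (4 * \<delta>)) / (2 * \<delta>))) ^ d) \<longlongrightarrow> 0) (at_right 0)"
    using \<open>d \<ge> 1\<close> by (simp add: power_0_left)
  then have "\<forall>\<^sub>F \<delta> in at_right 0. ((3 * \<delta> * (2 * k + \<delta>)) powr (1 + s) * (R + ln (3 * c / (4 * \<delta>)) / (2 * \<delta>))) ^ d < \<eta>"
    by (rule order_tendstoD) fact
  moreover have "\<forall>\<^sub>F \<delta> in at_right (0::real). \<delta> > 0" by (simp add: eventually_at_right_less)
  ultimately have "\<forall>\<^sub>F \<delta> in at_right 0. (3 * \<delta> * (2 * k + \<delta>)) powr p * (R + ln (3 * c / (4 * \<delta>)) / (2 * \<delta>)) ^ d < \<eta>"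
  proof eventually_elim
    case (elim \<delta>)
    have "3 * \<delta> * (2 * k + \<delta>) > 0" using elim(2) \<open>k > 0\<close> by simp
    then have "(3 * \<delta> * (2 * k + \<delta>)) powr (1 + s) > 0" using powr_gt_zero by force
    from powr_realpow[OF this, of d]
    have "((3 * \<delta> * (2 * k + \<delta>)) powr (1 + s)) ^ d = (3 * \<delta> * (2 * k + \<delta>)) powr p"
      unfolding s(2) powr_powr by simp
    then show ?case using elim(1) by (simp add: power_mult_distrib)
  qed
  with 1 2 3 4 show ?thesis by eventually_elim (simp add: less_imp_le)
qed

text \<open>The construction of a single layer. The quotient \<open>N / D\<close> is the function $\Phi$ of the matching condition
  without its pole at $k' = k$, and \<open>C\<close> is its limit as \<open>\<delta>\<close> tends to 0.\<close>

lemma slab_creates_resonance: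
  fixes a b :: "complex \<Rightarrow> complex" and E \<eta> R p :: real and d :: nat
  assumes a: "a holomorphic_on UNIV" and b: "b holomorphic_on UNIV"
    and E: "E > 0" and nd: "(a (of_real E))\<^sup>2 + of_real E * (b (of_real E))\<^sup>2 \<noteq> 0"
    and \<eta>: "\<eta> > 0" and d: "d \<ge> 1" "p > real d" and R: "R \<ge> 0"
  obtains q \<mu> :: complex and L :: real where
    "L \<ge> 1" "cmod q \<le> \<eta>" "cmod q powr p * (R + L) ^ d \<le> \<eta>"
    "Im \<mu> < 0" "cmod (\<mu> - of_real E) < \<eta>"
    "slab_der (\<mu> - q) (b \<mu>) (a \<mu>) L = - \<i> * csqrt \<mu> * slab_val (\<mu> - q) (b \<mu>) (a \<mu>) L"
proof -
  define k0 where "k0 = sqrt E"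
  have k0: "k0 > 0" "(of_real k0)\<^sup>2 = complex_of_real E"
    using E by (simp_all add: k0_def flip: of_real_power)
  define N where "N = (\<lambda>(k::complex, k'). (k' + k) * (\<i> * k' * b (k\<^sup>2) - a (k\<^sup>2)))"
  define D where "D = (\<lambda>(k::complex, k'). \<i> * k' * b (k\<^sup>2) + a (k\<^sup>2))"
  define P0 where "P0 = (- complex_of_real k0, - complex_of_real k0)"
  have ND: "N P0 * D P0 = (- 2 * of_real k0) * (- ((a (of_real E))\<^sup>2 + of_real E * (b (of_real E))\<^sup>2))"
    unfolding N_def D_def P0_def by (simp add: k0(2)) (simp add: k0(2)[symmetric] algebra_simps power2_eq_square)
  have ne: "N P0 * D P0 \<noteq> 0" unfolding ND mult_eq_0_iff neg_equal_0_iff_equal using k0(1) nd by simp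
  have ca: "continuous_on UNIV a" and cb: "continuous_on UNIV b"
    using a b by (auto intro: holomorphic_on_imp_continuous_on)
  have cN: "continuous_on UNIV N" and cD: "continuous_on UNIV D"
    unfolding N_def D_def case_prod_beta
    by (intro continuous_intros continuous_on_compose2[OF ca] continuous_on_compose2[OF cb]; simp)+
  define C where "C = N P0 / D P0"
  define c where "c = cmod C"
  have C0: "C \<noteq> 0" "c > 0" "D P0 \<noteq> 0" using ne by (auto simp: C_def c_def)
  have cN0: "isCont N P0" and cD0: "isCont D P0"
    using cN cD by (metis UNIV_I continuous_on_eq_continuous_at open_UNIV)+
  have cr: "isCont (\<lambda>P. N P / D P / C) P0"
    using C0 by (intro continuous_intros cN0 cD0)
  have "\<forall>\<^sub>F P in nhds P0. dist (N P / D P / C) 1 < 1 / 2"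
  proof -
    have "N P0 / D P0 / C = 1" using C0 by (simp add: C_def)
    moreover have "((\<lambda>P. N P / D P / C) \<longlongrightarrow> N P0 / D P0 / C) (nhds P0)"
      using cr unfolding isCont_def by (rule tendsto_at_iff_tendsto_nhds[THEN iffD1])
    ultimately have "((\<lambda>P. N P / D P / C) \<longlongrightarrow> 1) (nhds P0)" by simp
    then show ?thesis by (rule tendstoD) simp
  qed
  moreover have "\<forall>\<^sub>F P in nhds P0. D P \<noteq> 0"
    using cD0 C0(3) unfolding isCont_def
    by (intro tendsto_imp_eventually_ne[OF tendsto_at_iff_tendsto_nhds[THEN iffD1]])
  ultimately have "\<forall>\<^sub>F P in nhds P0. dist (N P / D P / C) 1 < 1 / 2 \<and> D P \<noteq> 0"
    by (rule eventually_conj)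
  then obtain e where e: "e > 0" "\<And>P. dist P P0 < e \<Longrightarrow> dist (N P / D P / C) 1 < 1 / 2 \<and> D P \<noteq> 0"
    unfolding eventually_nhds_metric by blast
  have "\<forall>\<^sub>F \<delta> in at_right (0::real). \<delta> < e / 4"
    using e(1) by (intro order_tendstoD[of "\<lambda>x. x"]) (auto intro!: tendsto_eq_intros)
  from eventually_happens'[OF trivial_limit_at_right_real
      eventually_conj[OF this eventually_conj[OF eventually_at_right_less
        small_slab_asymptotics[OF C0(2) k0(1) \<eta> d, of R]]]]
  obtain \<delta> where \<delta>: "\<delta> < e / 4" "0 < \<delta>" "3 * \<delta> * (2 * k0 + \<delta>) \<le> \<eta>" "\<delta>\<^sup>2 + 2 * k0 * \<delta> < \<eta>"
     "1 \<le> ln (c / (6 * \<delta>)) / (4 * \<delta>)"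
     "3 * pi \<le> 2 * k0 * (ln (c / (4 * \<delta>)) / (2 * \<delta>) - ln (c / (2 * \<delta>)) / (4 * \<delta>))"
     "(3 * \<delta> * (2 * k0 + \<delta>)) powr p * (R + ln (3 * c / (4 * \<delta>)) / (2 * \<delta>)) ^ d \<le> \<eta>"
    by (elim exE conjE)
  define k where "k = Complex (- k0) \<delta>"
  define \<mu> where "\<mu> = k\<^sup>2"
  define k' where "k' \<tau> = Complex (- k0) (- \<tau>)" for \<tau>
  define u where "u \<tau> = N (k, k' \<tau>) / D (k, k' \<tau>) / C" for \<tau>
  have kr: "csqrt \<mu> = - k"
  proof (rule csqrt_unique)
    show "(- k)\<^sup>2 = \<mu>" by (simp add: \<mu>_def)
  qed (use k0 in \<open>auto simp: k_def\<close>)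
  have near: "dist (k, k' \<tau>) P0 < e" if "\<tau> \<in> {\<delta>..2 * \<delta>}" for \<tau>
  proof -
    have "k - - complex_of_real k0 = \<i> * of_real \<delta>" "k' \<tau> - - complex_of_real k0 = - \<i> * of_real \<tau>"
      by (simp_all add: k_def k'_def complex_eq_iff)
    then have "dist k (- complex_of_real k0) = \<delta>" "dist (k' \<tau>) (- complex_of_real k0) = \<tau>"
      using that \<delta>(2) by (simp_all add: dist_norm norm_mult)
    then show ?thesis
      unfolding P0_def dist_Pair_Pair using that \<delta>(1,2)
        sqrt_sum_squares_le_sum[of \<delta> \<tau>] by simp
  qed
  have u: "dist (u \<tau>) 1 < 1 / 2" "D (k, k' \<tau>) \<noteq> 0" if "\<tau> \<in> {\<delta>..2 * \<delta>}" for \<tau>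
    using e(2)[OF near[OF that]] by (auto simp: u_def)
  have Reu: "Re (u \<tau>) > 0" "cmod (u \<tau>) > 1 / 2" "cmod (u \<tau>) < 3 / 2" if "\<tau> \<in> {\<delta>..2 * \<delta>}" for \<tau>
    using u(1)[OF that] abs_Re_le_cmod[of "u \<tau> - 1"] norm_triangle_ineq2[of "u \<tau>" 1] norm_triangle_ineq2[of 1 "u \<tau>"]
    by (auto simp: dist_norm norm_minus_commute abs_le_iff)
  define L where "L \<tau> = ln (c * cmod (u \<tau>) / (\<delta> + \<tau>)) / (2 * \<tau>)" for \<tau>
  define \<gamma> where "\<gamma> = Arg (\<i> * C)"
  \<comment> \<open>the matching condition holds iff \<open>h \<tau>\<close> is a multiple of $2\pi$; \<open>Ln\<close> is continuous on the values of \<open>u\<close>, which lie in a disc about 1\<close>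
  define h where "h \<tau> = 2 * k0 * L \<tau> + \<gamma> + Im (Ln (u \<tau>))" for \<tau>
  have cu: "continuous_on {\<delta>..2 * \<delta>} u"
  proof -
    have p: "continuous_on {\<delta>..2 * \<delta>} (\<lambda>\<tau>. (k, k' \<tau>))"
      unfolding k'_def Complex_eq by (intro continuous_intros)
    show ?thesis unfolding u_def
      by (intro continuous_on_divide continuous_on_const continuous_on_compose2[OF cN p] continuous_on_compose2[OF cD p])
         (use C0(1) u(2) in auto)
  qed
  have ch: "continuous_on {\<delta>..2 * \<delta>} h"
  proof -
    have np: "u \<tau> \<notin> \<real>\<^sub>\<le>\<^sub>0" "u \<tau> \<noteq> 0" "\<delta> + \<tau> \<noteq> 0" "2 * \<tau> \<noteq> 0" "c * cmod (u \<tau>) / (\<delta> + \<tau>) \<noteq> 0"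
      if "\<tau> \<in> {\<delta>..2 * \<delta>}" for \<tau>
      using Reu(1)[OF that] that \<delta>(2) C0(2) by (auto simp: complex_nonpos_Reals_iff)
    show ?thesis
      unfolding h_def L_def by (intro continuous_intros cu ballI np)
  qed
  have Lle: "L \<tau> \<le> ln (3 * c / (2 * (\<delta> + \<tau>))) / (2 * \<tau>)" and Lge: "L \<tau> \<ge> ln (c / (2 * (\<delta> + \<tau>))) / (2 * \<tau>)"
    if \<tau>: "\<tau> \<in> {\<delta>..2 * \<delta>}" for \<tau>
  proof -
    have t: "\<tau> > 0" using \<tau> \<delta>(2) by simp
    have le: "c * cmod (u \<tau>) / (\<delta> + \<tau>) \<le> 3 * c / (2 * (\<delta> + \<tau>))" and ge: "c / (2 * (\<delta> + \<tau>)) \<le> c * cmod (u \<tau>) / (\<delta> + \<tau>)"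
    proof -
      have "c * cmod (u \<tau>) \<le> c * (3 / 2)" "c * (1 / 2) \<le> c * cmod (u \<tau>)"
        using Reu(2,3)[OF \<tau>] C0(2) by (auto intro!: mult_left_mono)
      moreover have "\<delta> + \<tau> \<ge> 0" using t \<delta>(2) by simp
      ultimately have "c * cmod (u \<tau>) / (\<delta> + \<tau>) \<le> c * (3 / 2) / (\<delta> + \<tau>)" "c * (1 / 2) / (\<delta> + \<tau>) \<le> c * cmod (u \<tau>) / (\<delta> + \<tau>)"
        by (blast intro: divide_right_mono)+
      moreover have "x * (3 / 2) / s = 3 * x / (2 * s)" "x * (1 / 2) / s = x / (2 * s)" for x s :: real
        by simp_all
      ultimately show "c * cmod (u \<tau>) / (\<delta> + \<tau>) \<le> 3 * c / (2 * (\<delta> + \<tau>))" "c / (2 * (\<delta> + \<tau>)) \<le> c * cmod (u \<tau>) / (\<delta> + \<tau>)"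
        by metis+
    qed
    have p: "0 < c / (2 * (\<delta> + \<tau>))" using C0(2) t \<delta>(2) by simp
    show "L \<tau> \<le> ln (3 * c / (2 * (\<delta> + \<tau>))) / (2 * \<tau>)" "L \<tau> \<ge> ln (c / (2 * (\<delta> + \<tau>))) / (2 * \<tau>)"
      unfolding L_def using le ge p t by (auto intro!: divide_right_mono ln_mono)
  qed
  have "h \<delta> - h (2 * \<delta>) \<ge> 2 * pi"
  proof -
    have m: "\<delta> \<in> {\<delta>..2 * \<delta>}" "2 * \<delta> \<in> {\<delta>..2 * \<delta>}" using \<delta>(2) by auto
    have "L \<delta> \<ge> ln (c / (4 * \<delta>)) / (2 * \<delta>)" using Lge[OF m(1)] by simp
    moreover have "L (2 * \<delta>) \<le> ln (c / (2 * \<delta>)) / (4 * \<delta>)" using Lle[OF m(2)] by simp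
    ultimately have "2 * k0 * (ln (c / (4 * \<delta>)) / (2 * \<delta>) - ln (c / (2 * \<delta>)) / (4 * \<delta>)) \<le> 2 * k0 * (L \<delta> - L (2 * \<delta>))"
      using k0(1) by (intro mult_left_mono) auto
    moreover have "\<bar>Im (Ln (u \<tau>))\<bar> < pi / 2" if "\<tau> \<in> {\<delta>..2 * \<delta>}" for \<tau>
      using Reu(1)[OF that] by (metis Re_Ln_pos_lt less_irrefl zero_complex.simps(1))
    note this[OF m(1)] this[OF m(2)]
    ultimately show ?thesis using \<delta>(6) by (simp add: h_def abs_less_iff algebra_simps)
  qed
  then obtain n :: int where n: "h (2 * \<delta>) \<le> 2 * pi * n" "2 * pi * n \<le> h \<delta>"
  proof -
    assume ge: "h \<delta> - h (2 * \<delta>) \<ge> 2 * pi"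
    define n where "n = \<lceil>h (2 * \<delta>) / (2 * pi)\<rceil>"
    have "h (2 * \<delta>) / (2 * pi) \<le> n" "n < h (2 * \<delta>) / (2 * pi) + 1" unfolding n_def by linarith+
    then have "h (2 * \<delta>) \<le> 2 * pi * n" "2 * pi * n < h (2 * \<delta>) + 2 * pi"
      by (simp_all add: field_simps)
    then show ?thesis using that ge by simp
  qed
  obtain \<tau> where \<tau>: "\<tau> \<in> {\<delta>..2 * \<delta>}" "h \<tau> = 2 * pi * n"
    using IVT2'[OF n _ ch] \<delta>(2) by auto
  have t: "\<tau> > 0" "\<tau> \<le> 2 * \<delta>" using \<tau>(1) \<delta>(2) by auto
  define K where "K = k' \<tau>"
  have K0: "K \<noteq> 0" using t by (simp add: K_def k'_def complex_eq_iff)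
  have Kk: "K - k = - \<i> * of_real (\<delta> + \<tau>)" by (simp add: K_def k'_def k_def complex_eq_iff)
  have Kk': "k + K = Complex (- 2 * k0) (\<delta> - \<tau>)" by (simp add: K_def k'_def k_def complex_eq_iff)
  define q where "q = \<mu> - K\<^sup>2"
  have "exp (2 * \<i> * K * L \<tau>) = \<i> * C * u \<tau> / of_real (\<delta> + \<tau>)"
  proof -
    have u0: "u \<tau> \<noteq> 0" using Reu(1)[OF \<tau>(1)] by auto
    have s: "2 * \<i> * K * L \<tau> = of_real (ln (c * cmod (u \<tau>) / (\<delta> + \<tau>))) - \<i> * of_real (2 * k0 * L \<tau>)"
      using t by (simp add: K_def k'_def L_def complex_eq_iff)
    have "2 * k0 * L \<tau> = 2 * pi * n - \<gamma> - Im (Ln (u \<tau>))" using \<tau>(2) by (simp add: h_def)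
    then have "- (\<i> * of_real (2 * k0 * L \<tau>)) = \<i> * of_real \<gamma> + \<i> * of_real (Im (Ln (u \<tau>))) + (2 * of_int (- n) * complex_of_real pi) * \<i>"
      by (simp add: complex_eq_iff)
    moreover have "exp ((2 * of_int (- n) * complex_of_real pi) * \<i>) = 1"
      using exp_integer_2pi[of "of_int (- n)"] by simp
    ultimately have ph: "exp (- (\<i> * of_real (2 * k0 * L \<tau>))) = exp (\<i> * of_real \<gamma>) * exp (\<i> * of_real (Im (Ln (u \<tau>))))"
      by (simp only: exp_add mult_1_right)
    have g: "of_real c * exp (\<i> * of_real \<gamma>) = \<i> * C"
      using Arg_eq[of "\<i> * C"] C0(1) by (simp add: \<gamma>_def c_def norm_mult)
    have uu: "of_real (cmod (u \<tau>)) * exp (\<i> * of_real (Im (Ln (u \<tau>)))) = u \<tau>"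
      using Arg_eq[of "u \<tau>"] u0 by (simp add: Arg_eq_Im_Ln)
    have "exp (2 * \<i> * K * L \<tau>) = exp (of_real (ln (c * cmod (u \<tau>) / (\<delta> + \<tau>)))) * exp (- (\<i> * of_real (2 * k0 * L \<tau>)))"
      unfolding s by (simp flip: exp_add)
    also have "exp (of_real (ln (c * cmod (u \<tau>) / (\<delta> + \<tau>)))) = complex_of_real (c * cmod (u \<tau>) / (\<delta> + \<tau>))"
      using C0(2) u0 t \<delta>(2) by (simp add: exp_of_real)
    also have "\<dots> * exp (- (\<i> * of_real (2 * k0 * L \<tau>))) = (of_real c * exp (\<i> * of_real \<gamma>)) * (of_real (cmod (u \<tau>)) * exp (\<i> * of_real (Im (Ln (u \<tau>))))) / of_real (\<delta> + \<tau>)"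
      unfolding ph by simp
    finally show ?thesis unfolding g uu .
  qed
  then have ex: "exp (2 * \<i> * K * L \<tau>) * (K - k) = C * u \<tau>"
    unfolding Kk using t \<delta>(2) by (simp add: field_simps add_eq_0_iff flip: of_real_add)
  have Du: "C * u \<tau> * (\<i> * K * b \<mu> + a \<mu>) = (K + k) * (\<i> * K * b \<mu> - a \<mu>)"
  proof -
    have "C * u \<tau> = N (k, K) / D (k, K)" using C0(1) by (simp add: u_def K_def)
    moreover have "D (k, K) \<noteq> 0" using u(2)[OF \<tau>(1)] by (simp add: K_def)
    ultimately have "C * u \<tau> * D (k, K) = N (k, K)" by simp
    then show ?thesis by (simp add: N_def D_def \<mu>_def)
  qed
  have qle: "cmod q \<le> 3 * \<delta> * (2 * k0 + \<delta>)"
  proof -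
    have "q = (k - K) * (k + K)" by (simp add: q_def \<mu>_def power2_eq_square algebra_simps)
    then have "cmod q = cmod (K - k) * cmod (k + K)" by (simp add: norm_mult norm_minus_commute)
    also have "\<dots> \<le> (3 * \<delta>) * (2 * k0 + \<delta>)"
    proof (rule mult_mono)
      show "cmod (K - k) \<le> 3 * \<delta>" unfolding Kk using t \<delta>(2) by (simp add: norm_mult flip: of_real_add)
      show "cmod (k + K) \<le> 2 * k0 + \<delta>"
        unfolding Kk' using cmod_le[of "Complex (- 2 * k0) (\<delta> - \<tau>)"] t \<tau>(1) k0(1) by simp
    qed (use \<delta>(2) in auto)
    finally show ?thesis .
  qed
  show ?thesis
  proof (rule that[of "L \<tau>" q \<mu>])
    show L1: "1 \<le> L \<tau>"
    proof -
      have p: "0 < c / (6 * \<delta>)" using C0(2) \<delta>(2) by simp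
      have l0: "0 \<le> ln (c / (6 * \<delta>))" using \<delta>(2,5) by (simp add: field_simps)
      have "c / (6 * \<delta>) \<le> c / (2 * (\<delta> + \<tau>))" using t C0(2) \<delta>(2) by (intro divide_left_mono) auto
      then have "ln (c / (6 * \<delta>)) \<le> ln (c / (2 * (\<delta> + \<tau>)))" using p by (simp add: ln_mono)
      then have "ln (c / (6 * \<delta>)) / (4 * \<delta>) \<le> ln (c / (2 * (\<delta> + \<tau>))) / (2 * \<tau>)"
        using l0 t by (intro frac_le) auto
      then show ?thesis using \<delta>(5) Lge[OF \<tau>(1)] by linarith
    qed
    show "cmod q \<le> \<eta>" using qle \<delta>(3) by linarith
    have "L \<tau> \<le> ln (3 * c / (4 * \<delta>)) / (2 * \<delta>)"
    proof -
      have ps: "0 < 3 * c / (2 * (\<delta> + \<tau>))" using C0(2) \<delta>(2) t by simp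
      have le: "3 * c / (2 * (\<delta> + \<tau>)) \<le> 3 * c / (4 * \<delta>)"
        using \<tau>(1) C0(2) \<delta>(2) by (intro divide_left_mono) auto
      have 1: "L \<tau> \<le> ln (3 * c / (2 * (\<delta> + \<tau>))) / (2 * \<tau>)" by (rule Lle[OF \<tau>(1)])
      then have "0 \<le> ln (3 * c / (2 * (\<delta> + \<tau>)))" using L1 t by (smt (verit) divide_neg_pos)
      then have "ln (3 * c / (2 * (\<delta> + \<tau>))) / (2 * \<tau>) \<le> ln (3 * c / (4 * \<delta>)) / (2 * \<delta>)"
        using le ps \<tau>(1) \<delta>(2) by (intro frac_le) (auto simp: ln_mono intro: order_trans[OF _ ln_mono])
      then show ?thesis using 1 by linarith
    qed
    then have "(R + L \<tau>) ^ d \<le> (R + ln (3 * c / (4 * \<delta>)) / (2 * \<delta>)) ^ d"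
      using R L1 by (intro power_mono) auto
    moreover have "cmod q powr p \<le> (3 * \<delta> * (2 * k0 + \<delta>)) powr p"
      using qle d by (intro powr_mono2) auto
    ultimately have "cmod q powr p * (R + L \<tau>) ^ d \<le> (3 * \<delta> * (2 * k0 + \<delta>)) powr p * (R + ln (3 * c / (4 * \<delta>)) / (2 * \<delta>)) ^ d"
      using R L1 by (intro mult_mono) auto
    then show "cmod q powr p * (R + L \<tau>) ^ d \<le> \<eta>" using \<delta>(7) by linarith
    have \<mu>E: "\<mu> - of_real E = - of_real (\<delta>\<^sup>2) - \<i> * of_real (2 * k0 * \<delta>)"
    proof -
      have "k = - of_real k0 + \<i> * of_real \<delta>" by (simp add: k_def complex_eq_iff)
      then have "\<mu> = (- of_real k0 + \<i> * of_real \<delta>)\<^sup>2" by (simp only: \<mu>_def)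
      then show ?thesis unfolding k0(2)[symmetric] by (simp add: power2_eq_square algebra_simps)
    qed
    then have "Im (\<mu> - of_real E) = - 2 * k0 * \<delta>" by simp
    then show "Im \<mu> < 0" using k0(1) \<delta>(2) by simp
    have "cmod (\<mu> - of_real E) \<le> \<delta>\<^sup>2 + 2 * k0 * \<delta>"
      unfolding \<mu>E using norm_triangle_ineq4[of "- complex_of_real (\<delta>\<^sup>2)" "\<i> * of_real (2 * k0 * \<delta>)"] k0(1) \<delta>(2)
      by (simp add: norm_mult norm_power)
    then show "cmod (\<mu> - of_real E) < \<eta>" using \<delta>(4) by linarith
    have "slab_der (K\<^sup>2) (b \<mu>) (a \<mu>) (L \<tau>) = \<i> * k * slab_val (K\<^sup>2) (b \<mu>) (a \<mu>) (L \<tau>)"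
    proof (rule slab_matching_condition[OF K0])
      show "exp (2 * \<i> * K * complex_of_real (L \<tau>)) * ((K - k) * (\<i> * K * b \<mu> + a \<mu>)) = (K + k) * (\<i> * K * b \<mu> - a \<mu>)"
        using ex Du by (metis mult.assoc)
    qed
    then show "slab_der (\<mu> - q) (b \<mu>) (a \<mu>) (L \<tau>) = - \<i> * csqrt \<mu> * slab_val (\<mu> - q) (b \<mu>) (a \<mu>) (L \<tau>)"
      by (simp add: q_def kr)
  qed
qed

section \<open>Eigenvalues persist when weak layers are added outside\<close>

text \<open>The starting index is a parameter because an eigenvalue created by layer \<open>n\<close> is followed from radius
  \<open>R (Suc n)\<close> on, whereas eigenfunctions start at \<open>R 0\<close>.\<close>

primrec layers :: "(nat \<Rightarrow> complex) \<Rightarrow> (nat \<Rightarrow> real) \<Rightarrow> complex \<Rightarrow> nat \<Rightarrow> complex \<times> complex \<Rightarrow> nat \<Rightarrow> complex \<times> complex" where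
  "layers q R z i y 0 = y"
| "layers q R z i y (Suc m) =
    (slab_val (z - q (i + m)) (fst (layers q R z i y m)) (snd (layers q R z i y m)) (R (Suc (i + m)) - R (i + m)),
     slab_der (z - q (i + m)) (fst (layers q R z i y m)) (snd (layers q R z i y m)) (R (Suc (i + m)) - R (i + m)))"

lemma layers_linear:
  "fst (layers q R z i (b, a) m) = b * fst (layers q R z i (1, 0) m) + a * fst (layers q R z i (0, 1) m) \<and>
   snd (layers q R z i (b, a) m) = b * snd (layers q R z i (1, 0) m) + a * snd (layers q R z i (0, 1) m)"
proof (induction m)
  case (Suc m)
  then show ?case
    by (simp add: slab_val_def slab_der_def) (simp add: algebra_simps)
qed simp

text \<open>The transfer through a layer has determinant 1.\<close>

lemma slab_map_eq_0:
  assumes "slab_val \<zeta> b a L = 0" "slab_der \<zeta> b a L = 0"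
  shows "b = 0 \<and> a = 0"
proof -
  have "b * ((slab_cos \<zeta> L)\<^sup>2 + \<zeta> * (slab_sin \<zeta> L)\<^sup>2)
      = slab_cos \<zeta> L * slab_val \<zeta> b a L - slab_sin \<zeta> L * slab_der \<zeta> b a L"
    by (simp add: slab_val_def slab_der_def power2_eq_square algebra_simps)
  moreover have "a * ((slab_cos \<zeta> L)\<^sup>2 + \<zeta> * (slab_sin \<zeta> L)\<^sup>2)
      = \<zeta> * slab_sin \<zeta> L * slab_val \<zeta> b a L + slab_cos \<zeta> L * slab_der \<zeta> b a L"
    by (simp add: slab_val_def slab_der_def power2_eq_square algebra_simps)
  ultimately show ?thesis using assms by (simp add: slab_cos_sin_squared)
qed

lemma slab_val_holomorphic:
  assumes "b holomorphic_on UNIV" "a holomorphic_on UNIV"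
  shows "(\<lambda>z. slab_val (z - q) (b z) (a z) L) holomorphic_on UNIV"
    "(\<lambda>z. slab_der (z - q) (b z) (a z) L) holomorphic_on UNIV"
proof -
  have c: "(\<lambda>z. slab_cos (z - q) L) holomorphic_on UNIV"
    using holomorphic_on_compose_gen[OF _ slab_cos_holomorphic[of L], of "\<lambda>z. z - q" UNIV]
    by (simp add: o_def holomorphic_intros)
  have s: "(\<lambda>z. slab_sin (z - q) L) holomorphic_on UNIV"
    using holomorphic_on_compose_gen[OF _ slab_sin_holomorphic[of L], of "\<lambda>z. z - q" UNIV]
    by (simp add: o_def holomorphic_intros)
  show "(\<lambda>z. slab_val (z - q) (b z) (a z) L) holomorphic_on UNIV"
    "(\<lambda>z. slab_der (z - q) (b z) (a z) L) holomorphic_on UNIV"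
    unfolding slab_val_def slab_der_def by (intro holomorphic_intros c s assms)+
qed

lemma layers_holomorphic:
  assumes "b holomorphic_on UNIV" "a holomorphic_on UNIV"
  shows "(\<lambda>z. fst (layers q R z i (b z, a z) m)) holomorphic_on UNIV \<and>
         (\<lambda>z. snd (layers q R z i (b z, a z) m)) holomorphic_on UNIV"
  by (induction m) (use assms slab_val_holomorphic in auto)

text \<open>The quadratic form of \<open>cone_functional_mono\<close> on the data $(w, w')$.\<close>

definition cone_form :: "real \<Rightarrow> complex \<Rightarrow> complex \<times> complex \<Rightarrow> real" where
  "cone_form \<rho> k y = (cmod (snd y - \<i> * k * fst y))\<^sup>2 - \<rho>\<^sup>2 * (cmod (fst y))\<^sup>2"

lemma cone_form_nonpos_iff: "\<rho> \<ge> 0 \<Longrightarrow> cone_form \<rho> k y \<le> 0 \<longleftrightarrow> cmod (snd y - \<i> * k * fst y) \<le> \<rho> * cmod (fst y)"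
  unfolding cone_form_def
  by (simp add: power_mult_distrib[symmetric] abs_le_square_iff[symmetric] abs_mult)

lemma cone_slab_mono:
  assumes "\<kappa> \<le> Im k" "0 < \<rho>" "cmod q + \<rho>\<^sup>2 \<le> 2 * \<kappa> * \<rho>" "x \<le> y"
  shows "cone_form \<rho> k (slab_val (k\<^sup>2 - q) b a x, slab_der (k\<^sup>2 - q) b a x)
       \<le> cone_form \<rho> k (slab_val (k\<^sup>2 - q) b a y, slab_der (k\<^sup>2 - q) b a y)"
  unfolding cone_form_def using cone_functional_mono[OF slab_val_deriv slab_der_deriv assms] by simp

lemma layers_cone_mono:
  assumes k: "\<kappa> \<le> Im k" "0 < \<rho>" and q: "\<And>j. j \<ge> i \<Longrightarrow> cmod (q j) + \<rho>\<^sup>2 \<le> 2 * \<kappa> * \<rho>"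
    and R: "\<And>j. R j \<le> R (Suc j)" and "m \<le> n"
  shows "cone_form \<rho> k (layers q R (k\<^sup>2) i y m) \<le> cone_form \<rho> k (layers q R (k\<^sup>2) i y n)"
  using \<open>m \<le> n\<close>
proof (induction n rule: dec_induct)
  case (step n)
  have "cone_form \<rho> k (layers q R (k\<^sup>2) i y n) \<le> cone_form \<rho> k (layers q R (k\<^sup>2) i y (Suc n))"
    using cone_slab_mono[OF k q, of "i + n" 0 "R (Suc (i + n)) - R (i + n)"
        "fst (layers q R (k\<^sup>2) i y n)" "snd (layers q R (k\<^sup>2) i y n)"] R[of "i + n"] by simp
  then show ?case using step.IH by simp
qed simp

text \<open>Let \<open>X y\<close> be the defect $w' - ikw$ after \<open>m\<close> layers of the solution with data \<open>y\<close>. The data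
  \<open>(\<psi>, \<psi>')\<close> have defect 0, so by monotonicity $|\psi' - ik\psi| \le \rho|\psi|$, and the defect of
  \<open>(b, a)\<close> divided by \<open>\<psi>\<close> is within \<open>\<rho> * cmod b\<close> of the unperturbed matching function.
  Without a zero in the disc, the reciprocal of this quotient would be holomorphic there and larger at the
  centre than anywhere on the boundary.\<close>

lemma perturbed_resonance_exists:
  fixes a b :: "complex \<Rightarrow> complex"
  assumes a: "a holomorphic_on UNIV" and b: "b holomorphic_on UNIV"
    and prot: "protected_zero b a \<mu> rad \<kappa> \<rho>"
    and q: "\<And>j. j \<ge> i \<Longrightarrow> cmod (q j) + \<rho>\<^sup>2 \<le> 2 * \<kappa> * \<rho>"
    and R: "\<And>j. R j \<le> R (Suc j)"
  shows "\<exists>z\<in>cball \<mu> rad. snd (layers q R z i (b z, a z) m) + \<i> * csqrt z * fst (layers q R z i (b z, a z) m) = 0"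
proof (rule ccontr)
  assume contr: "\<not> ?thesis"
  note p = prot[unfolded protected_zero_def]
  have \<mu>: "a \<mu> + \<i> * csqrt \<mu> * b \<mu> = 0" and rad: "rad > 0" and \<rho>: "\<rho> > 0" using p by blast+
  have low: "Im z < 0" and Imk: "\<kappa> \<le> Im (- csqrt z)" if "z \<in> cball \<mu> rad" for z using p that by blast+
  have gap: "\<rho> * cmod (b \<mu>) + \<rho> * cmod (b z) < cmod (a z + \<i> * csqrt z * b z)" if "z \<in> sphere \<mu> rad" for z
    using p that by blast
  define X where "X y z = snd (layers q R z i y m) + \<i> * csqrt z * fst (layers q R z i y m)" for y z
  \<comment> \<open>up to a common factor, \<open>\<psi>\<close> and \<open>\<psi>'\<close> are the data at \<open>R i\<close> of the solution that is purely decaying beyond the last layer\<close>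
  define \<psi> where "\<psi> z = X (0, 1) z" for z
  define \<psi>' where "\<psi>' z = - X (1, 0) z" for z
  define G where "G z = X (b z, a z) z" for z
  have Xlin: "X (\<beta>, \<alpha>) z = \<alpha> * \<psi> z - \<beta> * \<psi>' z" for \<alpha> \<beta> z
    unfolding X_def \<psi>_def \<psi>'_def layers_linear[THEN conjunct1, of q R z i \<beta> \<alpha> m]
      layers_linear[THEN conjunct2, of q R z i \<beta> \<alpha> m] by (simp add: algebra_simps)
  have G0: "G z \<noteq> 0" if "z \<in> cball \<mu> rad" for z using contr that unfolding G_def X_def by blast
  have close: "cmod (\<psi>' z + \<i> * csqrt z * \<psi> z) \<le> \<rho> * cmod (\<psi> z)" if z: "z \<in> cball \<mu> rad" for z
  proof -
    have "X (\<psi> z, \<psi>' z) z = 0" by (simp add: Xlin)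
    then have "cone_form \<rho> (- csqrt z) (layers q R ((- csqrt z)\<^sup>2) i (\<psi> z, \<psi>' z) m) \<le> 0"
      by (simp add: cone_form_def X_def)
    then have "cone_form \<rho> (- csqrt z) (\<psi> z, \<psi>' z) \<le> 0"
      using layers_cone_mono[where q=q and R=R and i=i, OF Imk[OF z] \<rho> q R, of 0 m "(\<psi> z, \<psi>' z)"] by simp
    then show ?thesis using \<rho> by (simp add: cone_form_nonpos_iff)
  qed
  have \<psi>0: "\<psi> z \<noteq> 0" if z: "z \<in> cball \<mu> rad" for z
  proof
    assume "\<psi> z = 0"
    then have "\<psi>' z = 0" using close[OF z] by simp
    then have "G z = 0" using \<open>\<psi> z = 0\<close> by (simp add: G_def Xlin)
    then show False using G0[OF z] by simp
  qed
  have nr: "z \<notin> \<real>\<^sub>\<le>\<^sub>0" if "z \<in> cball \<mu> rad" for z using low[OF that] by (auto simp: complex_nonpos_Reals_iff)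
  have X_hol: "(\<lambda>z. X (\<beta> z, \<alpha> z) z) holomorphic_on cball \<mu> rad"
    if "\<beta> holomorphic_on UNIV" "\<alpha> holomorphic_on UNIV" for \<alpha> \<beta>
    unfolding X_def using layers_holomorphic[OF that, of q R i m] nr
    by (intro holomorphic_intros) (auto intro: holomorphic_on_subset)
  have \<psi>_hol: "\<psi> holomorphic_on cball \<mu> rad"
    unfolding \<psi>_def[abs_def] by (rule X_hol) (auto intro: holomorphic_intros)
  have G_hol: "G holomorphic_on cball \<mu> rad"
    unfolding G_def[abs_def] by (rule X_hol[OF b a])
  have quot: "(\<lambda>z. \<psi> z / G z) holomorphic_on cball \<mu> rad"
    by (intro holomorphic_intros \<psi>_hol G_hol G0)
  have repr: "cmod (G z / \<psi> z - (a z + \<i> * csqrt z * b z)) \<le> \<rho> * cmod (b z)" if z: "z \<in> cball \<mu> rad" for z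
  proof -
    have "G z / \<psi> z - (a z + \<i> * csqrt z * b z) = - b z * ((\<psi>' z + \<i> * csqrt z * \<psi> z) / \<psi> z)"
      using \<psi>0[OF z] by (simp add: G_def Xlin field_simps)
    then have "cmod (G z / \<psi> z - (a z + \<i> * csqrt z * b z)) = cmod (b z) * (cmod (\<psi>' z + \<i> * csqrt z * \<psi> z) / cmod (\<psi> z))"
      by (simp add: norm_mult norm_divide)
    also have "\<dots> \<le> cmod (b z) * \<rho>"
      using close[OF z] \<psi>0[OF z] by (intro mult_left_mono) (auto simp: divide_le_eq)
    finally show ?thesis by (simp add: mult.commute)
  qed
  have \<mu>in: "\<mu> \<in> cball \<mu> rad" using rad by simp
  have at_centre: "cmod (G \<mu> / \<psi> \<mu>) \<le> \<rho> * cmod (b \<mu>)" using repr[OF \<mu>in] \<mu> by simp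
  have on_sphere: "cmod (G z / \<psi> z) > \<rho> * cmod (b \<mu>)" if "z \<in> sphere \<mu> rad" for z
  proof -
    have "z \<in> cball \<mu> rad" using that by simp
    from repr[OF this] gap[OF that] show ?thesis
      using norm_triangle_ineq2[of "a z + \<i> * csqrt z * b z" "a z + \<i> * csqrt z * b z - G z / \<psi> z"]
      by (simp add: norm_minus_commute)
  qed
  have cont: "continuous_on (cball \<mu> rad) (\<lambda>z. \<psi> z / G z)"
    by (rule holomorphic_on_imp_continuous_on[OF quot])
  have "continuous_on (sphere \<mu> rad) (\<lambda>z. cmod (\<psi> z / G z))"
    by (intro continuous_on_norm continuous_on_subset[OF cont]) auto
  moreover have "sphere \<mu> rad \<noteq> {}" using rad by simp
  ultimately obtain z1 where z1: "z1 \<in> sphere \<mu> rad"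
      "\<And>z. z \<in> sphere \<mu> rad \<Longrightarrow> cmod (\<psi> z / G z) \<le> cmod (\<psi> z1 / G z1)"
    using continuous_attains_sup[OF compact_sphere] by blast
  have "cmod (\<psi> \<mu> / G \<mu>) \<le> cmod (\<psi> z1 / G z1)"
  proof (rule maximum_modulus_frontier[where S="cball \<mu> rad" and f="\<lambda>z. \<psi> z / G z"])
    show "(\<lambda>z. \<psi> z / G z) holomorphic_on interior (cball \<mu> rad)"
      by (rule holomorphic_on_subset[OF quot interior_subset])
    show "continuous_on (closure (cball \<mu> rad)) (\<lambda>z. \<psi> z / G z)" using cont by simp
    show "norm (\<psi> z / G z) \<le> cmod (\<psi> z1 / G z1)" if "z \<in> frontier (cball \<mu> rad)" for z
      using that z1(2) by (simp only: frontier_cball)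
  qed (use \<mu>in in auto)
  then have "inverse (cmod (G \<mu> / \<psi> \<mu>)) \<le> inverse (cmod (G z1 / \<psi> z1))"
    by (simp add: norm_divide)
  moreover have "z1 \<in> cball \<mu> rad" using z1(1) by simp
  then have "cmod (G z1 / \<psi> z1) > 0" "cmod (G \<mu> / \<psi> \<mu>) > 0"
    using G0 \<psi>0 \<mu>in by simp_all
  ultimately have "cmod (G z1 / \<psi> z1) \<le> cmod (G \<mu> / \<psi> \<mu>)" by (simp add: inverse_le_iff_le)
  then show False using on_sphere[OF z1(1)] at_centre by simp
qed

text \<open>Zeros for \<open>m\<close> layers put the solution in the cone at all earlier radii. The disc is compact, so
  a subsequence of the zeros converges, and at the limit the solution is in the cone at every radius.\<close>

lemma persistent_resonance:
  fixes a b :: "complex \<Rightarrow> complex"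
  assumes a: "a holomorphic_on UNIV" and b: "b holomorphic_on UNIV"
    and prot: "protected_zero b a \<mu> rad \<kappa> \<rho>"
    and q: "\<And>j. j \<ge> i \<Longrightarrow> cmod (q j) + \<rho>\<^sup>2 \<le> 2 * \<kappa> * \<rho>"
    and R: "\<And>j. R j \<le> R (Suc j)"
  obtains z where "z \<in> cball \<mu> rad" "\<And>m. cone_form \<rho> (- csqrt z) (layers q R z i (b z, a z) m) \<le> 0"
proof -
  note p = prot[unfolded protected_zero_def]
  have \<rho>: "\<rho> > 0" using p by blast
  have low: "Im z < 0" and Imk: "\<kappa> \<le> Im (- csqrt z)" if "z \<in> cball \<mu> rad" for z using p that by blast+
  have "\<forall>m. \<exists>z\<in>cball \<mu> rad. snd (layers q R z i (b z, a z) m) + \<i> * csqrt z * fst (layers q R z i (b z, a z) m) = 0"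
    using perturbed_resonance_exists[where q=q and R=R and i=i, OF assms] by blast
  then obtain Z where Z: "\<And>m. Z m \<in> cball \<mu> rad"
     "\<And>m. snd (layers q R (Z m) i (b (Z m), a (Z m)) m) + \<i> * csqrt (Z m) * fst (layers q R (Z m) i (b (Z m), a (Z m)) m) = 0"
    by metis
  have ev: "cone_form \<rho> (- csqrt (Z n)) (layers q R (Z n) i (b (Z n), a (Z n)) m) \<le> 0" if "m \<le> n" for m n
  proof -
    have "cone_form \<rho> (- csqrt (Z n)) (layers q R (Z n) i (b (Z n), a (Z n)) n) \<le> 0"
      using Z(2)[of n] by (simp add: cone_form_def)
    then show ?thesis
      using layers_cone_mono[where q=q and R=R and i=i, OF Imk[OF Z(1)[of n]] \<rho> q R that, of "(b (Z n), a (Z n))"] by simp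
  qed
  obtain z r where z: "z \<in> cball \<mu> rad" "strict_mono r" "(Z \<circ> r) \<longlonglongrightarrow> z"
    using compact_cball[of \<mu> rad] Z(1) unfolding compact_def by metis
  have "cone_form \<rho> (- csqrt z) (layers q R z i (b z, a z) m) \<le> 0" for m
  proof (rule tendsto_upperbound)
    let ?f = "\<lambda>z. cone_form \<rho> (- csqrt z) (layers q R z i (b z, a z) m)"
    have c: "isCont (\<lambda>z. fst (layers q R z i (b z, a z) m)) z" "isCont (\<lambda>z. snd (layers q R z i (b z, a z) m)) z"
      using layers_holomorphic[OF b a, of q R i m] holomorphic_on_imp_continuous_on[of _ UNIV]
      by (metis UNIV_I continuous_on_eq_continuous_at open_UNIV)+
    have "z \<notin> \<real>\<^sub>\<le>\<^sub>0" using low[OF z(1)] by (auto simp: complex_nonpos_Reals_iff)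
    then have "isCont csqrt z" by (rule continuous_at_csqrt)
    then have "isCont ?f z" unfolding cone_form_def by (intro continuous_intros c)
    then show "((\<lambda>n. ?f ((Z \<circ> r) n)) \<longlongrightarrow> ?f z) sequentially"
      using z(3) by (rule isCont_tendsto_compose)
    show "\<forall>\<^sub>F n in sequentially. ?f ((Z \<circ> r) n) \<le> 0"
      using eventually_ge_at_top[of m]
    proof eventually_elim
      case (elim n)
      then have "m \<le> r n" using seq_suble[OF z(2), of n] by simp
      then show ?case using ev by simp
    qed
  qed simp
  then show ?thesis using that z(1) by blast
qed

section \<open>Gluing the layers\<close>

text \<open>A break point \<open>S i\<close> belongs to the piece on its left.\<close>

definition piece_index :: "(nat \<Rightarrow> real) \<Rightarrow> real \<Rightarrow> nat" where
  "piece_index S s = (LEAST i. s \<le> S i)"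

lemma piece_index_eqI: "s \<le> S i \<Longrightarrow> (\<And>j. j < i \<Longrightarrow> S j < s) \<Longrightarrow> piece_index S s = i"
  unfolding piece_index_def by (rule Least_equality) (auto simp: not_less[symmetric])

lemma piece_index_bounds:
  assumes "s \<le> S k"
  shows "s \<le> S (piece_index S s)" "j < piece_index S s \<Longrightarrow> S j < s"
  using LeastI[of "\<lambda>i. s \<le> S i", OF assms] not_less_Least[of j "\<lambda>i. s \<le> S i"]
  by (auto simp: piece_index_def)

lemma piece_index_near_inner:
  assumes S: "strict_mono S" and unb: "s \<le> S k" and s: "s \<notin> range S"
  obtains U where "open U" "s \<in> U" "\<And>t. t \<in> U \<Longrightarrow> piece_index S t = piece_index S s"
proof -
  define i where "i = piece_index S s"
  have i: "s \<le> S i" "\<And>j. j < i \<Longrightarrow> S j < s" using piece_index_bounds[where S=S, OF unb] by (auto simp: i_def)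
  define U where "U = (if i = 0 then {..<S i} else {S (i - 1)<..<S i})"
  have "s < S i" using i(1) s by (metis order_le_less rangeI)
  show ?thesis
  proof
    show "open U" by (simp add: U_def)
    show "s \<in> U" using \<open>s < S i\<close> i(2)[of "i - 1"] by (cases "i = 0") (auto simp: U_def)
    show "piece_index S t = piece_index S s" if "t \<in> U" for t
      unfolding i_def[symmetric]
    proof (rule piece_index_eqI)
      show "t \<le> S i" using that by (simp add: U_def split: if_splits)
      show "S j < t" if "j < i" for j
      proof -
        have "j \<le> i - 1" "i \<noteq> 0" using that by auto
        then show ?thesis using \<open>t \<in> U\<close> strict_mono_leD[OF S, of j "i - 1"] by (simp add: U_def)
      qed
    qed
  qed
qed

lemma piece_index_near_break:
  assumes S: "strict_mono S"
  obtains U where "open U" "S i \<in> U"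
    "\<And>t. t \<in> U \<Longrightarrow> piece_index S t = (if t \<le> S i then i else Suc i)"
proof -
  define U where "U = (if i = 0 then {..<S (Suc i)} else {S (i - 1)<..<S (Suc i)})"
  show ?thesis
  proof
    show "open U" by (simp add: U_def)
    show "S i \<in> U" using S by (simp add: U_def strict_mono_less)
    show "piece_index S t = (if t \<le> S i then i else Suc i)" if "t \<in> U" for t
    proof (rule piece_index_eqI)
      show "t \<le> S (if t \<le> S i then i else Suc i)" using that by (auto simp: U_def split: if_splits)
      show "S j < t" if "j < (if t \<le> S i then i else Suc i)" for j
      proof (cases "t \<le> S i")
        case True
        then have "j \<le> i - 1" "i \<noteq> 0" using that by auto
        then show ?thesis using \<open>t \<in> U\<close> strict_mono_leD[OF S, of j "i - 1"] by (simp add: U_def)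
      next
        case False
        then have "j \<le> i" using that by simp
        then show ?thesis using False strict_mono_leD[OF S, of j i] by simp
      qed
    qed
  qed
qed

lemma has_vector_derivative_if_le:
  fixes f g :: "real \<Rightarrow> complex"
  assumes "(f has_vector_derivative D) (at a)" "(g has_vector_derivative D) (at a)" "f a = g a"
  shows "((\<lambda>t. if t \<le> a then f t else g t) has_vector_derivative D) (at a)"
proof -
  have "((\<lambda>t. if t \<in> {..a} then f t else g t) has_vector_derivative (if a \<in> {..a} then D else D)) (at a within UNIV)"
    by (rule has_vector_derivative_If_within_closures[where T="{a..}"])
       (use assms in \<open>auto intro: has_vector_derivative_at_within\<close>)
  then show ?thesis by simp
qed

text \<open>This gives the second derivatives of the glued functions, which jump at the break points.\<close>

lemma glued_derivative_off_breaks: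
  fixes P P' :: "nat \<Rightarrow> real \<Rightarrow> complex"
  assumes S: "strict_mono S" "0 < S 0" and unb: "\<And>s. \<exists>k. s \<le> S k"
    and d: "\<And>i s. i = 0 \<or> s > 0 \<Longrightarrow> (P i has_vector_derivative P' i s) (at s)"
    and s: "s \<notin> range S"
  shows "((\<lambda>s. P (piece_index S s) s) has_vector_derivative P' (piece_index S s) s) (at s)"
proof -
  obtain k where k: "s \<le> S k" using unb by blast
  obtain U where U: "open U" "s \<in> U" "\<And>t. t \<in> U \<Longrightarrow> piece_index S t = piece_index S s"
    using piece_index_near_inner[OF S(1) k s] by blast
  have "piece_index S s = 0 \<or> s > 0"
    using piece_index_bounds(2)[where S=S, OF k, of 0] S(2) by fastforce
  from has_vector_derivative_transform_within_open[OF d[OF this] U(1,2)] U(3)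
  show ?thesis by simp
qed

lemma glued_derivative:
  fixes P P' :: "nat \<Rightarrow> real \<Rightarrow> complex"
  assumes S: "strict_mono S" "0 < S 0" and unb: "\<And>s. \<exists>k. s \<le> S k"
    and d: "\<And>i s. i = 0 \<or> s > 0 \<Longrightarrow> (P i has_vector_derivative P' i s) (at s)"
    and match: "\<And>i. P i (S i) = P (Suc i) (S i)" "\<And>i. P' i (S i) = P' (Suc i) (S i)"
  shows "((\<lambda>s. P (piece_index S s) s) has_vector_derivative P' (piece_index S s) s) (at s)"
proof (cases "s \<in> range S")
  case True
  then obtain i where i: "s = S i" by blast
  have pos: "S i > 0" using S strict_mono_leD[OF S(1), of 0 i] by simp
  obtain U where U: "open U" "S i \<in> U"
    "\<And>t. t \<in> U \<Longrightarrow> piece_index S t = (if t \<le> S i then i else Suc i)"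
    using piece_index_near_break[OF S(1), of i] by blast
  have "((\<lambda>t. if t \<le> S i then P i t else P (Suc i) t) has_vector_derivative P' i (S i)) (at (S i))"
    using d[of i "S i"] d[of "Suc i" "S i"] pos match[of i] by (intro has_vector_derivative_if_le) auto
  from has_vector_derivative_transform_within_open[OF this U(1,2)] U(3)
  have "((\<lambda>s. P (piece_index S s) s) has_vector_derivative P' i (S i)) (at (S i))" by simp
  then show ?thesis using U(3)[OF U(2)] i by simp
qed (rule glued_derivative_off_breaks[OF assms(1-4)])

lemma glued_continuous:
  fixes P :: "nat \<Rightarrow> real \<Rightarrow> complex"
  assumes S: "strict_mono S" "0 < S 0" and unb: "\<And>s. \<exists>k. s \<le> S k"
    and c: "\<And>i s. i = 0 \<or> s > 0 \<Longrightarrow> isCont (P i) s"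
    and match: "\<And>i. P i (S i) = P (Suc i) (S i)"
  shows "continuous_on UNIV (\<lambda>s. P (piece_index S s) s)"
proof (rule continuous_at_imp_continuous_on, rule ballI)
  fix s
  show "isCont (\<lambda>s. P (piece_index S s) s) s"
  proof (cases "s \<in> range S")
    case True
    then obtain i where i: "s = S i" by blast
    have pos: "S i > 0" using S strict_mono_leD[OF S(1), of 0 i] by simp
    obtain U where U: "open U" "S i \<in> U"
      "\<And>t. t \<in> U \<Longrightarrow> piece_index S t = (if t \<le> S i then i else Suc i)"
      using piece_index_near_break[OF S(1), of i] by blast
    have ci: "isCont (P i) (S i)" "isCont (P (Suc i)) (S i)" using c pos by auto
    have "isCont (\<lambda>t. if t \<le> S i then P i t else P (Suc i) t) (S i)"
    proof (rule isCont_If_ge)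
      show "continuous (at_left (S i)) (P i)" using ci(1) by (rule continuous_at_imp_continuous_at_within)
      show "(P (Suc i) \<longlongrightarrow> P i (S i)) (at_right (S i))"
        using ci(2) match[of i] by (simp add: isCont_def filterlim_at_split)
    qed
    moreover have ev: "\<forall>\<^sub>F t in nhds (S i). (if t \<le> S i then P i t else P (Suc i) t) = P (piece_index S t) t"
      unfolding eventually_nhds using U by auto
    ultimately show ?thesis unfolding i using isCont_cong[OF ev] by blast
  next
    case False
    obtain k where k: "s \<le> S k" using unb by blast
    obtain U where U: "open U" "s \<in> U" "\<And>t. t \<in> U \<Longrightarrow> piece_index S t = piece_index S s"
      using piece_index_near_inner[OF S(1) k False] by blast
    have "piece_index S s = 0 \<or> s > 0"
      using piece_index_bounds(2)[where S=S, OF k, of 0] S(2) by fastforce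
    then have "isCont (P (piece_index S s)) s" by (rule c)
    moreover have ev: "\<forall>\<^sub>F t in nhds s. P (piece_index S s) t = P (piece_index S t) t"
      unfolding eventually_nhds using U by metis
    ultimately show ?thesis using isCont_cong[OF ev] by blast
  qed
qed

lemma piece_index_measurable [measurable]: "piece_index S \<in> borel \<rightarrow>\<^sub>M count_space UNIV"
  unfolding piece_index_def by measurable

text \<open>The substitution $f = r^{-\alpha} w(r)$ as a function of $s = r^2$; \<open>outer_der\<close> is its derivative in \<open>s\<close>.\<close>

definition outer_val :: "real \<Rightarrow> (real \<Rightarrow> complex) \<Rightarrow> real \<Rightarrow> complex" where
  "outer_val \<alpha> w s = of_real (s powr (- \<alpha> / 2)) * w (sqrt s)"

definition outer_der :: "real \<Rightarrow> (real \<Rightarrow> complex) \<Rightarrow> (real \<Rightarrow> complex) \<Rightarrow> real \<Rightarrow> complex" where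
  "outer_der \<alpha> w w' s = of_real (s powr (- \<alpha> / 2)) *
     (of_real (1 / (2 * sqrt s)) * w' (sqrt s) - of_real (\<alpha> / 2 / s) * w (sqrt s))"

lemma deriv_of_real:
  "(f has_real_derivative D) (at s) \<Longrightarrow> ((\<lambda>s. complex_of_real (f s)) has_vector_derivative of_real D) (at s)"
  by (rule has_vector_derivative_of_real) 

lemma deriv_comp_sqrt:
  assumes "\<And>r. (w has_vector_derivative w' r) (at r)" and s: "s > 0"
  shows "((\<lambda>s. w (sqrt s)) has_vector_derivative of_real (1 / (2 * sqrt s)) * w' (sqrt s)) (at s)"
proof -
  have "(sqrt has_vector_derivative 1 / (2 * sqrt s)) (at s)"
    using DERIV_real_sqrt[OF s] by (simp add: has_real_derivative_iff_has_vector_derivative inverse_eq_divide mult.commute)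
  from vector_diff_chain_at[OF this assms(1)] show ?thesis by (simp add: o_def scaleR_conv_of_real)
qed

lemma powr_weight_deriv:
  assumes s: "(s::real) > 0"
  shows "((\<lambda>s. complex_of_real (s powr (- \<alpha> / 2))) has_vector_derivative
    of_real (s powr (- \<alpha> / 2)) * of_real (- \<alpha> / 2 / s)) (at s)"
proof -
  have "((\<lambda>s. s powr (- \<alpha> / 2)) has_real_derivative s powr (- \<alpha> / 2) * (- \<alpha> / 2 / s)) (at s)"
    using s by (auto intro!: derivative_eq_intros simp: powr_diff)
  from deriv_of_real[OF this] show ?thesis by simp
qed

lemma outer_val_deriv:
  assumes w: "\<And>r. (w has_vector_derivative w' r) (at r)" and s: "s > 0"
  shows "(outer_val \<alpha> w has_vector_derivative outer_der \<alpha> w w' s) (at s)"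
  using has_vector_derivative_mult[OF powr_weight_deriv[OF s, of \<alpha>] deriv_comp_sqrt[OF w s]]
  by (simp add: outer_val_def[abs_def] outer_der_def algebra_simps)

text \<open>The radial equation in the variable $s = |x|^2$: removing the first-order term by the weight
  $s^{-\alpha/2}$ produces the potential $\alpha(\alpha-1)/s$, with \<open>4 * \<alpha> + 2\<close> equal to twice the dimension.\<close>

lemma outer_der_deriv:
  assumes w: "\<And>r. (w has_vector_derivative w' r) (at r)"
    and w': "\<And>r. (w' has_vector_derivative - \<zeta> * w r) (at r)" and s: "s > 0"
  shows "(outer_der \<alpha> w w' has_vector_derivative
     - (of_real (4 * \<alpha> + 2) * outer_der \<alpha> w w' s
         + (\<zeta> + of_real (\<alpha> * (\<alpha> - 1) / s)) * outer_val \<alpha> w s) / of_real (4 * s)) (at s)"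
proof -
  let ?r = "sqrt s"
  have r: "?r > 0" "s = ?r * ?r" using s by auto
  have d1: "((\<lambda>s. complex_of_real (1 / (2 * sqrt s))) has_vector_derivative of_real (- 1 / (4 * ?r * s))) (at s)"
    by (rule deriv_of_real) (use s in \<open>auto intro!: derivative_eq_intros simp: field_simps\<close>)
  have d2: "((\<lambda>s. complex_of_real (\<alpha> / 2 / s)) has_vector_derivative of_real (- \<alpha> / 2 / (s * s))) (at s)"
    by (rule deriv_of_real) (use s in \<open>auto intro!: derivative_eq_intros simp: field_simps power2_eq_square\<close>)
  define p where "p = complex_of_real (s powr (- \<alpha> / 2))"
  define x where "x = complex_of_real ?r"
  have x0: "x \<noteq> 0" using r(1) by (simp add: x_def)
  have sx: "complex_of_real s = x * x" using r(2) by (metis x_def of_real_mult)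
  have D: "(outer_der \<alpha> w w' has_vector_derivative
     p * ((of_real (1 / (2 * ?r)) * (of_real (1 / (2 * ?r)) * (- \<zeta> * w ?r)) + of_real (- 1 / (4 * ?r * s)) * w' ?r)
        - (of_real (\<alpha> / 2 / s) * (of_real (1 / (2 * ?r)) * w' ?r) + of_real (- \<alpha> / 2 / (s * s)) * w ?r))
      + (p * of_real (- \<alpha> / 2 / s)) * (of_real (1 / (2 * ?r)) * w' ?r - of_real (\<alpha> / 2 / s) * w ?r)) (at s)"
    unfolding outer_der_def[abs_def] p_def
    by (intro has_vector_derivative_mult has_vector_derivative_diff powr_weight_deriv[OF s]
        deriv_comp_sqrt[OF w s] deriv_comp_sqrt[OF w' s] d1 d2)
  have "p * ((of_real (1 / (2 * ?r)) * (of_real (1 / (2 * ?r)) * (- \<zeta> * w ?r)) + of_real (- 1 / (4 * ?r * s)) * w' ?r)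
        - (of_real (\<alpha> / 2 / s) * (of_real (1 / (2 * ?r)) * w' ?r) + of_real (- \<alpha> / 2 / (s * s)) * w ?r))
      + (p * of_real (- \<alpha> / 2 / s)) * (of_real (1 / (2 * ?r)) * w' ?r - of_real (\<alpha> / 2 / s) * w ?r)
    = - (of_real (4 * \<alpha> + 2) * (p * (of_real (1 / (2 * ?r)) * w' ?r - of_real (\<alpha> / 2 / s) * w ?r))
         + (\<zeta> + of_real (\<alpha> * (\<alpha> - 1) / s)) * (p * w ?r)) / of_real (4 * s)"
    unfolding of_real_divide of_real_mult of_real_minus of_real_add of_real_diff of_real_numeral of_real_1 sx x_def[symmetric]
    using x0 by (simp add: divide_simps) (simp add: algebra_simps)
  then show ?thesis using D by (simp only: outer_der_def outer_val_def p_def)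
qed

section \<open>Eigenfunctions of layered potentials\<close>

text \<open>The argument is $s = |x|^2$. The term $-\alpha(\alpha-1)/s$ cancels the centrifugal potential, so that the
  reduced equation in a layer has constant coefficients.\<close>

definition layered_profile :: "real \<Rightarrow> (nat \<Rightarrow> complex) \<Rightarrow> (nat \<Rightarrow> real) \<Rightarrow> real \<Rightarrow> complex" where
  "layered_profile \<alpha> q R s = (case piece_index (\<lambda>i. (R i)\<^sup>2) s of
      0 \<Rightarrow> 0
    | Suc j \<Rightarrow> q j - of_real (\<alpha> * (\<alpha> - 1) / s))"

lemma layers_add: "layers q R z 0 y (i + m) = layers q R z i (layers q R z 0 y i) m"
  by (induction m) simp_all

lemma shift_deriv:
  assumes "\<And>x. (w has_vector_derivative w' x) (at x)"
  shows "((\<lambda>r. w (r - c)) has_vector_derivative w' (r - c)) (at (r :: real))"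
proof -
  have "((\<lambda>r. r - c) has_vector_derivative 1) (at r)" by (auto intro!: derivative_eq_intros)
  from vector_diff_chain_at[OF this assms] show ?thesis by (simp add: o_def)
qed

text \<open>Within every layer the solution stays in the cone because it is there at the end of the layer, and
  $|w|^2 e^{\kappa r}$ decreases from layer to layer. The constant \<open>T\<close> does not depend on the layer.\<close>

lemma layer_decay:
  fixes q :: "nat \<Rightarrow> complex" and R :: "nat \<Rightarrow> real" and y :: "complex \<times> complex" and z :: complex
  defines "w \<equiv> \<lambda>j. slab_val (z - q j) (fst (layers q R z 0 y j)) (snd (layers q R z 0 y j))"
    and "w' \<equiv> \<lambda>j. slab_der (z - q j) (fst (layers q R z 0 y j)) (snd (layers q R z 0 y j))"
  assumes R: "\<And>j. R j \<le> R (Suc j)"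
    and \<rho>: "\<rho> > 0" "2 * \<rho> \<le> \<kappa>" and Imk: "\<kappa> \<le> Im (- csqrt z)"
    and q: "\<And>j. j \<ge> i \<Longrightarrow> cmod (q j) + \<rho>\<^sup>2 \<le> 2 * \<kappa> * \<rho>"
    and cone: "\<And>m. m \<ge> i \<Longrightarrow> cone_form \<rho> (- csqrt z) (layers q R z 0 y m) \<le> 0"
  obtains T where "T \<ge> 0"
    "\<And>j r. j \<ge> i \<Longrightarrow> R j \<le> r \<Longrightarrow> r \<le> R (Suc j) \<Longrightarrow> cmod (w j (r - R j)) \<le> T * exp (- (\<kappa> / 2) * r)"
    "\<And>j r. j \<ge> i \<Longrightarrow> R j \<le> r \<Longrightarrow> r \<le> R (Suc j) \<Longrightarrow> cmod (w' j (r - R j)) \<le> T * exp (- (\<kappa> / 2) * r)"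
proof -
  let ?k = "- csqrt z"
  have in_cone: "cmod (w' j x - \<i> * ?k * w j x) \<le> \<rho> * cmod (w j x)"
    if j: "j \<ge> i" "x \<le> R (Suc j) - R j" for j x
  proof -
    let ?L = "R (Suc j) - R j"
    have "cone_form \<rho> ?k (w j x, w' j x) \<le> cone_form \<rho> ?k (w j ?L, w' j ?L)"
      using cone_slab_mono[OF Imk \<rho>(1) q[OF j(1)] j(2)] by (simp add: w_def w'_def)
    also have "\<dots> \<le> 0" using cone[of "Suc j"] j(1) by (simp add: w_def w'_def)
    finally show ?thesis using \<rho>(1) by (simp add: cone_form_nonpos_iff)
  qed
  have wd: "(w j has_vector_derivative w' j x) (at x)" for j x
    unfolding w_def w'_def by (rule slab_val_deriv)
  define E where "E m = (cmod (fst (layers q R z 0 y m)))\<^sup>2 * exp (\<kappa> * R m)" for m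
  have dec: "(cmod (w j x))\<^sup>2 * exp (\<kappa> * (R j + x)) \<le> E j" if j: "j \<ge> i" "0 \<le> x" "x \<le> R (Suc j) - R j" for j x
  proof -
    have "(cmod (w j x))\<^sup>2 * exp (\<kappa> * x) \<le> (cmod (w j 0))\<^sup>2 * exp (\<kappa> * 0)"
      by (rule cone_decay[OF wd Imk \<rho>(2) in_cone[OF j(1)] j(2)]) (use j in auto)
    then have "(cmod (w j x))\<^sup>2 * exp (\<kappa> * x) * exp (\<kappa> * R j) \<le> (cmod (w j 0))\<^sup>2 * exp (\<kappa> * 0) * exp (\<kappa> * R j)"
      by (intro mult_right_mono) auto
    then show ?thesis by (simp add: E_def w_def exp_add distrib_left mult_ac)
  qed
  have Estep: "E (Suc j) \<le> E j" if "j \<ge> i" for j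
    using dec[OF that, of "R (Suc j) - R j"] R[of j] by (simp add: E_def w_def)
  have Ei: "E j \<le> E i" if "j \<ge> i" for j
    using that by (induction j rule: dec_induct) (auto intro: order_trans[OF Estep])
  define T0 where "T0 = sqrt (E i)"
  have w_le: "cmod (w j (r - R j)) \<le> T0 * exp (- (\<kappa> / 2) * r)" if j: "j \<ge> i" "R j \<le> r" "r \<le> R (Suc j)" for j r
  proof -
    have e2: "exp (\<kappa> * r) = (exp (\<kappa> / 2 * r))\<^sup>2" by (simp add: exp_double[symmetric])
    have "(cmod (w j (r - R j)) * exp (\<kappa> / 2 * r))\<^sup>2 \<le> E i"
      using dec[OF j(1), of "r - R j"] j Ei[OF j(1)] by (simp add: power_mult_distrib e2)
    then have "cmod (w j (r - R j)) * exp (\<kappa> / 2 * r) \<le> T0"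
      unfolding T0_def by (rule real_le_rsqrt)
    then have "cmod (w j (r - R j)) * exp (\<kappa> / 2 * r) * exp (- (\<kappa> / 2) * r) \<le> T0 * exp (- (\<kappa> / 2) * r)"
      by (intro mult_right_mono) auto
    then show ?thesis by (simp add: mult.assoc exp_add[symmetric])
  qed
  have T00: "T0 \<ge> 0" by (simp add: T0_def E_def)
  define T where "T = max T0 ((\<rho> + cmod ?k) * T0)"
  show ?thesis
  proof
    show "T \<ge> 0" using T00 by (simp add: T_def le_max_iff_disj)
    fix j r assume j: "j \<ge> i" "R j \<le> r" "r \<le> R (Suc j)"
    have "T0 * exp (- (\<kappa> / 2) * r) \<le> T * exp (- (\<kappa> / 2) * r)" by (intro mult_right_mono) (auto simp: T_def)
    then show "cmod (w j (r - R j)) \<le> T * exp (- (\<kappa> / 2) * r)" using w_le[OF j] by linarith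
    have "cmod (w' j (r - R j)) \<le> cmod (w' j (r - R j) - \<i> * ?k * w j (r - R j)) + cmod (\<i> * ?k * w j (r - R j))"
      by (metis norm_triangle_ineq diff_add_cancel)
    also have "\<dots> \<le> (\<rho> + cmod ?k) * cmod (w j (r - R j))"
      using in_cone[OF j(1), of "r - R j"] j by (simp add: norm_mult algebra_simps)
    also have "\<dots> \<le> (\<rho> + cmod ?k) * (T0 * exp (- (\<kappa> / 2) * r))"
      using w_le[OF j] \<rho>(1) by (intro mult_left_mono) auto
    also have "\<dots> \<le> T * exp (- (\<kappa> / 2) * r)"
      unfolding mult.assoc[symmetric] by (intro mult_right_mono) (auto simp: T_def)
    finally show "cmod (w' j (r - R j)) \<le> T * exp (- (\<kappa> / 2) * r)" .
  qed
qed

lemma layered_profile_measurable [measurable]: "layered_profile \<alpha> q R \<in> borel_measurable borel"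
proof -
  have "(\<lambda>s. (\<lambda>i s. case i of 0 \<Rightarrow> 0 | Suc j \<Rightarrow> q j - of_real (\<alpha> * (\<alpha> - 1) / s)) (piece_index (\<lambda>i. (R i)\<^sup>2) s) s)
      \<in> borel_measurable borel"
  proof (rule measurable_compose_countable)
    show "(\<lambda>s. case i of 0 \<Rightarrow> 0 | Suc j \<Rightarrow> q j - of_real (\<alpha> * (\<alpha> - 1) / s)) \<in> borel_measurable borel" for i
      by (cases i) auto
  qed measurable
  then show ?thesis by (simp add: layered_profile_def[abs_def])
qed

text \<open>The data \<open>b0\<close> and \<open>a0\<close> are those of $r^\alpha F(zr^2)$ at $r = R_0$, so that the pieces match to first
  order at the boundary of the inner ball.\<close>

lemma layered_eigenvalue:
  fixes \<alpha> \<kappa> \<rho> M :: real and q :: "nat \<Rightarrow> complex" and R :: "nat \<Rightarrow> real" and z b0 a0 :: complex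
  assumes \<alpha>: "real CARD('n::finite) = 2 * \<alpha> + 1"
    and F: "\<And>z. (F has_field_derivative F' z) (at z)" "\<And>z. (F' has_field_derivative F'' z) (at z)"
      "continuous_on UNIV F''" "\<And>z. 4 * z * F'' z + 2 * of_real (2 * \<alpha> + 1) * F' z + F z = 0" "F 0 = 1"
    and R: "strict_mono R" "1 \<le> R 0" "\<And>s. \<exists>k. s \<le> R k"
    and b0: "b0 = of_real (R 0 powr \<alpha>) * F (z * of_real ((R 0)\<^sup>2))"
    and a0: "a0 = of_real (R 0 powr \<alpha>) * (of_real (2 * R 0) * z * F' (z * of_real ((R 0)\<^sup>2))
        + of_real (\<alpha> / R 0) * F (z * of_real ((R 0)\<^sup>2)))"
    and M: "\<And>j. cmod (q j) \<le> M"
    and \<rho>: "\<rho> > 0" "2 * \<rho> \<le> \<kappa>" and Imk: "\<kappa> \<le> Im (- csqrt z)"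
    and q: "\<And>j. j \<ge> i \<Longrightarrow> cmod (q j) + \<rho>\<^sup>2 \<le> 2 * \<kappa> * \<rho>"
    and cone: "\<And>m. m \<ge> i \<Longrightarrow> cone_form \<rho> (- csqrt z) (layers q R z 0 (b0, a0) m) \<le> 0"
  shows "eigenvalue (schroedinger_op (\<lambda>x :: real ^ 'n. layered_profile \<alpha> q R ((norm x)\<^sup>2))) z"
proof -
  have \<alpha>0: "\<alpha> \<ge> 0"
  proof -
    have "CARD('n) \<ge> 1" by (simp add: Suc_leI)
    then have "real CARD('n) \<ge> 1" by linarith
    then show ?thesis using \<alpha> by linarith
  qed
  have Rpos: "R j \<ge> 1" for j using R(2) strict_mono_leD[OF R(1), of 0 j] by simp
  have Rmono: "R j \<le> R (Suc j)" for j using strict_mono_leD[OF R(1)] by simp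
  define S where "S j = (R j)\<^sup>2" for j
  have sqS: "sqrt (S j) = R j" for j using Rpos[of j] by (simp add: S_def)
  have S: "strict_mono S" "0 < S 0"
  proof -
    show "strict_mono S" unfolding S_def strict_mono_def
    proof (intro allI impI)
      fix a b :: nat assume "a < b"
      then have "R a < R b" using R(1) by (simp add: strict_mono_def)
      then show "(R a)\<^sup>2 < (R b)\<^sup>2" using Rpos[of a] by (intro power_strict_mono) auto
    qed
    show "0 < S 0" using Rpos[of 0] by (simp add: S_def)
  qed
  have Spos: "S j \<ge> 1" for j using Rpos[of j] by (simp add: S_def)
  have unb: "\<exists>k. s \<le> S k" for s
  proof -
    obtain k where "\<bar>s\<bar> \<le> R k" using R(3) by blast
    moreover have "R k \<le> S k" using Rpos[of k] by (simp add: S_def power2_eq_square)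
    ultimately show ?thesis by (intro exI[of _ k]) linarith
  qed
  let ?y = "(b0, a0)"
  define b where "b j = fst (layers q R z 0 ?y j)" for j
  define a where "a j = snd (layers q R z 0 ?y j)" for j
  define w where "w j r = slab_val (z - q j) (b j) (a j) (r - R j)" for j r
  define w' where "w' j r = slab_der (z - q j) (b j) (a j) (r - R j)" for j r
  have dw: "(w j has_vector_derivative w' j r) (at r)" for j r
    unfolding w_def[abs_def] w'_def by (rule shift_deriv[OF slab_val_deriv])
  have dw': "(w' j has_vector_derivative - (z - q j) * w j r) (at r)" for j r
    unfolding w_def w'_def[abs_def] by (rule shift_deriv[OF slab_der_deriv])
  have step: "w j (R (Suc j)) = b (Suc j)" "w' j (R (Suc j)) = a (Suc j)" "w j (R j) = b j" "w' j (R j) = a j" for j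
    by (simp_all add: w_def w'_def b_def a_def)
  define P where "P j = (case j of 0 \<Rightarrow> (\<lambda>s. F (z * of_real s)) | Suc j \<Rightarrow> outer_val \<alpha> (w j))" for j
  define P' where "P' j = (case j of 0 \<Rightarrow> (\<lambda>s. z * F' (z * of_real s)) | Suc j \<Rightarrow> outer_der \<alpha> (w j) (w' j))" for j
  define P'' where "P'' j = (case j of 0 \<Rightarrow> (\<lambda>s. z * (z * F'' (z * of_real s)))
     | Suc j \<Rightarrow> (\<lambda>s. - (of_real (4 * \<alpha> + 2) * outer_der \<alpha> (w j) (w' j) s
         + ((z - q j) + of_real (\<alpha> * (\<alpha> - 1) / s)) * outer_val \<alpha> (w j) s) / of_real (4 * s)))" for j
  have lin: "((\<lambda>s. G (z * complex_of_real s)) has_vector_derivative z * G' (z * of_real s)) (at s)"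
    if "\<And>z. (G has_field_derivative G' z) (at z)" for G G' and s :: real
  proof (rule has_vector_derivative_real_field)
    show "((\<lambda>s. G (z * s)) has_field_derivative z * G' (z * complex_of_real s)) (at (complex_of_real s))"
      by (rule DERIV_chain2[OF that, THEN DERIV_cong]) (auto intro!: derivative_eq_intros)
  qed
  have dP: "(P j has_vector_derivative P' j s) (at s)" if "j = 0 \<or> s > 0" for j s
    using that lin[OF F(1)] outer_val_deriv[OF dw] by (auto simp: P_def P'_def split: nat.splits)
  have dP': "(P' j has_vector_derivative P'' j s) (at s)" if "j = 0 \<or> s > 0" for j s
    using that has_vector_derivative_mult_right[OF lin[OF F(2)], of z] outer_der_deriv[OF dw dw']
    by (auto simp: P''_def P'_def split: nat.splits)
  have matchP: "P j (S j) = P (Suc j) (S j)" and matchP': "P' j (S j) = P' (Suc j) (S j)" for j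
  proof -
    show "P j (S j) = P (Suc j) (S j)"
    proof (cases j)
      case 0
      have "S 0 powr (- \<alpha> / 2) * R 0 powr \<alpha> = 1"
        using Rpos[of 0] by (simp add: S_def powr_power[symmetric] powr_powr flip: powr_add powr_numeral)
      then have "complex_of_real (S 0 powr (- \<alpha> / 2)) * of_real (R 0 powr \<alpha>) = 1" by (metis of_real_mult of_real_1)
      moreover have "b 0 = b0" by (simp add: b_def)
      ultimately show ?thesis
        using 0 by (simp add: P_def outer_val_def sqS step b0 mult.assoc[symmetric]) (simp add: S_def)
    qed (simp add: P_def outer_val_def sqS step)
    show "P' j (S j) = P' (Suc j) (S j)"
    proof (cases j)
      case 0
      have "S 0 powr (- \<alpha> / 2) * R 0 powr \<alpha> = 1"
        using Rpos[of 0] by (simp add: S_def powr_power[symmetric] powr_powr flip: powr_add powr_numeral)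
      then have p: "complex_of_real (S 0 powr (- \<alpha> / 2)) * of_real (R 0 powr \<alpha>) = 1" by (metis of_real_mult of_real_1)
      have r0: "complex_of_real (R 0) \<noteq> 0" using Rpos[of 0] by auto
      have ab: "b 0 = b0" "a 0 = a0" by (simp_all add: b_def a_def)
      have "of_real (1 / (2 * R 0)) * a0 - of_real (\<alpha> / 2 / S 0) * b0
         = of_real (R 0 powr \<alpha>) * (z * F' (z * of_real ((R 0)\<^sup>2)))"
        unfolding a0 b0 S_def using r0 by (simp add: field_simps power2_eq_square)
      then have "P' (Suc 0) (S 0) = (complex_of_real (S 0 powr (- \<alpha> / 2)) * of_real (R 0 powr \<alpha>)) * (z * F' (z * of_real ((R 0)\<^sup>2)))"
        by (simp add: P'_def outer_der_def sqS step ab mult.assoc)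
      then show ?thesis using 0 unfolding p by (simp add: P'_def S_def)
    qed (simp add: P'_def outer_der_def sqS step)
  qed
  define g where "g s = P (piece_index S s) s" for s
  define g1 where "g1 s = P' (piece_index S s) s" for s
  define g2 where "g2 s = P'' (piece_index S s) s" for s
  have v: "layered_profile \<alpha> q R s = (case piece_index S s of 0 \<Rightarrow> 0 | Suc j \<Rightarrow> q j - of_real (\<alpha> * (\<alpha> - 1) / s))" for s
    by (simp add: layered_profile_def S_def[abs_def])
  have idx0: "piece_index S s = 0" if "s \<le> S 0" for s
    by (rule piece_index_eqI) (use that in auto)
  have idx_Suc: "S j < s" if "piece_index S s = Suc j" for s j
    using unb[of s] piece_index_bounds(2)[of s S _ j] that by fastforce
  have \<kappa>: "\<kappa> > 0" using \<rho> by simp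
  obtain T where T: "T \<ge> 0"
    "\<And>j r. j \<ge> i \<Longrightarrow> R j \<le> r \<Longrightarrow> r \<le> R (Suc j) \<Longrightarrow> cmod (w j r) \<le> T * exp (- (\<kappa> / 2) * r)"
    "\<And>j r. j \<ge> i \<Longrightarrow> R j \<le> r \<Longrightarrow> r \<le> R (Suc j) \<Longrightarrow> cmod (w' j r) \<le> T * exp (- (\<kappa> / 2) * r)"
    unfolding w_def w'_def b_def a_def
    by (rule layer_decay[OF Rmono \<rho> Imk q cone]) blast+
  have tail_idx: "\<exists>j\<ge>i. piece_index S s = Suc j \<and> R j \<le> sqrt s \<and> sqrt s \<le> R (Suc j)" if s: "s \<ge> S i + 1" for s
  proof -
    obtain k where k: "s \<le> S k" using unb by blast
    let ?m = "piece_index S s"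
    have m: "s \<le> S ?m" by (rule piece_index_bounds(1)[where S=S, OF k])
    have "\<not> ?m \<le> i" using m s strict_mono_leD[OF S(1), of ?m i] by linarith
    then obtain j where j: "?m = Suc j" "j \<ge> i" by (cases ?m) auto
    have "S j < s" by (rule idx_Suc[OF j(1)])
    then have "R j \<le> sqrt s" using real_sqrt_le_mono[of "S j" s] by (simp add: sqS)
    moreover have "sqrt s \<le> R (Suc j)" using m real_sqrt_le_mono[of s "S (Suc j)"] by (simp add: j sqS)
    ultimately show ?thesis using j by blast
  qed
  have weight: "s powr (- \<alpha> / 2) \<le> 1" if "s \<ge> 1" for s :: real
    using powr_mono[of "- \<alpha> / 2" 0 s] that \<alpha>0 by simp
  define C where "C = (1 + \<alpha>) * T"
  have CT: "T \<le> C" using mult_right_mono[of 1 "1 + \<alpha>" T] \<alpha>0 T(1) by (simp add: C_def)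
  show ?thesis
  proof (rule eigenvalue_radial[where g=g and ?g1.0=g1 and ?g2.0=g2 and B="range S" and S="S i + 1" and \<kappa>="\<kappa> / 2" and C=C
        and K="Sup ((\<lambda>s. cmod (P'' 0 s)) ` {0..1})" and M="M + \<bar>\<alpha> * (\<alpha> - 1)\<bar>"])
    show "(g has_vector_derivative g1 s) (at s)" for s
      unfolding g_def[abs_def] g1_def by (rule glued_derivative[OF S unb dP matchP matchP'])
    have "isCont (P' j) s" if "j = 0 \<or> s > 0" for j s
      using dP'[OF that] by (rule has_vector_derivative_continuous)
    then show "continuous_on UNIV g1"
      unfolding g1_def[abs_def] by (intro glued_continuous[OF S unb _ matchP'])
    show "(g1 has_vector_derivative g2 s) (at s)" if "s \<notin> range S" for s
      unfolding g1_def[abs_def] g2_def by (rule glued_derivative_off_breaks[OF S unb dP' that])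
    show "finite (range S \<inter> {..r})" for r
    proof -
      obtain k where k: "r \<le> S k" using unb by blast
      have "range S \<inter> {..r} \<subseteq> S ` {..k}"
      proof
        fix s assume "s \<in> range S \<inter> {..r}"
        then obtain j where j: "s = S j" "S j \<le> r" by auto
        then have "S j \<le> S k" using k by linarith
        then have "j \<le> k" using S(1) by (simp add: strict_mono_less_eq)
        then show "s \<in> S ` {..k}" using j by auto
      qed
      then show ?thesis by (rule finite_subset) simp
    qed
    show "g2 \<in> borel_measurable borel"
      unfolding g2_def[abs_def]
    proof (rule measurable_compose_countable)
      have c: "continuous_on UNIV (w j)" "continuous_on UNIV (w' j)" for j
        using dw dw' by (meson continuous_at_imp_continuous_on has_vector_derivative_continuous)+
      have [measurable]: "w j \<in> borel_measurable borel" "w' j \<in> borel_measurable borel" for j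
        using c by (auto intro: borel_measurable_continuous_onI)
      have [measurable]: "F'' \<in> borel_measurable borel" by (rule borel_measurable_continuous_onI[OF F(3)])
      show "P'' j \<in> borel_measurable borel" for j
        by (cases j) (simp_all add: P''_def outer_val_def outer_der_def)
    qed measurable
    show "of_real (4 * s) * g2 s + of_nat (2 * CARD('n)) * g1 s + (z - layered_profile \<alpha> q R s) * g s = 0" if "s \<ge> 0" for s
    proof -
      have card: "of_nat (2 * CARD('n)) = complex_of_real (2 * (2 * \<alpha> + 1))"
        using \<alpha> by (metis of_nat_mult of_nat_numeral of_real_mult of_real_numeral of_real_of_nat_eq)
      show ?thesis
      proof (cases "piece_index S s")
        case 0
        have "of_real (4 * s) * (z * (z * F'' (z * of_real s))) + complex_of_real (2 * (2 * \<alpha> + 1)) * (z * F' (z * of_real s)) + z * F (z * of_real s)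
          = z * (4 * (z * of_real s) * F'' (z * of_real s) + 2 * of_real (2 * \<alpha> + 1) * F' (z * of_real s) + F (z * of_real s))"
          by (simp add: algebra_simps)
        also have "\<dots> = 0" using F(4) by simp
        finally show ?thesis unfolding v g_def g1_def g2_def 0 card by (simp add: P_def P'_def P''_def)
      next
        case (Suc j)
        then have "s > 0" using idx_Suc[OF Suc] Spos[of j] by linarith
        then have s0: "complex_of_real (4 * s) \<noteq> 0" by simp
        have "4 * \<alpha> + 2 = 2 * (2 * \<alpha> + 1)" by simp
        moreover have "X * (- (A + B * Y) / X) + A + (B' * Y) = 0" if "X \<noteq> 0" "B' = B" for X A B B' Y :: complex
          using that by simp
        ultimately show ?thesis
          unfolding v g_def g1_def g2_def Suc card using s0
          by (simp only: P_def P'_def P''_def nat.case) simp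
      qed
    qed
    show "cmod (layered_profile \<alpha> q R s) \<le> M + \<bar>\<alpha> * (\<alpha> - 1)\<bar>" for s
    proof (cases "piece_index S s")
      case 0
      have "M \<ge> 0" using M[of 0] norm_ge_zero order_trans by blast
      then show ?thesis using 0 by (simp add: v)
    next
      case (Suc j)
      then have s: "s \<ge> 1" using idx_Suc[OF Suc] Spos[of j] by linarith
      have "cmod (of_real (\<alpha> * (\<alpha> - 1) / s)) = \<bar>\<alpha> * (\<alpha> - 1)\<bar> / s" using s by (simp only: norm_of_real abs_divide)
      also have "\<dots> \<le> \<bar>\<alpha> * (\<alpha> - 1)\<bar> / 1" using s by (intro divide_left_mono) auto
      finally show ?thesis using M[of j] norm_triangle_ineq4[of "q j" "of_real (\<alpha> * (\<alpha> - 1) / s)"]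
        unfolding v Suc by simp
    qed
    show "cmod (g2 s) \<le> Sup ((\<lambda>s. cmod (P'' 0 s)) ` {0..1})" if "0 \<le> s" "s \<le> 1" for s
    proof -
      have "continuous_on {0..1} (\<lambda>s. cmod (P'' 0 s))"
        unfolding P''_def by (simp, intro continuous_intros continuous_on_compose2[OF F(3)]) auto
      then have "bdd_above ((\<lambda>s. cmod (P'' 0 s)) ` {0..1})"
        by (intro bounded_imp_bdd_above compact_imp_bounded compact_continuous_image compact_Icc)
      moreover have "g2 s = P'' 0 s" using that Spos[of 0] idx0[of s] by (simp add: g2_def)
      ultimately show ?thesis using that by (auto intro!: cSup_upper)
    qed
    show "\<kappa> / 2 > 0" using \<kappa> by simp
    show "S i + 1 \<ge> 1" using Spos[of i] by simp
    show "cmod (g s) \<le> C * exp (- (\<kappa> / 2) * sqrt s)" if s: "s \<ge> S i + 1" for s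
    proof -
      obtain j where j: "j \<ge> i" "piece_index S s = Suc j" "R j \<le> sqrt s" "sqrt s \<le> R (Suc j)" using tail_idx[OF s] by blast
      have "cmod (g s) = s powr (- \<alpha> / 2) * cmod (w j (sqrt s))" by (simp add: g_def j P_def outer_val_def norm_mult)
      also have "\<dots> \<le> 1 * (T * exp (- (\<kappa> / 2) * sqrt s))"
        using T(2)[OF j(1,3,4)] weight[of s] s Spos[of i] by (intro mult_mono) auto
      also have "\<dots> \<le> C * exp (- (\<kappa> / 2) * sqrt s)" using CT by (simp add: mult_right_mono)
      finally show ?thesis .
    qed
    show "sqrt s * cmod (g1 s) \<le> C * exp (- (\<kappa> / 2) * sqrt s)" if s: "s \<ge> S i + 1" for s
    proof -
      obtain j where j: "j \<ge> i" "piece_index S s = Suc j" "R j \<le> sqrt s" "sqrt s \<le> R (Suc j)" using tail_idx[OF s] by blast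
      have s1: "s \<ge> 1" "sqrt s \<ge> 1" using s Spos[of i] by auto
      let ?Y = "of_real (1 / (2 * sqrt s)) * w' j (sqrt s) - of_real (\<alpha> / 2 / s) * w j (sqrt s)"
      let ?e = "T * exp (- (\<kappa> / 2) * sqrt s)"
      have e0: "?e \<ge> 0" using T(1) by simp
      have "cmod ?Y
         \<le> 1 / (2 * sqrt s) * cmod (w' j (sqrt s)) + \<alpha> / 2 / s * cmod (w j (sqrt s))"
        by (rule order_trans[OF norm_triangle_ineq4]) (use s1 \<alpha>0 in \<open>simp add: norm_mult norm_divide\<close>)
      also have "\<dots> \<le> 1 / (2 * sqrt s) * ?e + \<alpha> / 2 / s * ?e"
        using T(2,3)[OF j(1,3,4)] s1 \<alpha>0 by (intro add_mono mult_left_mono) auto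
      finally have "sqrt s * cmod ?Y
         \<le> sqrt s * (1 / (2 * sqrt s) * ?e + \<alpha> / 2 / s * ?e)" using s1 by (intro mult_left_mono) auto
      also have "\<dots> = (1 / 2 + \<alpha> / 2 * (sqrt s / s)) * ?e" using s1 by (simp add: field_simps)
      also have "\<dots> \<le> (1 + \<alpha>) * ?e"
      proof (rule mult_right_mono[OF _ e0])
        have "sqrt s \<le> s" using s1 by (metis mult_left_mono mult.right_neutral real_sqrt_ge_zero real_sqrt_mult_self abs_of_nonneg order_trans zero_le_one)
        then have "sqrt s / s \<le> 1" using s1 by simp
        then have "\<alpha> / 2 * (sqrt s / s) \<le> \<alpha> / 2 * 1" using \<alpha>0 by (intro mult_left_mono) auto
        then show "1 / 2 + \<alpha> / 2 * (sqrt s / s) \<le> 1 + \<alpha>" using \<alpha>0 by simp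
      qed
      finally have *: "sqrt s * cmod ?Y \<le> C * exp (- (\<kappa> / 2) * sqrt s)"
        by (simp add: C_def mult.assoc)
      have "cmod (g1 s) = s powr (- \<alpha> / 2) * cmod ?Y"
        unfolding g1_def j P'_def by (simp only: nat.case outer_der_def norm_mult norm_of_real abs_of_nonneg powr_ge_zero)
      also have "\<dots> \<le> 1 * cmod ?Y"
        by (intro mult_right_mono weight s1) auto
      finally have "sqrt s * cmod (g1 s) \<le> sqrt s * cmod ?Y"
        using s1 by (intro mult_left_mono) auto
      then show ?thesis using * by linarith
    qed
    show "g 0 \<noteq> 0" using idx0[of 0] Spos[of 0] F(5) by (simp add: g_def P_def)
  qed
qed

section \<open>Infinitely many layers\<close>

text \<open>Layer and protection data together, for an arbitrary energy: first \<open>E\<close> is moved to a nondegenerate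
  energy \<open>E'\<close>, then the layer is built, then the zero is isolated, each step costing a third of \<open>\<eta>\<close>.\<close>

lemma add_layer:
  fixes a b :: "complex \<Rightarrow> complex" and E \<eta> R p :: real and d :: nat
  assumes a: "a holomorphic_on UNIV" and b: "b holomorphic_on UNIV" and nz: "a 0 \<noteq> 0 \<or> b 0 \<noteq> 0"
    and E: "E > 0" and \<eta>: "\<eta> > 0" and d: "d \<ge> 1" "p > real d" and R: "R \<ge> 0"
  obtains q \<mu> :: complex and L rad \<kappa> \<rho> :: real where
    "L \<ge> 1" "cmod q \<le> \<eta>" "cmod q powr p * (R + L) ^ d \<le> \<eta>"
    "protected_zero (\<lambda>z. slab_val (z - q) (b z) (a z) L) (\<lambda>z. slab_der (z - q) (b z) (a z) L) \<mu> rad \<kappa> \<rho>"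
    "\<And>z. z \<in> cball \<mu> rad \<Longrightarrow> cmod (z - of_real E) < \<eta>"
proof -
  have \<eta>3: "\<eta> / 3 > 0" using \<eta> by simp
  obtain E' :: real where E': "E' > 0" "\<bar>E' - E\<bar> < \<eta> / 3" "(a (of_real E'))\<^sup>2 + of_real E' * (b (of_real E'))\<^sup>2 \<noteq> 0"
    using nondegenerate_energy[OF a b nz E \<eta>3] by blast
  obtain q \<mu> :: complex and L :: real where
    L: "L \<ge> 1" and q: "cmod q \<le> \<eta> / 3" "cmod q powr p * (R + L) ^ d \<le> \<eta> / 3"
    and \<mu>: "Im \<mu> < 0" "cmod (\<mu> - of_real E') < \<eta> / 3"
    and m: "slab_der (\<mu> - q) (b \<mu>) (a \<mu>) L = - \<i> * csqrt \<mu> * slab_val (\<mu> - q) (b \<mu>) (a \<mu>) L"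
    using slab_creates_resonance[OF a b E'(1,3) \<eta>3 d R] by blast
  define a' where "a' z = slab_der (z - q) (b z) (a z) L" for z
  define b' where "b' z = slab_val (z - q) (b z) (a z) L" for z
  have hol: "a' holomorphic_on UNIV" "b' holomorphic_on UNIV"
    unfolding a'_def[abs_def] b'_def[abs_def] by (rule slab_val_holomorphic[OF b a])+
  have nz': "a' 0 \<noteq> 0 \<or> b' 0 \<noteq> 0"
    using slab_map_eq_0[of "0 - q" "b 0" "a 0" L] nz by (auto simp: a'_def b'_def)
  have m': "a' \<mu> + \<i> * csqrt \<mu> * b' \<mu> = 0" using m by (simp add: a'_def b'_def)
  obtain rad \<kappa> \<rho> :: real where r: "rad < \<eta> / 3" "protected_zero b' a' \<mu> rad \<kappa> \<rho>"
    using isolated_resonance[OF hol nz' \<mu>(1) m' \<eta>3] by blast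
  have near: "cmod (z - of_real E) < \<eta>" if "z \<in> cball \<mu> rad" for z
  proof -
    have "z - of_real E = (z - \<mu>) + (\<mu> - of_real E') + of_real (E' - E)" by simp
    then have "cmod (z - of_real E) \<le> cmod (z - \<mu>) + cmod (\<mu> - of_real E') + cmod (complex_of_real (E' - E))"
      by (metis norm_triangle_ineq order_trans add_right_mono)
    moreover have "cmod (z - \<mu>) \<le> rad" using that by (simp add: dist_norm norm_minus_commute)
    moreover have "cmod (complex_of_real (E' - E)) = \<bar>E' - E\<bar>" by (simp only: norm_of_real)
    ultimately show ?thesis using r(1) \<mu>(2) E'(2) by linarith
  qed
  show ?thesis
    by (rule that[OF L _ _ r(2)[unfolded a'_def[abs_def] b'_def[abs_def]] near]) (use q \<eta> in auto)
qed

text \<open>Dependent choice. The state consists of radius, data and the bound \<open>\<beta>\<close> that all further \<open>q\<close> must obey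
  in order not to destroy the eigenvalues obtained so far; each new layer lowers \<open>\<beta>\<close> to its own tolerance
  \<open>\<kappa> * \<rho>\<close>.\<close>

lemma resonance_sequence:
  fixes a0 b0 :: "complex \<Rightarrow> complex" and E \<delta> :: "nat \<Rightarrow> real" and R0 p :: real and d :: nat
  assumes a0: "a0 holomorphic_on UNIV" and b0: "b0 holomorphic_on UNIV" and nz: "a0 0 \<noteq> 0 \<or> b0 0 \<noteq> 0"
    and E: "\<And>n. E n > 0" and \<delta>: "\<And>n. \<delta> n > 0" and d: "d \<ge> 1" "p > real d" and R0: "R0 \<ge> 0"
  obtains R :: "nat \<Rightarrow> real" and q :: "nat \<Rightarrow> complex" where
    "R 0 = R0" "\<And>n. R n + 1 \<le> R (Suc n)"
    "\<And>n. cmod (q n) \<le> \<delta> n" "\<And>n. cmod (q n) powr p * R (Suc n) ^ d \<le> \<delta> n"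
    "\<And>n. \<exists>z \<kappa> \<rho>. cmod (z - of_real (E n)) < \<delta> n \<and> Im z < 0 \<and> \<rho> > 0 \<and> 2 * \<rho> \<le> \<kappa> \<and> \<kappa> \<le> Im (- csqrt z) \<and>
       (\<forall>j\<ge>Suc n. cmod (q j) + \<rho>\<^sup>2 \<le> 2 * \<kappa> * \<rho>) \<and>
       (\<forall>m\<ge>Suc n. cone_form \<rho> (- csqrt z) (layers q R z 0 (b0 z, a0 z) m) \<le> 0)"
proof -
  define step where "step n x q \<mu> rad \<kappa> \<rho> y \<longleftrightarrow> (case x of (R, b, a, \<beta>) \<Rightarrow> case y of (R', b', a', \<beta>') \<Rightarrow>
      R + 1 \<le> R' \<and> b' = (\<lambda>z. slab_val (z - q) (b z) (a z) (R' - R)) \<and> a' = (\<lambda>z. slab_der (z - q) (b z) (a z) (R' - R)) \<and>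
      cmod q \<le> \<delta> n \<and> cmod q \<le> \<beta> \<and> cmod q powr p * R' ^ d \<le> \<delta> n \<and> \<beta>' \<le> \<beta> \<and> \<beta>' \<le> \<kappa> * \<rho> \<and>
      protected_zero b' a' \<mu> rad \<kappa> \<rho> \<and> (\<forall>z\<in>cball \<mu> rad. cmod (z - of_real (E n)) < \<delta> n))"
    for n :: nat and x y :: "real \<times> (complex \<Rightarrow> complex) \<times> (complex \<Rightarrow> complex) \<times> real" and q \<mu> :: complex and rad \<kappa> \<rho> :: real
  define valid where "valid x \<longleftrightarrow> (case x of (R, b, a, \<beta>) \<Rightarrow> R \<ge> 0 \<and> b holomorphic_on UNIV \<and> a holomorphic_on UNIV \<and>
      (a 0 \<noteq> 0 \<or> b 0 \<noteq> 0) \<and> \<beta> > 0)" for x :: "real \<times> (complex \<Rightarrow> complex) \<times> (complex \<Rightarrow> complex) \<times> real"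
  have "\<exists>X. \<forall>n. (valid (X n) \<and> (n = 0 \<longrightarrow> X n = (R0, b0, a0, 1))) \<and> (\<exists>q \<mu> rad \<kappa> \<rho>. step n (X n) q \<mu> rad \<kappa> \<rho> (X (Suc n)))"
  proof (rule dependent_nat_choice)
    show "\<exists>x. valid x \<and> (0 = (0::nat) \<longrightarrow> x = (R0, b0, a0, 1))"
      using a0 b0 nz R0 by (auto simp: valid_def)
    fix x and n :: nat
    assume x: "valid x \<and> (n = 0 \<longrightarrow> x = (R0, b0, a0, 1))"
    obtain R b a \<beta> where xe: "x = (R, b, a, \<beta>)" by (cases x) auto
    have v: "R \<ge> 0" "b holomorphic_on UNIV" "a holomorphic_on UNIV" "a 0 \<noteq> 0 \<or> b 0 \<noteq> 0" "\<beta> > 0"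
      using x by (simp_all add: valid_def xe)
    \<comment> \<open>the new layer must respect both the old eigenvalues and its own precision\<close>
    define \<eta> where "\<eta> = min \<beta> (\<delta> n)"
    have \<eta>: "\<eta> > 0" "\<eta> \<le> \<beta>" "\<eta> \<le> \<delta> n" using v(5) \<delta>[of n] by (auto simp: \<eta>_def)
    obtain q \<mu> :: complex and L rad \<kappa> \<rho> :: real where s:
      "L \<ge> 1" "cmod q \<le> \<eta>" "cmod q powr p * (R + L) ^ d \<le> \<eta>"
      "protected_zero (\<lambda>z. slab_val (z - q) (b z) (a z) L) (\<lambda>z. slab_der (z - q) (b z) (a z) L) \<mu> rad \<kappa> \<rho>"
      "\<And>z. z \<in> cball \<mu> rad \<Longrightarrow> cmod (z - of_real (E n)) < \<eta>"
      by (rule add_layer[OF v(3,2,4) E[of n] \<eta>(1) d v(1)]) (rule that; assumption)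
    define y where "y = (R + L, (\<lambda>z. slab_val (z - q) (b z) (a z) L), (\<lambda>z. slab_der (z - q) (b z) (a z) L), min \<beta> (\<kappa> * \<rho>))"
    have "\<kappa> > 0" "\<rho> > 0" using s(4) unfolding protected_zero_def by blast+
    then have "valid y"
      using v s(1) slab_val_holomorphic[OF v(2,3), of q L] slab_map_eq_0[of "0 - q" "b 0" "a 0" L]
      by (auto simp: valid_def y_def)
    moreover have "step n x q \<mu> rad \<kappa> \<rho> y"
    proof -
      have "\<forall>z\<in>cball \<mu> rad. cmod (z - of_real (E n)) < \<delta> n" using s(5) \<eta>(3) less_le_trans by blast
      then show ?thesis
        unfolding step_def xe y_def case_prod_conv using s \<eta> by (simp add: order_trans[OF s(2)] order_trans[OF s(3)])
    qed
    ultimately show "\<exists>y. (valid y \<and> (Suc n = 0 \<longrightarrow> y = (R0, b0, a0, 1))) \<and> (\<exists>q \<mu> rad \<kappa> \<rho>. step n x q \<mu> rad \<kappa> \<rho> y)"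
      by (intro exI[of _ y] conjI) (simp_all, blast)
  qed
  then obtain X where X0: "\<forall>n. (valid (X n) \<and> (n = 0 \<longrightarrow> X n = (R0, b0, a0, 1))) \<and> (\<exists>q \<mu> rad \<kappa> \<rho>. step n (X n) q \<mu> rad \<kappa> \<rho> (X (Suc n)))"
    by (elim exE)
  then have X: "valid (X n)" "X 0 = (R0, b0, a0, 1)" for n by simp_all
  have "\<forall>n. \<exists>q \<mu> rad \<kappa> \<rho>. step n (X n) q \<mu> rad \<kappa> \<rho> (X (Suc n))" using X0 by simp
  then have "\<exists>q \<mu> rad \<kappa> \<rho>. \<forall>n. step n (X n) (q n) (\<mu> n) (rad n) (\<kappa> n) (\<rho> n) (X (Suc n))"
    by (simp only: choice_iff)
  then obtain q \<mu> rad \<kappa> \<rho> where st: "\<forall>n. step n (X n) (q n) (\<mu> n) (rad n) (\<kappa> n) (\<rho> n) (X (Suc n))"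
    by (elim exE)
  define R where "R n = fst (X n)" for n
  define b where "b n = fst (snd (X n))" for n
  define a where "a n = fst (snd (snd (X n)))" for n
  define \<beta> where "\<beta> n = snd (snd (snd (X n)))" for n
  have Xe: "X n = (R n, b n, a n, \<beta> n)" for n by (simp add: R_def b_def a_def \<beta>_def)
  note s = st[rule_format, unfolded step_def Xe case_prod_conv]
  have hol: "b n holomorphic_on UNIV" "a n holomorphic_on UNIV" for n
    using X(1)[of n] by (auto simp: valid_def Xe)
  have init: "R 0 = R0" "b 0 = b0" "a 0 = a0" using X(2) by (simp_all add: R_def b_def a_def)
  have Rs: "R n + 1 \<le> R (Suc n)" for n using s[of n] by blast
  have Rm: "R n \<le> R (Suc n)" for n using Rs[of n] by linarith
  have ly: "layers q R z 0 (b0 z, a0 z) n = (b n z, a n z)" for z n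
  proof (induction n)
    case (Suc n)
    have "b (Suc n) = (\<lambda>z. slab_val (z - q n) (b n z) (a n z) (R (Suc n) - R n))"
      "a (Suc n) = (\<lambda>z. slab_der (z - q n) (b n z) (a n z) (R (Suc n) - R n))"
      using s[of n] by blast+
    then show ?case using Suc by simp
  qed (simp add: init)
  have \<beta>s: "\<beta> (Suc n) \<le> \<beta> n" "\<beta> (Suc n) \<le> \<kappa> n * \<rho> n" "cmod (q n) \<le> \<beta> n" for n using s[of n] by blast+
  have \<beta>m: "\<beta> j \<le> \<beta> n" if "n \<le> j" for n j
    using that by (induction j rule: dec_induct) (auto intro: order_trans[OF \<beta>s(1)])
  show ?thesis
  proof (rule that[OF init(1) Rs])
    show "cmod (q n) \<le> \<delta> n" "cmod (q n) powr p * R (Suc n) ^ d \<le> \<delta> n" for n using s[of n] by blast+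
    fix n
    have prot: "protected_zero (b (Suc n)) (a (Suc n)) (\<mu> n) (rad n) (\<kappa> n) (\<rho> n)" using s[of n] by blast
    then have k: "\<kappa> n > 0" "\<rho> n > 0" "2 * \<rho> n \<le> \<kappa> n" unfolding protected_zero_def by blast+
    have qj: "cmod (q j) + (\<rho> n)\<^sup>2 \<le> 2 * \<kappa> n * \<rho> n" if "j \<ge> Suc n" for j
    proof -
      have "cmod (q j) \<le> \<kappa> n * \<rho> n" using \<beta>s(3)[of j] \<beta>m[OF that] \<beta>s(2)[of n] by linarith
      moreover have "\<rho> n * \<rho> n \<le> \<kappa> n * \<rho> n" using k by (intro mult_right_mono) auto
      ultimately show ?thesis by (simp add: power2_eq_square)
    qed
    have "\<exists>z\<in>cball (\<mu> n) (rad n). \<forall>m. cone_form (\<rho> n) (- csqrt z) (layers q R z (Suc n) (b (Suc n) z, a (Suc n) z) m) \<le> 0"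
      by (rule persistent_resonance[where q=q and R=R and i="Suc n", OF hol(2)[of "Suc n"] hol(1)[of "Suc n"] prot])
        (use qj Rm in blast)+
    then obtain z where z: "z \<in> cball (\<mu> n) (rad n)"
      "\<And>m. cone_form (\<rho> n) (- csqrt z) (layers q R z (Suc n) (b (Suc n) z, a (Suc n) z) m) \<le> 0" by blast
    have cone: "cone_form (\<rho> n) (- csqrt z) (layers q R z 0 (b0 z, a0 z) m) \<le> 0" if "m \<ge> Suc n" for m
    proof -
      from le_Suc_ex[OF that] obtain j where "m = Suc n + j" by blast
      then show ?thesis using z(2)[of j] by (simp only: layers_add ly)
    qed
    have "cmod (z - of_real (E n)) < \<delta> n" using s[of n] z(1) by blast
    moreover have "Im z < 0" "\<kappa> n \<le> Im (- csqrt z)" using prot z(1) unfolding protected_zero_def by blast+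
    ultimately show "\<exists>z \<kappa> \<rho>. cmod (z - of_real (E n)) < \<delta> n \<and> Im z < 0 \<and> \<rho> > 0 \<and> 2 * \<rho> \<le> \<kappa> \<and> \<kappa> \<le> Im (- csqrt z) \<and>
       (\<forall>j\<ge>Suc n. cmod (q j) + \<rho>\<^sup>2 \<le> 2 * \<kappa> * \<rho>) \<and>
       (\<forall>m\<ge>Suc n. cone_form \<rho> (- csqrt z) (layers q R z 0 (b0 z, a0 z) m) \<le> 0)"
      using k qj cone by blast
  qed
qed

section \<open>Size of the potential and accumulation of eigenvalues\<close>

text \<open>The absolute value of every rational number is taken as a target with every precision $1/(m+1)$; adding the precision
  keeps the targets positive.\<close>

lemma dense_targets:
  obtains E \<delta> :: "nat \<Rightarrow> real" where "\<And>n. E n > 0" "\<And>n. \<delta> n > 0"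
    "\<And>t \<epsilon>. t \<ge> 0 \<Longrightarrow> \<epsilon> > 0 \<Longrightarrow> \<exists>n. \<bar>E n - t\<bar> + \<delta> n < \<epsilon>"
proof -
  define e :: "nat \<Rightarrow> real" where "e = from_nat_into \<rat>"
  define \<delta> where "\<delta> n = 1 / real (Suc (snd (prod_decode n)))" for n
  define E where "E n = \<bar>e (fst (prod_decode n))\<bar> + \<delta> n" for n
  show ?thesis
  proof (rule that[of E \<delta>])
    show \<delta>: "\<delta> n > 0" for n by (simp add: \<delta>_def)
    show "E n > 0" for n unfolding E_def using \<delta>[of n] by (intro add_nonneg_pos) auto
    fix t \<epsilon> :: real assume t: "t \<ge> 0" "\<epsilon> > 0"
    obtain m where m: "1 / real (Suc m) < \<epsilon> / 4" using nat_approx_posE[of "\<epsilon> / 4"] t by auto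
    obtain r where r: "r \<in> \<rat>" "t < r" "r < t + \<epsilon> / 4" using Rats_dense_in_real[of t "t + \<epsilon> / 4"] t by auto
    obtain k where k: "e k = r" using from_nat_into_surj[OF countable_rat r(1)] unfolding e_def by blast
    define n where "n = prod_encode (k, m)"
    have "\<delta> n = 1 / real (Suc m)" "E n = r + 1 / real (Suc m)"
      using r(2) t(1) by (simp_all add: \<delta>_def E_def n_def k)
    then show "\<exists>n. \<bar>E n - t\<bar> + \<delta> n < \<epsilon>" using m r by (intro exI[of _ n]) auto
  qed
qed

lemma powr_add_le:
  fixes x y p :: real
  assumes "x \<ge> 0" "y \<ge> 0" "p > 0"
  shows "(x + y) powr p \<le> 2 powr p * (x powr p + y powr p)"
proof -
  have "(x + y) powr p \<le> (2 * max x y) powr p" using assms by (intro powr_mono2) auto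
  also have "\<dots> = 2 powr p * max x y powr p" using assms by (simp add: powr_mult)
  also have "max x y powr p \<le> x powr p + y powr p" by (auto simp: max_def)
  finally show ?thesis by (simp add: mult_left_mono)
qed

lemma inverse_square_tail_small:
  fixes c p A :: real and d :: nat
  assumes "p > real d" "d \<ge> 1" "A > 0" "c \<ge> 0"
  obtains N0 S where "\<And>N. N \<ge> N0 \<Longrightarrow> (\<lambda>n. (c / (real (n + N))\<^sup>2) powr p * real (Suc (n + N)) ^ d) sums S N"
    "\<And>N. N \<ge> N0 \<Longrightarrow> S N \<le> A" "N0 \<ge> (1::nat)"
proof -
  define u where "u n = (c / (real n)\<^sup>2) powr p * real (Suc n) ^ d" for n
  have "u n = c powr p * (real n powr (- 2 * p) * real (Suc n) ^ d)" if "n \<ge> 1" for n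
  proof -
    have "(c / (real n)\<^sup>2) powr p = c powr p * real n powr (- 2 * p)"
    proof -
      have "(real n)\<^sup>2 = real n powr 2" using that by (simp add: powr_numeral)
      then have "(c / (real n)\<^sup>2) powr p = c powr p / (real n powr 2) powr p"
        using assms(4) by (simp only: powr_divide powr_ge_zero)
      also have "\<dots> = c powr p * real n powr (- 2 * p)"
        unfolding powr_powr by (simp add: powr_minus_divide)
      finally show ?thesis .
    qed
    then show ?thesis by (simp add: u_def mult.assoc)
  qed
  then have "\<forall>\<^sub>F n in sequentially. u n = c powr p * (real n powr (- 2 * p) * real (Suc n) ^ d)"
    by (rule eventually_sequentiallyI)
  from summable_cong[OF this] have "summable u"
    using summable_mult[OF summable_inverse_square_power[OF assms(1,2)], of "c powr p"] by blast
  then have "\<exists>N. \<forall>n\<ge>N. norm (\<Sum>i. u (i + n)) < A" by (intro suminf_exist_split assms)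
  then obtain N where N: "\<And>n. n \<ge> N \<Longrightarrow> norm (\<Sum>i. u (i + n)) < A" by blast
  show ?thesis
  proof (rule that[of "max N 1" "\<lambda>n. \<Sum>i. u (i + n)"])
    show "(\<lambda>n. (c / (real (n + k))\<^sup>2) powr p * real (Suc (n + k)) ^ d) sums (\<Sum>i. u (i + k))" for k
      using summable_sums[OF summable_ignore_initial_segment[OF \<open>summable u\<close>, of k]] by (simp add: u_def)
    show "(\<Sum>i. u (i + n)) \<le> A" if "n \<ge> max N 1" for n using N[of n] that by simp
  qed simp
qed

text \<open>The layer constants and the centrifugal term are integrated separately. The first contribution is the
  cost controlled in the construction of the layers; each layer is charged with the volume of the whole
  ball around it.\<close>

lemma layered_potential_Lp:
  fixes \<alpha> p A :: real and q :: "nat \<Rightarrow> complex" and R :: "nat \<Rightarrow> real" and N :: nat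
  defines "V \<equiv> \<lambda>x :: real ^ 'n::finite. layered_profile \<alpha> q R ((norm x)\<^sup>2)"
  assumes p: "p > 0" and R: "strict_mono R" "1 \<le> R 0" "\<And>s. \<exists>k. s \<le> R k" and N: "R 0 = real N"
    and q: "(\<lambda>n. cmod (q n) powr p * R (Suc n) ^ CARD('n)) sums S1" "S1 \<le> A"
    and c: "(\<lambda>n. (\<bar>\<alpha> * (\<alpha> - 1)\<bar> / (real (n + N))\<^sup>2) powr p * real (Suc (n + N)) ^ CARD('n)) sums S2" "S2 \<le> A"
  shows "V \<in> Lp_space p" "(LINT x|lebesgue. cmod (V x) powr p) \<le> 2 powr p * (2 * (unit_ball_vol (real CARD('n)) * A))"
proof -
  let ?S = "\<lambda>i. (R i)\<^sup>2"
  let ?I = "\<lambda>x :: real ^ 'n. piece_index ?S ((norm x)\<^sup>2)"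
  define c where "c = \<bar>\<alpha> * (\<alpha> - 1)\<bar>"
  have Rpos: "R j \<ge> 1" for j using R(2) strict_mono_leD[OF R(1), of 0 j] by simp
  have unb: "\<exists>k. (norm x)\<^sup>2 \<le> ?S k" for x :: "real ^ 'n"
  proof -
    obtain k where "norm x \<le> R k" using R(3) by blast
    then show ?thesis by (intro exI[of _ k] power_mono) auto
  qed
  have idx: "norm x \<le> R (?I x)" "j < ?I x \<Longrightarrow> R j < norm x" for x :: "real ^ 'n" and j
  proof -
    obtain k where k: "(norm x)\<^sup>2 \<le> ?S k" using unb by blast
    have "(norm x)\<^sup>2 \<le> (R (?I x))\<^sup>2" by (rule piece_index_bounds(1)[where S="?S", OF k])
    moreover have "0 \<le> R (?I x)" using Rpos[of "?I x"] by linarith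
    ultimately show "norm x \<le> R (?I x)" by (rule power2_le_imp_le)
    assume "j < ?I x"
    then have "(R j)\<^sup>2 < (norm x)\<^sup>2" by (rule piece_index_bounds(2)[where S="?S", OF k])
    then show "R j < norm x" by (rule power2_less_imp_less) (rule norm_ge_zero)
  qed
  define f1 where "f1 x = (case ?I x of 0 \<Rightarrow> 0 | Suc j \<Rightarrow> cmod (q j) powr p)" for x :: "real ^ 'n"
  define f2 where "f2 x = (if norm x > R 0 then (c / (norm x)\<^sup>2) powr p else 0)" for x :: "real ^ 'n"
  have nm: "(\<lambda>x :: real ^ 'n. (norm x)\<^sup>2) \<in> borel \<rightarrow>\<^sub>M borel" by measurable
  have mV: "V \<in> borel_measurable lebesgue"
    unfolding V_def by (rule borel_measurable_imp_lebesgue[OF measurable_compose[OF nm layered_profile_measurable]])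
  have "(\<lambda>i. case i of 0 \<Rightarrow> 0 | Suc j \<Rightarrow> cmod (q j) powr p) \<in> count_space UNIV \<rightarrow>\<^sub>M borel" by simp
  from measurable_compose[OF measurable_compose[OF nm piece_index_measurable] this]
  have m1: "f1 \<in> borel_measurable lebesgue" unfolding f1_def by (rule borel_measurable_imp_lebesgue)
  have m2: "f2 \<in> borel_measurable lebesgue"
    unfolding f2_def by (rule borel_measurable_imp_lebesgue) measurable
  have i1: "integrable lebesgue f1" "(LINT x|lebesgue. f1 x) \<le> unit_ball_vol (real CARD('n)) * S1"
  proof -
    have maj: "\<exists>n. norm x \<le> R (Suc n) \<and> f1 x \<le> cmod (q n) powr p" if "f1 x \<noteq> 0" for x
    proof (cases "?I x")
      case (Suc j)
      then show ?thesis using idx(1)[of x] by (intro exI[of _ j]) (simp add: f1_def)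
    qed (use that in \<open>simp add: f1_def\<close>)
    have nn: "0 \<le> f1 x" for x by (simp add: f1_def split: nat.splits)
    have Rn: "0 \<le> R (Suc n)" for n using Rpos[of "Suc n"] by simp
    have q': "(\<lambda>n. cmod (q n) powr p * R (Suc n) ^ DIM(real ^ 'n)) sums S1" using q(1) by simp
    show "integrable lebesgue f1"
      by (rule radial_majorant(1)[OF m1 nn _ Rn maj q']) auto
    show "(LINT x|lebesgue. f1 x) \<le> unit_ball_vol (real CARD('n)) * S1"
      using radial_majorant(2)[OF m1 nn _ Rn maj q'] by simp
  qed
  have i2: "integrable lebesgue f2" "(LINT x|lebesgue. f2 x) \<le> unit_ball_vol (real CARD('n)) * S2"
  proof -
    have maj: "\<exists>n. norm x \<le> real (Suc (n + N)) \<and> f2 x \<le> (c / (real (n + N))\<^sup>2) powr p" if "f2 x \<noteq> 0" for x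
    proof -
      have x: "norm x > R 0" using that by (auto simp: f2_def split: if_splits)
      then have "N \<le> nat \<lfloor>norm x\<rfloor>" using N by (simp add: le_nat_floor)
      then obtain n where n: "nat \<lfloor>norm x\<rfloor> = n + N" by (metis add.commute le_Suc_ex)
      have le: "real (n + N) \<le> norm x" "norm x \<le> real (Suc (n + N))"
        unfolding n[symmetric] by (simp_all, linarith)
      have "n + N \<ge> 1" using N R(2) by linarith
      then have "c / (norm x)\<^sup>2 \<le> c / (real (n + N))\<^sup>2"
        using le(1) by (intro divide_left_mono power_mono mult_pos_pos zero_less_power) (auto simp: c_def)
      then have "f2 x \<le> (c / (real (n + N))\<^sup>2) powr p"
        using x p by (auto simp: f2_def c_def intro!: powr_mono2)
      then show ?thesis using le(2) by blast
    qed
    have nn: "0 \<le> f2 x" for x by (simp add: f2_def)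
    have c': "(\<lambda>n. (c / (real (n + N))\<^sup>2) powr p * real (Suc (n + N)) ^ DIM(real ^ 'n)) sums S2" using c(1) by (simp add: c_def)
    show "integrable lebesgue f2"
      by (rule radial_majorant(1)[OF m2 nn _ _ maj c']) auto
    show "(LINT x|lebesgue. f2 x) \<le> unit_ball_vol (real CARD('n)) * S2"
      using radial_majorant(2)[OF m2 nn _ _ maj c'] by simp
  qed
  have pw: "cmod (V x) powr p \<le> 2 powr p * (f1 x + f2 x)" for x
  proof (cases "?I x")
    case 0
    then show ?thesis using p by (simp add: V_def layered_profile_def f1_def f2_def)
  next
    case (Suc j)
    have "R 0 < norm x" using idx(2)[of 0 x] Suc by simp
    have "cmod (V x) \<le> cmod (q j) + cmod (of_real (\<alpha> * (\<alpha> - 1) / (norm x)\<^sup>2))"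
      unfolding V_def layered_profile_def Suc nat.case by (rule norm_triangle_ineq4)
    also have "cmod (of_real (\<alpha> * (\<alpha> - 1) / (norm x)\<^sup>2)) = c / (norm x)\<^sup>2"
      by (simp only: norm_of_real abs_divide c_def) simp
    finally have "cmod (V x) powr p \<le> (cmod (q j) + c / (norm x)\<^sup>2) powr p"
      using p by (intro powr_mono2) auto
    also have "\<dots> \<le> 2 powr p * (cmod (q j) powr p + (c / (norm x)\<^sup>2) powr p)"
      using p by (intro powr_add_le) (auto simp: c_def)
    finally show ?thesis using Suc \<open>R 0 < norm x\<close> by (simp add: f1_def f2_def)
  qed
  have i12: "integrable lebesgue (\<lambda>x. 2 powr p * (f1 x + f2 x))"
    by (intro integrable_mult_right Bochner_Integration.integrable_add i1 i2)
  have iV: "integrable lebesgue (\<lambda>x. cmod (V x) powr p)"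
  proof (rule Bochner_Integration.integrable_bound[OF i12])
    show "(\<lambda>x. cmod (V x) powr p) \<in> borel_measurable lebesgue" using mV by measurable
    show "AE x in lebesgue. norm (cmod (V x) powr p) \<le> norm (2 powr p * (f1 x + f2 x))"
    proof (rule AE_I2)
      fix x
      have "norm (cmod (V x) powr p) = cmod (V x) powr p" by simp
      also have "\<dots> \<le> 2 powr p * (f1 x + f2 x)" by (rule pw)
      also have "\<dots> \<le> norm (2 powr p * (f1 x + f2 x))" by simp
      finally show "norm (cmod (V x) powr p) \<le> norm (2 powr p * (f1 x + f2 x))" .
    qed
  qed
  show "V \<in> Lp_space p" using mV iV by (simp add: Lp_space_def)
  have "(LINT x|lebesgue. cmod (V x) powr p) \<le> (LINT x|lebesgue. 2 powr p * (f1 x + f2 x))"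
    by (intro integral_mono iV i12 pw)
  also have "\<dots> = 2 powr p * ((LINT x|lebesgue. f1 x) + (LINT x|lebesgue. f2 x))" using i1(1) i2(1) by simp
  also have "\<dots> \<le> 2 powr p * (unit_ball_vol (real CARD('n)) * A + unit_ball_vol (real CARD('n)) * A)"
    by (intro mult_left_mono add_mono order_trans[OF i1(2)] order_trans[OF i2(2)] q(2) c(2)) auto
  finally show "(LINT x|lebesgue. cmod (V x) powr p) \<le> 2 powr p * (2 * (unit_ball_vol (real CARD('n)) * A))"
    by (simp only: mult_2)
qed

lemma layered_profile_bound:
  assumes R: "strict_mono R" "1 \<le> R 0" "\<And>s. \<exists>k. s \<le> R k" and s: "s > (R m)\<^sup>2" and j0: "\<And>j. j \<ge> m \<Longrightarrow> cmod (q j) \<le> B"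
  shows "cmod (layered_profile \<alpha> q R s) \<le> B + \<bar>\<alpha> * (\<alpha> - 1)\<bar> / s"
proof -
  let ?S = "\<lambda>i. (R i)\<^sup>2"
  have Rpos: "R j \<ge> 1" for j using R(2) strict_mono_leD[OF R(1), of 0 j] by simp
  obtain k where "s \<le> R k" using R(3) by blast
  then have "s \<le> ?S k" using Rpos[of k] power_increasing[of 1 2 "R k"] by simp
  then have le: "s \<le> ?S (piece_index ?S s)" by (rule piece_index_bounds(1)[where S="?S"])
  have "\<not> piece_index ?S s \<le> m"
  proof
    assume "piece_index ?S s \<le> m"
    then have "R (piece_index ?S s) \<le> R m" by (rule strict_mono_leD[OF R(1)])
    then have "?S (piece_index ?S s) \<le> ?S m" using Rpos[of "piece_index ?S s"] by (intro power_mono) auto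
    then show False using le s by linarith
  qed
  then obtain j where j: "piece_index ?S s = Suc j" "j \<ge> m" by (cases "piece_index ?S s") auto
  have "s > 0" using s by (meson le_less_trans zero_le_power2)
  have "cmod (layered_profile \<alpha> q R s) \<le> cmod (q j) + cmod (of_real (\<alpha> * (\<alpha> - 1) / s))"
    unfolding layered_profile_def j nat.case by (rule norm_triangle_ineq4)
  also have "cmod (of_real (\<alpha> * (\<alpha> - 1) / s)) = \<bar>\<alpha> * (\<alpha> - 1)\<bar> / s"
    using \<open>s > 0\<close> by (simp only: norm_of_real abs_divide) 
  finally show ?thesis using j0[OF j(2)] by simp
qed

theorem theorem1:
  fixes p \<E> :: real
  assumes "p > real CARD('n::finite)" and "\<E> > 0"
  shows "\<exists>V :: real ^ 'n \<Rightarrow> complex.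
    V \<in> Linf_space \<inter> Lp_space p \<and>
    max (Linf_norm V) (Lp_norm p V) \<le> \<E> \<and>
    decays_at_infinity V \<and>
    infinite {\<mu>. eigenvalue (schroedinger_op V) \<mu> \<and> Im \<mu> < 0} \<and>
    (\<forall>t\<ge>0. complex_of_real t islimpt {\<mu>. eigenvalue (schroedinger_op V) \<mu> \<and> Im \<mu> < 0})"
proof -
  let ?d = "CARD('n)"
  have d: "?d \<ge> 1" by (simp add: Suc_leI)
  then have p: "p > 0" using assms(1) by linarith
  define \<alpha> where "\<alpha> = (real ?d - 1) / 2"
  have \<alpha>: "real ?d = 2 * \<alpha> + 1" by (simp add: \<alpha>_def field_simps)
  define c where "c = \<bar>\<alpha> * (\<alpha> - 1)\<bar>"
  have c0: "c \<ge> 0" by (simp add: c_def)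
  define \<omega> where "\<omega> = unit_ball_vol (real ?d)"
  have \<omega>: "\<omega> > 0" by (simp add: \<omega>_def)
  \<comment> \<open>the value for which the bound of \<open>layered_potential_Lp\<close> equals \<open>\<E> powr p\<close>\<close>
  define A where "A = \<E> powr p / (2 powr p * (2 * \<omega>))"
  have A: "A > 0" using assms(2) \<omega> by (simp add: A_def)
  obtain N0 S2 where N0: "\<And>N. N \<ge> N0 \<Longrightarrow> (\<lambda>n. (c / (real (n + N))\<^sup>2) powr p * real (Suc (n + N)) ^ ?d) sums S2 N"
    "\<And>N. N \<ge> N0 \<Longrightarrow> S2 N \<le> A" "N0 \<ge> (1::nat)"
    by (rule inverse_square_tail_small[OF assms(1) d A c0]) (rule that; assumption)
  obtain N1 where N1: "real N1 \<ge> 2 * c / \<E>" using real_arch_simple by blast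
  define N where "N = max N0 N1"
  have N: "N \<ge> N0" "real N \<ge> 1" "real N \<ge> 2 * c / \<E>" using N0(3) N1 by (auto simp: N_def)
  have cN: "c / s \<le> \<E> / 2" if "s \<ge> (real N)\<^sup>2" for s
  proof -
    have "real N * 1 \<le> real N * real N" using N(2) by (intro mult_left_mono) auto
    then have s: "s \<ge> real N" "s > 0" using that N(2) unfolding power2_eq_square by linarith+
    then have "2 * c / \<E> \<le> s" using N(3) by linarith
    then show ?thesis using s assms(2) by (simp add: field_simps)
  qed
  have d1: "2 * \<alpha> + 1 \<ge> 1" using d unfolding \<alpha>[symmetric] by simp
  obtain F F' F'' :: "complex \<Rightarrow> complex" where F: "\<And>z. (F has_field_derivative F' z) (at z)"
    "\<And>z. (F' has_field_derivative F'' z) (at z)" "continuous_on UNIV F''"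
    "\<And>z. 4 * z * F'' z + 2 * of_real (2 * \<alpha> + 1) * F' z + F z = 0" "F 0 = 1"
    by (rule radial_free_solution[OF d1]) (rule that; assumption)
  let ?R0 = "real N"
  define b0 where "b0 z = of_real (?R0 powr \<alpha>) * F (z * of_real (?R0\<^sup>2))" for z
  define a0 where "a0 z = of_real (?R0 powr \<alpha>) * (of_real (2 * ?R0) * z * F' (z * of_real (?R0\<^sup>2))
        + of_real (\<alpha> / ?R0) * F (z * of_real (?R0\<^sup>2)))" for z
  have hF: "(\<lambda>z. G (z * of_real (?R0\<^sup>2))) holomorphic_on UNIV" if "\<And>z. (G has_field_derivative G' z) (at z)" for G G'
  proof -
    have "G holomorphic_on UNIV" using that unfolding holomorphic_on_def field_differentiable_def by blast
    from holomorphic_on_compose_gen[OF _ this, of "\<lambda>z. z * of_real (?R0\<^sup>2)" UNIV]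
    show ?thesis by (simp add: o_def holomorphic_intros)
  qed
  have hol: "a0 holomorphic_on UNIV" "b0 holomorphic_on UNIV"
    unfolding a0_def[abs_def] b0_def[abs_def] by (intro holomorphic_intros hF[OF F(1)] hF[OF F(2)])+
  have nz: "a0 0 \<noteq> 0 \<or> b0 0 \<noteq> 0" using N(2) F(5) by (simp add: b0_def)
  obtain E \<delta>0 :: "nat \<Rightarrow> real" where E: "\<And>n. E n > 0" "\<And>n. \<delta>0 n > 0"
    "\<And>t \<epsilon>. t \<ge> 0 \<Longrightarrow> \<epsilon> > 0 \<Longrightarrow> \<exists>n. \<bar>E n - t\<bar> + \<delta>0 n < \<epsilon>"
    by (rule dense_targets) (rule that; assumption)
  \<comment> \<open>the geometric factor makes the costs summable and the layer constants tend to 0\<close>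
  define \<delta> where "\<delta> n = min (\<delta>0 n) (min A (\<E> / 2) * (1 / 2) ^ Suc n)" for n
  have \<delta>: "\<delta> n > 0" "\<delta> n \<le> \<delta>0 n" "\<delta> n \<le> A * (1 / 2) ^ Suc n" "\<delta> n \<le> \<E> / 2 * (1 / 2) ^ Suc n" for n
  proof -
    show "\<delta> n > 0" using E(2)[of n] A assms(2) by (simp add: \<delta>_def)
    show "\<delta> n \<le> \<delta>0 n" by (simp add: \<delta>_def)
    have "min A (\<E> / 2) * (1 / 2) ^ Suc n \<le> A * (1 / 2) ^ Suc n"
         "min A (\<E> / 2) * (1 / 2) ^ Suc n \<le> \<E> / 2 * (1 / 2) ^ Suc n" by (intro mult_right_mono; simp)+
    then show "\<delta> n \<le> A * (1 / 2) ^ Suc n" "\<delta> n \<le> \<E> / 2 * (1 / 2) ^ Suc n" unfolding \<delta>_def by linarith+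
  qed
  obtain R q where Rq: "R 0 = ?R0" "\<And>n. R n + 1 \<le> R (Suc n)"
    "\<And>n. cmod (q n) \<le> \<delta> n" "\<And>n. cmod (q n) powr p * R (Suc n) ^ ?d \<le> \<delta> n"
    "\<And>n. \<exists>z \<kappa> \<rho>. cmod (z - of_real (E n)) < \<delta> n \<and> Im z < 0 \<and> \<rho> > 0 \<and> 2 * \<rho> \<le> \<kappa> \<and> \<kappa> \<le> Im (- csqrt z) \<and>
       (\<forall>j\<ge>Suc n. cmod (q j) + \<rho>\<^sup>2 \<le> 2 * \<kappa> * \<rho>) \<and>
       (\<forall>m\<ge>Suc n. cone_form \<rho> (- csqrt z) (layers q R z 0 (b0 z, a0 z) m) \<le> 0)"
    by (rule resonance_sequence[OF hol nz E(1) \<delta>(1) d assms(1) of_nat_0_le_iff[of N]]) (rule that; assumption)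
  have R: "strict_mono R" "1 \<le> R 0" "\<And>s. \<exists>k. s \<le> R k"
  proof -
    have "R n < R (Suc n)" for n using Rq(2)[of n] by linarith
    then show "strict_mono R" by (simp add: strict_mono_Suc_iff)
    show "1 \<le> R 0" using Rq(1) N(2) by simp
    have "real n \<le> R n" for n
    proof (induction n)
      case (Suc n)
      then show ?case using Rq(2)[of n] by simp
    qed (simp add: Rq(1))
    then show "\<exists>k. s \<le> R k" for s using real_arch_simple[of s] order_trans by blast
  qed
  define V where "V x = layered_profile \<alpha> q R ((norm x)\<^sup>2)" for x :: "real ^ 'n"
  have pow1: "(1 / 2 :: real) ^ Suc n \<le> 1" for n by (rule power_le_one) auto
  have q_le: "cmod (q n) \<le> \<E> / 2" for n
    using Rq(3)[of n] \<delta>(4)[of n] mult_left_mono[OF pow1[of n], of "\<E> / 2"] assms(2) by linarith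
  have geo: "(\<lambda>n. A * (1 / 2) ^ Suc n) sums A"
    using sums_mult[OF power_half_series, of A] by simp
  have sm: "summable (\<lambda>n. cmod (q n) powr p * R (Suc n) ^ ?d)"
  proof (rule summable_comparison_test'[OF sums_summable[OF geo]])
    fix n :: nat
    have "R (Suc n) \<ge> 1" using R(2) strict_mono_leD[OF R(1), of 0 "Suc n"] by simp
    then have "norm (cmod (q n) powr p * R (Suc n) ^ ?d) = cmod (q n) powr p * R (Suc n) ^ ?d" by simp
    then show "norm (cmod (q n) powr p * R (Suc n) ^ ?d) \<le> A * (1 / 2) ^ Suc n"
      using Rq(4)[of n] \<delta>(3)[of n] by linarith
  qed
  have S1: "(\<Sum>n. cmod (q n) powr p * R (Suc n) ^ ?d) \<le> A"
  proof -
    have "(\<Sum>n. cmod (q n) powr p * R (Suc n) ^ ?d) \<le> (\<Sum>n. A * (1 / 2) ^ Suc n)"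
    proof (rule suminf_le[OF _ sm sums_summable[OF geo]])
      show "cmod (q n) powr p * R (Suc n) ^ ?d \<le> A * (1 / 2) ^ Suc n" for n
        using Rq(4)[of n] \<delta>(3)[of n] by linarith
    qed
    then show ?thesis using sums_unique[OF geo] by simp
  qed
  note Lp = layered_potential_Lp[where 'n='n, OF p R Rq(1) summable_sums[OF sm] S1 N0(1)[OF N(1), unfolded c_def] N0(2)[OF N(1)], folded V_def]
  have VLp: "V \<in> Lp_space p" using Lp(1) by (simp add: V_def[abs_def])
  have mV: "V \<in> borel_measurable lebesgue" using VLp by (simp add: Lp_space_def)
  have bound: "cmod (V x) \<le> \<E>" for x
  proof (cases "(norm x)\<^sup>2 > (R 0)\<^sup>2")
    case True
    have "cmod (V x) \<le> \<E> / 2 + c / (norm x)\<^sup>2"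
      unfolding V_def c_def by (rule layered_profile_bound[OF R True q_le])
    also have "c / (norm x)\<^sup>2 \<le> \<E> / 2" 
      by (rule cN) (use True in \<open>simp only: Rq(1) less_imp_le\<close>)
    finally show ?thesis by simp
  next
    case False
    then have "piece_index (\<lambda>i. (R i)\<^sup>2) ((norm x)\<^sup>2) = 0" by (intro piece_index_eqI) auto
    then show ?thesis using assms(2) by (simp add: V_def layered_profile_def)
  qed
  have ess: "esssup lebesgue (\<lambda>x. ereal (cmod (V x))) \<le> ereal \<E>"
    using mV bound by (intro esssup_I) auto
  have VLinf: "V \<in> Linf_space"
    unfolding Linf_space_def
  proof (intro CollectI conjI mV)
    show "esssup lebesgue (\<lambda>x. ereal (cmod (V x))) < \<infinity>" by (rule le_less_trans[OF ess]) simp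
  qed
  have Linf: "Linf_norm V \<le> \<E>"
    unfolding Linf_norm_def using ess assms(2) by (cases "esssup lebesgue (\<lambda>x. ereal (cmod (V x)))") auto
  have LpN: "Lp_norm p V \<le> \<E>"
  proof -
    have "(LINT x|lebesgue. cmod (V x) powr p) \<le> 2 powr p * (2 * (\<omega> * A))"
      using Lp(2) by (simp add: V_def[abs_def] \<omega>_def)
    also have "\<dots> = \<E> powr p" using \<omega> by (simp add: A_def field_simps)
    finally have "(LINT x|lebesgue. cmod (V x) powr p) powr (1 / p) \<le> (\<E> powr p) powr (1 / p)"
      using p by (intro powr_mono2) auto
    then show ?thesis using p assms(2) by (simp add: Lp_norm_def powr_powr)
  qed
  have dec: "decays_at_infinity V"
    unfolding decays_at_infinity_def
  proof (intro allI impI)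
    fix \<epsilon> :: real assume \<epsilon>: "\<epsilon> > 0"
    obtain m where m: "(1 / 2 :: real) ^ m < \<epsilon> / \<E>" using real_arch_pow_inv[of "\<epsilon> / \<E>" "1 / 2"] \<epsilon> assms(2) by auto
    have qm: "cmod (q j) \<le> \<epsilon> / 2" if "j \<ge> m" for j
    proof -
      have "(1 / 2 :: real) ^ Suc j \<le> (1 / 2) ^ m" using that by (intro power_decreasing) auto
      then have "(1 / 2 :: real) ^ Suc j \<le> \<epsilon> / \<E>" using m by linarith
      then have "\<E> / 2 * (1 / 2) ^ Suc j \<le> \<E> / 2 * (\<epsilon> / \<E>)" by (rule mult_left_mono) (use assms(2) in simp)
      also have "\<dots> = \<epsilon> / 2" using assms(2) by simp
      finally show ?thesis using Rq(3)[of j] \<delta>(4)[of j] by linarith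
    qed
    define r where "r = max (R m + 1) (2 * c / \<epsilon>)"
    have "cmod (V x) \<le> \<epsilon>" if x: "norm x \<ge> r" for x
    proof -
      have "R m \<ge> 1" using R(2) strict_mono_leD[OF R(1), of 0 m] by simp
      then have x1: "norm x > R m" "norm x \<ge> 1" "norm x \<ge> 2 * c / \<epsilon>" using x by (auto simp: r_def)
      have "norm x * 1 \<le> norm x * norm x" using x1(2) by (intro mult_left_mono) auto
      then have "(norm x)\<^sup>2 \<ge> 2 * c / \<epsilon>" using x1(3) by (simp add: power2_eq_square)
      moreover have "(norm x)\<^sup>2 > 0" by (rule zero_less_power[OF less_le_trans[OF zero_less_one x1(2)]])
      moreover have "c / s \<le> \<epsilon> / 2" if "s > 0" "s \<ge> 2 * c / \<epsilon>" for s
        using that \<epsilon> by (simp add: field_simps)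
      ultimately have "c / (norm x)\<^sup>2 \<le> \<epsilon> / 2" by blast
      moreover have "(norm x)\<^sup>2 > (R m)\<^sup>2" using x1(1) \<open>R m \<ge> 1\<close> by (intro power_strict_mono) auto
      then have "cmod (V x) \<le> \<epsilon> / 2 + c / (norm x)\<^sup>2"
        unfolding V_def c_def by (rule layered_profile_bound[OF R _ qm])
      ultimately show ?thesis by linarith
    qed
    then show "\<exists>R. AE x in lebesgue. R \<le> norm x \<longrightarrow> cmod (V x) \<le> \<epsilon>" by (intro exI[of _ r] AE_I2) blast
  qed
  let ?Ev = "{\<mu>. eigenvalue (schroedinger_op V) \<mu> \<and> Im \<mu> < 0}"
  have ev: "\<exists>z\<in>?Ev. cmod (z - of_real (E n)) < \<delta> n" for n
  proof -
    obtain z \<kappa> \<rho> where z: "cmod (z - of_real (E n)) < \<delta> n" "Im z < 0" and \<rho>: "\<rho> > 0" "2 * \<rho> \<le> \<kappa>" "\<kappa> \<le> Im (- csqrt z)"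
       and qj: "\<forall>j\<ge>Suc n. cmod (q j) + \<rho>\<^sup>2 \<le> 2 * \<kappa> * \<rho>"
       and cone: "\<forall>m\<ge>Suc n. cone_form \<rho> (- csqrt z) (layers q R z 0 (b0 z, a0 z) m) \<le> 0"
      using Rq(5)[of n] by (elim exE conjE) (rule that; assumption)
    have "eigenvalue (schroedinger_op (\<lambda>x :: real ^ 'n. layered_profile \<alpha> q R ((norm x)\<^sup>2))) z"
    proof (rule layered_eigenvalue[where i="Suc n" and M="\<E> / 2" and \<rho>=\<rho> and \<kappa>=\<kappa> and ?b0.0="b0 z" and ?a0.0="a0 z", OF \<alpha> F R])
      show "b0 z = of_real (R 0 powr \<alpha>) * F (z * of_real ((R 0)\<^sup>2))" by (simp only: b0_def Rq(1))
      show "a0 z = of_real (R 0 powr \<alpha>) * (of_real (2 * R 0) * z * F' (z * of_real ((R 0)\<^sup>2))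
        + of_real (\<alpha> / R 0) * F (z * of_real ((R 0)\<^sup>2)))" by (simp only: a0_def Rq(1))
    qed (use q_le \<rho> qj cone in blast)+
    then have "eigenvalue (schroedinger_op V) z" by (simp add: V_def[abs_def])
    then show ?thesis using z by blast
  qed
  have lim: "complex_of_real t islimpt ?Ev" if t: "t \<ge> 0" for t
    unfolding islimpt_approachable
  proof (intro allI impI)
    fix \<epsilon> :: real assume "\<epsilon> > 0"
    then obtain n where n: "\<bar>E n - t\<bar> + \<delta>0 n < \<epsilon>" using E(3)[OF t] by blast
    obtain z where z: "z \<in> ?Ev" "cmod (z - of_real (E n)) < \<delta> n" using ev[of n] by blast
    have "z - of_real t = (z - of_real (E n)) + of_real (E n - t)" by simp
    then have "cmod (z - of_real t) \<le> cmod (z - of_real (E n)) + \<bar>E n - t\<bar>"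
      by (metis norm_triangle_ineq norm_of_real)
    then have "dist z (of_real t) < \<epsilon>" using z(2) \<delta>(2)[of n] n by (simp add: dist_norm)
    moreover have "z \<noteq> of_real t" using z(1) by auto
    ultimately show "\<exists>x'\<in>?Ev. x' \<noteq> complex_of_real t \<and> dist x' (complex_of_real t) < \<epsilon>" using z(1) by blast
  qed
  moreover have "infinite ?Ev" using lim[of 0] islimpt_finite by fastforce
  ultimately show ?thesis using VLinf VLp Linf LpN dec by (intro exI[of _ V]) auto
qed

end
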